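(* Let $(f_n)_n$ and $(g_n)_n$ be arbitrary sequences of probability densities on $[0,1]$. Then, as $n\to\infty$, $$\|P_{f_n}^n-P_{g_n}^n\|_{\mathrm{TV}}\to0\iff\|Q_{f_n}^n-Q_{g_n}^n\|_{\mathrm{TV}}\to0\iff n\int_0^1(\sqrt{f_n}-\sqrt{g_n})^2\to0,$$ and $$\|P_{f_n}^n-P_{g_n}^n\|_{\mathrm{TV}}\to1\iff\|Q_{f_n}^n-Q_{g_n}^n\|_{\mathrm{TV}}\to1\iff n\int_0^1(\sqrt{f_n}-\sqrt{g_n})^2\to\infty.$$ Moreover, for every $n>1$, $$H^2(Q_{f_n}^n,Q_{g_n}^n)\le H^2(P_{f_n}^n,P_{g_n}^n)\le H^2(Q_{f_n}^n,Q_{g_n}^n)+\frac{2\log n}{n}.$$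
   Context: For a probability density $f$ on $[0,1]$, $P_f^n$ denotes the law on $[0,1]^n$ of $n$ i.i.d. random variables with Lebesgue density $f$, and $Q_f^n$ denotes the law on the space of continuous functions $\mathcal{C}([0,1])$ (with Borel $\sigma$-algebra of the uniform norm) of $(Y_t)_{t\in[0,1]}$ with $Y_0=0$ and $dY_t=2\sqrt{f(t)}\,dt+n^{-1/2}dW_t$, $W$ a standard Brownian motion. For probability measures $P,Q$ with densities $p,q$ with respect to a dominating measure $\nu$: $\|P-Q\|_{\mathrm{TV}}=\tfrac12\int|p-q|\,d\nu$ and $H^2(P,Q)=\int(\sqrt p-\sqrt q)^2\,d\nu$. *)

theory Defs
  imports "HOL-Probability.Probability"
begin

section \<open>Total variation and Hellinger distance\<close>

text \<open>
  The canonical dominating measure \<open>P + Q\<close> is used below; the lemmas \<open>tv_dist_density\<close> and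
  \<open>hellinger_sq_density\<close> show that any other \<open>\<sigma>\<close>-finite dominating measure gives the same value.
\<close>

definition sum_measure :: "'a measure \<Rightarrow> 'a measure \<Rightarrow> 'a measure" where
  "sum_measure P Q = measure_of (space P) (sets P) (\<lambda>A. emeasure P A + emeasure Q A)"

definition tv_dist :: "'a measure \<Rightarrow> 'a measure \<Rightarrow> real" where
  "tv_dist P Q = (let \<nu> = sum_measure P Q in
     1 / 2 * (LINT x|\<nu>. \<bar>enn2real (RN_deriv \<nu> P x) - enn2real (RN_deriv \<nu> Q x)\<bar>))"

definition hellinger_sq :: "'a measure \<Rightarrow> 'a measure \<Rightarrow> real" where
  "hellinger_sq P Q = (let \<nu> = sum_measure P Q in
     LINT x|\<nu>. (sqrt (enn2real (RN_deriv \<nu> P x)) - sqrt (enn2real (RN_deriv \<nu> Q x)))\<^sup>2)"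

lemma space_sum_measure [simp]: "space (sum_measure P Q) = space P"
  by (simp add: sum_measure_def)

lemma sets_sum_measure [simp, measurable_cong]: "sets (sum_measure P Q) = sets P"
  by (simp add: sum_measure_def)

lemma emeasure_sum_measure:
  assumes "sets P = sets Q" "A \<in> sets P"
  shows "emeasure (sum_measure P Q) A = emeasure P A + emeasure Q A"
  using sum_measure_def
proof (rule emeasure_measure_of)
  show "countably_additive (sets (sum_measure P Q)) (\<lambda>A. emeasure P A + emeasure Q A)"
    unfolding countably_additive_def
    using assms(1) by (auto simp: suminf_add[symmetric] suminf_emeasure)
qed (use assms sets.space_closed[of P] in \<open>auto simp: positive_def\<close>)

lemma
  fixes p q :: "'a \<Rightarrow> real"
  assumes [measurable]: "p \<in> borel_measurable \<nu>" "q \<in> borel_measurable \<nu>"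
    and nonneg: "\<And>x. x \<in> space \<nu> \<Longrightarrow> 0 \<le> p x" "\<And>x. x \<in> space \<nu> \<Longrightarrow> 0 \<le> q x"
    and P: "P = density \<nu> p" "prob_space P"
    and Q: "Q = density \<nu> q" "prob_space Q"
  shows sum_measure_density: "sum_measure P Q = density \<nu> (\<lambda>x. p x + q x)"
    and RN_deriv_sum_measure_left: "AE x in sum_measure P Q. RN_deriv (sum_measure P Q) P x = ennreal (p x / (p x + q x))"
    and RN_deriv_sum_measure_right: "AE x in sum_measure P Q. RN_deriv (sum_measure P Q) Q x = ennreal (q x / (p x + q x))"
proof -
  have sets_eq: "sets P = sets \<nu>" "sets Q = sets \<nu>"
    by (simp_all add: P Q)
  show eq: "sum_measure P Q = density \<nu> (\<lambda>x. p x + q x)"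
  proof (rule measure_eqI)
    fix A assume "A \<in> sets (sum_measure P Q)"
    then have [measurable]: "A \<in> sets \<nu>"
      by (simp add: sets_eq)
    have "emeasure P A + emeasure Q A = (\<integral>\<^sup>+x. (ennreal (p x) + ennreal (q x)) * indicator A x \<partial>\<nu>)"
      by (simp add: P Q emeasure_density nn_integral_add[symmetric] distrib_right)
    also have "\<dots> = (\<integral>\<^sup>+x. ennreal (p x + q x) * indicator A x \<partial>\<nu>)"
      by (intro nn_integral_cong) (simp add: nonneg)
    finally show "emeasure (sum_measure P Q) A = emeasure (density \<nu> (\<lambda>x. p x + q x)) A"
      by (simp add: emeasure_sum_measure sets_eq emeasure_density)
  qed (simp add: sets_eq)
  interpret P: prob_space P by fact
  interpret Q: prob_space Q by fact
  have "emeasure (sum_measure P Q) (space P) = emeasure P (space P) + emeasure Q (space P)"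
    by (rule emeasure_sum_measure[OF _ sets.top]) (simp add: sets_eq)
  also have "\<dots> \<noteq> \<infinity>"
    by simp
  finally interpret S: finite_measure "sum_measure P Q"
    by (intro finite_measureI) simp
  have "density (sum_measure P Q) (\<lambda>x. ennreal (p x / (p x + q x))) = P"
    unfolding eq unfolding P
    apply (subst density_density_eq)
      apply measurable
    apply (rule density_cong)
      apply measurable
    apply (intro AE_I2)
    subgoal for x
      using nonneg(1)[of x] nonneg(2)[of x]
      by (auto simp: ennreal_mult[symmetric] simp flip: ennreal_plus)
    done
  then show "AE x in sum_measure P Q. RN_deriv (sum_measure P Q) P x = ennreal (p x / (p x + q x))"
    using S.RN_deriv_unique[of "\<lambda>x. ennreal (p x / (p x + q x))" P]
    by (auto simp: eq)
  have "density (sum_measure P Q) (\<lambda>x. ennreal (q x / (p x + q x))) = Q"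
    unfolding eq unfolding Q
    apply (subst density_density_eq)
      apply measurable
    apply (rule density_cong)
      apply measurable
    apply (intro AE_I2)
    subgoal for x
      using nonneg(1)[of x] nonneg(2)[of x]
      by (auto simp: ennreal_mult[symmetric] simp flip: ennreal_plus)
    done
  then show "AE x in sum_measure P Q. RN_deriv (sum_measure P Q) Q x = ennreal (q x / (p x + q x))"
    using S.RN_deriv_unique[of "\<lambda>x. ennreal (q x / (p x + q x))" Q]
    by (auto simp: eq)
qed

lemma
  fixes p q :: "'a \<Rightarrow> real"
  assumes m[measurable]: "p \<in> borel_measurable \<nu>" "q \<in> borel_measurable \<nu>"
    and nonneg: "\<And>x. x \<in> space \<nu> \<Longrightarrow> 0 \<le> p x" "\<And>x. x \<in> space \<nu> \<Longrightarrow> 0 \<le> q x"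
    and P: "P = density \<nu> p" "prob_space P"
    and Q: "Q = density \<nu> q" "prob_space Q"
  shows tv_dist_density: "tv_dist P Q = 1 / 2 * (LINT x|\<nu>. \<bar>p x - q x\<bar>)"
    and hellinger_sq_density: "hellinger_sq P Q = (LINT x|\<nu>. (sqrt (p x) - sqrt (q x))\<^sup>2)"
proof -
  let ?S = "sum_measure P Q"
  have S: "?S = density \<nu> (\<lambda>x. p x + q x)"
    by (rule sum_measure_density) (fact assms)+
  have RN: "AE x in ?S. RN_deriv ?S P x = ennreal (p x / (p x + q x))"
      "AE x in ?S. RN_deriv ?S Q x = ennreal (q x / (p x + q x))"
    by (rule RN_deriv_sum_measure_left RN_deriv_sum_measure_right; fact assms)+
  have sets_S [measurable_cong]: "sets ?S = sets \<nu>"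
    by (simp add: P)
  have RN_real: "AE x in ?S. enn2real (RN_deriv ?S P x) = p x / (p x + q x) \<and>
      enn2real (RN_deriv ?S Q x) = q x / (p x + q x)"
    using RN AE_space[of ?S] by eventually_elim (simp add: nonneg P)
  have "(LINT x|?S. \<bar>enn2real (RN_deriv ?S P x) - enn2real (RN_deriv ?S Q x)\<bar>)
      = (LINT x|?S. \<bar>p x / (p x + q x) - q x / (p x + q x)\<bar>)"
    using RN_real by (intro integral_cong_AE) (measurable, auto)
  also have "\<dots> = (LINT x|\<nu>. (p x + q x) * \<bar>p x / (p x + q x) - q x / (p x + q x)\<bar>)"
    unfolding S by (subst integral_real_density) (auto simp: nonneg)
  also have "\<dots> = (LINT x|\<nu>. \<bar>p x - q x\<bar>)"
    apply (intro Bochner_Integration.integral_cong refl)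
    subgoal for x
      using nonneg(1)[of x] nonneg(2)[of x]
      by (cases "p x + q x = 0")
         (auto simp: diff_divide_distrib[symmetric] add_nonneg_eq_0_iff)
    done
  finally show "tv_dist P Q = 1 / 2 * (LINT x|\<nu>. \<bar>p x - q x\<bar>)"
    by (simp add: tv_dist_def Let_def)
  have "(LINT x|?S. (sqrt (enn2real (RN_deriv ?S P x)) - sqrt (enn2real (RN_deriv ?S Q x)))\<^sup>2)
      = (LINT x|?S. (sqrt (p x / (p x + q x)) - sqrt (q x / (p x + q x)))\<^sup>2)"
    using RN_real by (intro integral_cong_AE) (measurable, auto)
  also have "\<dots> = (LINT x|\<nu>. (p x + q x) * (sqrt (p x / (p x + q x)) - sqrt (q x / (p x + q x)))\<^sup>2)"
    unfolding S by (subst integral_real_density) (auto simp: nonneg)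
  also have "\<dots> = (LINT x|\<nu>. (sqrt (p x) - sqrt (q x))\<^sup>2)"
    apply (intro Bochner_Integration.integral_cong refl)
    subgoal for x
      using nonneg(1)[of x] nonneg(2)[of x]
      by (cases "p x + q x = 0")
         (auto simp: real_sqrt_divide diff_divide_distrib[symmetric] power_divide add_nonneg_eq_0_iff)
    done
  finally show "hellinger_sq P Q = (LINT x|\<nu>. (sqrt (p x) - sqrt (q x))\<^sup>2)"
    by (simp add: hellinger_sq_def Let_def)
qed

section \<open>Density estimation and Gaussian white noise\<close>

abbreviation unit_lebesgue :: "real measure" where
  "unit_lebesgue \<equiv> restrict_space lborel {0..1}"

definition prob_density :: "(real \<Rightarrow> real) \<Rightarrow> bool" where
  "prob_density f \<longleftrightarrow> f \<in> borel_measurable unit_lebesgue \<and> (\<forall>x\<in>{0..1}. 0 \<le> f x) \<and>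
     (\<integral>\<^sup>+x. ennreal (f x) \<partial>unit_lebesgue) = 1"

definition iid_law :: "nat \<Rightarrow> (real \<Rightarrow> real) \<Rightarrow> (nat \<Rightarrow> real) measure" where
  "iid_law n f = (\<Pi>\<^sub>M i\<in>{..<n}. density unit_lebesgue (\<lambda>x. ennreal (f x)))"

text \<open>
  Elements of \<open>cfunspace\<close> are extensional, i.e. equal to \<open>undefined\<close> outside \<open>[0,1]\<close>;
  its metric is the supremum distance.
\<close>

definition path_space :: "(real \<Rightarrow> real) metric" where
  "path_space = cfunspace (top_of_set {0..1}) euclidean_metric"

definition path_borel :: "(real \<Rightarrow> real) measure" where
  "path_borel = sigma (mspace path_space) {U. openin (mtopology_of path_space) U}"

definition brownian_motion01 :: "'w measure \<Rightarrow> (real \<Rightarrow> 'w \<Rightarrow> real) \<Rightarrow> bool" where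
  "brownian_motion01 M W \<longleftrightarrow> prob_space M \<and>
     (\<forall>t\<in>{0..1}. W t \<in> borel_measurable M) \<and>
     (AE \<omega> in M. W 0 \<omega> = 0) \<and>
     (\<forall>\<omega>\<in>space M. continuous_on {0..1} (\<lambda>t. W t \<omega>)) \<and>
     (\<forall>s t. 0 \<le> s \<and> s < t \<and> t \<le> 1 \<longrightarrow>
        distributed M lborel (\<lambda>\<omega>. W t \<omega> - W s \<omega>) (normal_density 0 (sqrt (t - s)))) \<and>
     (\<forall>k (\<tau> :: nat \<Rightarrow> real). mono_on {..k} \<tau> \<and> \<tau> ` {..k} \<subseteq> {0..1} \<longrightarrow>
        prob_space.indep_vars M (\<lambda>_. borel) (\<lambda>i \<omega>. W (\<tau> (Suc i)) \<omega> - W (\<tau> i) \<omega>) {..<k})"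

text \<open>
  Law of the solution of \<open>Y\<^sub>0 = 0\<close>, \<open>dY\<^sub>t = 2 \<surd>f(t) dt + n\<^sup>-\<^sup>1\<^sup>/\<^sup>2 dW\<^sub>t\<close>. It is the same for every
  Brownian motion \<open>W\<close>.
\<close>

definition white_noise_law ::
    "'w measure \<Rightarrow> (real \<Rightarrow> 'w \<Rightarrow> real) \<Rightarrow> nat \<Rightarrow> (real \<Rightarrow> real) \<Rightarrow> (real \<Rightarrow> real) measure" where
  "white_noise_law M W n f = distr M path_borel
     (\<lambda>\<omega>. \<lambda>t\<in>{0..1}. 2 * (LBINT s:{0..t}. sqrt (f s)) + W t \<omega> / sqrt (real n))"

end

theory Submission
  imports Defs
begin

text \<open>
  Both models are controlled by their Hellinger affinity \<open>A = 1 - H\<^sup>2 / 2\<close>, because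
  \<open>1 - A \<le> TV\<close> and \<open>TV\<^sup>2 \<le> 1 - A\<^sup>2\<close>. With \<open>I = \<integral>(\<surd>f - \<surd>g)\<^sup>2\<close>, the affinity of the i.i.d. laws is
  \<open>(1 - I / 2)\<^sup>n\<close> and that of the white noise laws is \<open>exp (- n I / 2)\<close>; elementary calculus gives
  \<open>0 \<le> exp (- n x) - (1 - x)\<^sup>n \<le> n x\<^sup>2 exp (- n x) \<le> ln n / n\<close> for \<open>x\<close> in \<open>[0,1]\<close>.

  The affinity of the white noise laws is obtained without Girsanov's theorem. The increments over the
  dyadic intervals of level \<open>m\<close> are independent Gaussians with affinity \<open>exp (- n E\<^sub>m / 2)\<close>, where
  \<open>E\<^sub>m\<close> is the squared \<open>L\<^sup>2\<close> norm of the projection of \<open>\<surd>f - \<surd>g\<close> to dyadic step functions, and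
  \<open>E\<^sub>m\<close> has supremum \<open>I\<close>. The affinity of \<open>P\<close> and \<open>Q\<close> is the infimum of \<open>(E\<^sub>P u + E\<^sub>Q (1 / u)) / 2\<close> over
  positive \<open>u\<close>. Testing with functions of the increments bounds it above, and since functions of
  finitely many dyadic evaluations are dense in \<open>L\<^sup>1(P + Q)\<close>, no other \<open>u\<close> does better than the
  infimum over all levels \<open>m\<close>.
\<close>

section \<open>Hellinger affinity\<close>

text \<open>The path laws come without explicit densities, so their affinity cannot be computed as
  an integral. The variational form avoids this: it contains only one integral under P and one under
  Q, hence it passes through measurable maps by change of variables and is stable under L^1
  perturbation of \<open>u\<close>, as long as \<open>u\<close> stays between positive bounds. This
  replaces both a likelihood ratio on path space and a martingale limit along the dyadic levels.

  The drift 2 sqrt f is scaled so that the experiments match: Gaussians with mean difference 2 d and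
  standard deviation s have affinity exp (- d^2 / (2 s^2)), which leads to the exponent - n I / 2,
  the first-order term of n ln (1 - I / 2). The affinities therefore differ by a null sequence even
  when I does not tend to 0. The factor 2 in front of ln n / n comes from H^2 = 2 - 2 A.\<close>

definition affinity :: "'a measure \<Rightarrow> 'a measure \<Rightarrow> real" where
  "affinity P Q = 1 - hellinger_sq P Q / 2"

lemma prob_space_density_integral:
  fixes p :: "'a \<Rightarrow> real"
  assumes [measurable]: "p \<in> borel_measurable \<nu>" and nn: "\<And>x. x \<in> space \<nu> \<Longrightarrow> 0 \<le> p x"
    and "prob_space (density \<nu> p)"
  shows "integrable \<nu> p" "integral\<^sup>L \<nu> p = 1"
proof -
  interpret prob_space "density \<nu> p" by fact
  have "(\<integral>\<^sup>+x. ennreal (p x) \<partial>\<nu>) = emeasure (density \<nu> p) (space \<nu>)"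
    by (subst emeasure_density) (auto intro!: nn_integral_cong)
  also have "\<dots> = 1" using emeasure_space_1 by simp
  finally have *: "(\<integral>\<^sup>+x. ennreal (p x) \<partial>\<nu>) = ennreal 1" by simp
  have "has_bochner_integral \<nu> p 1"
    by (rule has_bochner_integral_nn_integral) (use * nn in auto)
  then show "integrable \<nu> p" "integral\<^sup>L \<nu> p = 1"
    by (auto simp: has_bochner_integral_iff)
qed

text \<open>With \<open>u = sqrt (q / p)\<close> the two terms \<open>p * u\<close> and
  \<open>q / u\<close> of the variational functional both collapse to \<open>sqrt (p * q)\<close>;
  this is the equality case of the arithmetic-geometric mean inequality.\<close>

lemma mult_sqrt_divide:
  assumes "0 < a" "0 < (b::real)"
  shows "a * sqrt (b / a) = sqrt (a * b)" "b * (1 / sqrt (b / a)) = sqrt (a * b)"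
proof -
  have *: "x = sqrt x * sqrt x" if "x > 0" for x :: real using that by simp
  show "a * sqrt (b / a) = sqrt (a * b)"
    using assms by (subst *[of a]) (auto simp: real_sqrt_divide real_sqrt_mult simp del: real_sqrt_mult_self)
  show "b * (1 / sqrt (b / a)) = sqrt (a * b)"
    using assms by (subst *[of b]) (auto simp: real_sqrt_divide real_sqrt_mult simp del: real_sqrt_mult_self)
qed

lemma integrable_sqrt_mult:
  fixes p q :: "'a \<Rightarrow> real"
  assumes p: "integrable \<nu> p" and q: "integrable \<nu> q"
    and nn: "\<And>x. x \<in> space \<nu> \<Longrightarrow> 0 \<le> p x" "\<And>x. x \<in> space \<nu> \<Longrightarrow> 0 \<le> q x"
  shows "integrable \<nu> (\<lambda>x. sqrt (p x * q x))"
proof (rule Bochner_Integration.integrable_bound)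
  show "integrable \<nu> (\<lambda>x. p x + q x)" using p q by simp
  have [measurable]: "p \<in> borel_measurable \<nu>" "q \<in> borel_measurable \<nu>" using p q by auto
  show "(\<lambda>x. sqrt (p x * q x)) \<in> borel_measurable \<nu>" by measurable
  show "AE x in \<nu>. norm (sqrt (p x * q x)) \<le> norm (p x + q x)"
  proof (rule AE_I2)
    fix x assume "x \<in> space \<nu>"
    then have "0 \<le> p x" "0 \<le> q x" using nn by auto
    then show "norm (sqrt (p x * q x)) \<le> norm (p x + q x)"
      using arith_geo_mean_sqrt[of "p x" "q x"] by simp
  qed
qed

context
  fixes p q :: "'a \<Rightarrow> real" and P Q \<nu> :: "'a measure"
  assumes m[measurable]: "p \<in> borel_measurable \<nu>" "q \<in> borel_measurable \<nu>"
    and nn: "\<And>x. x \<in> space \<nu> \<Longrightarrow> 0 \<le> p x" "\<And>x. x \<in> space \<nu> \<Longrightarrow> 0 \<le> q x"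
    and P: "P = density \<nu> p" "prob_space P"
    and Q: "Q = density \<nu> q" "prob_space Q"
begin

text \<open>The affinity is the Bhattacharyya coefficient: expanding the square in H^2, the two
  total masses contribute 2 and the cross term remains.\<close>

lemma affinity_density: "affinity P Q = (LINT x|\<nu>. sqrt (p x * q x))"
proof -
  have p: "integrable \<nu> p" "integral\<^sup>L \<nu> p = 1"
    using prob_space_density_integral[of p \<nu>] P nn by auto
  have q: "integrable \<nu> q" "integral\<^sup>L \<nu> q = 1"
    using prob_space_density_integral[of q \<nu>] Q nn by auto
  have s: "integrable \<nu> (\<lambda>x. sqrt (p x * q x))"
    using integrable_sqrt_mult[of \<nu> p q] p q nn by auto
  have "hellinger_sq P Q = (LINT x|\<nu>. (sqrt (p x) - sqrt (q x))\<^sup>2)"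
    by (rule hellinger_sq_density) (fact m nn P Q)+
  also have "\<dots> = (LINT x|\<nu>. p x + q x - 2 * sqrt (p x * q x))"
    by (intro Bochner_Integration.integral_cong refl)
       (simp add: power2_diff nn real_sqrt_mult)
  also have "\<dots> = 2 - 2 * (LINT x|\<nu>. sqrt (p x * q x))"
    using p q s by simp
  finally show ?thesis by (simp add: affinity_def field_simps)
qed

text \<open>Le Cam's inequalities. With a = sqrt p and b = sqrt q, the first integrates (a - b)^2 <=
  |a^2 - b^2|. The second is Cauchy-Schwarz for |a - b| (a + b), whose factors have squared L^2
  norms 2 (1 - A) and 2 (1 + A).\<close>

lemma tv_dist_affinity_density:
  "1 - affinity P Q \<le> tv_dist P Q" "(tv_dist P Q)\<^sup>2 \<le> 1 - (affinity P Q)\<^sup>2"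
  "0 \<le> affinity P Q" "affinity P Q \<le> 1"
proof -
  let ?A = "affinity P Q"
  have p: "integrable \<nu> p" "integral\<^sup>L \<nu> p = 1"
    using prob_space_density_integral[of p \<nu>] P nn by auto
  have q: "integrable \<nu> q" "integral\<^sup>L \<nu> q = 1"
    using prob_space_density_integral[of q \<nu>] Q nn by auto
  have s: "integrable \<nu> (\<lambda>x. sqrt (p x * q x))"
    using integrable_sqrt_mult[of \<nu> p q] p q nn by auto
  have TV: "tv_dist P Q = 1 / 2 * (LINT x|\<nu>. \<bar>p x - q x\<bar>)"
    by (rule tv_dist_density) (fact m nn P Q)+
  have A: "?A = (LINT x|\<nu>. sqrt (p x * q x))" by (rule affinity_density)
  show "0 \<le> ?A" unfolding A by (intro integral_nonneg_AE AE_I2) (simp add: nn)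
  have sum: "(LINT x|\<nu>. (p x + q x) / 2) = 1" using p q by simp
  have "?A \<le> (LINT x|\<nu>. (p x + q x) / 2)"
    unfolding A using p q s by (intro integral_mono arith_geo_mean_sqrt) (auto simp: nn)
  then show A1: "?A \<le> 1" unfolding sum .
  have "(LINT x|\<nu>. p x + q x - 2 * sqrt (p x * q x)) \<le> (LINT x|\<nu>. \<bar>p x - q x\<bar>)"
  proof (rule integral_mono)
    fix x assume x: "x \<in> space \<nu>"
    let ?a = "sqrt (p x)" and ?b = "sqrt (q x)"
    have ab: "?a \<ge> 0" "?b \<ge> 0" using nn x by auto
    have "p x + q x - 2 * sqrt (p x * q x) = \<bar>?a - ?b\<bar> * \<bar>?a - ?b\<bar>"
      using nn x by (simp add: real_sqrt_mult power2_diff flip: power2_eq_square abs_mult)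
    also have "\<dots> \<le> \<bar>?a - ?b\<bar> * \<bar>?a + ?b\<bar>"
      using ab by (intro mult_left_mono) (auto simp: abs_le_iff)
    also have "\<dots> = \<bar>(?a - ?b) * (?a + ?b)\<bar>" by (simp only: abs_mult)
    also have "\<dots> = \<bar>p x - q x\<bar>"
      using nn x by (simp add: algebra_simps flip: power2_eq_square)
    finally show "p x + q x - 2 * sqrt (p x * q x) \<le> \<bar>p x - q x\<bar>" .
  qed (use p q s in auto)
  then show "1 - ?A \<le> tv_dist P Q" unfolding TV A using p q s by simp
  \<comment> \<open>Cauchy-Schwarz in weighted form: d s <= c d^2 / 2 + s^2 / (2 c) for every c > 0,
    with c optimised afterwards.\<close>
  have key: "2 * tv_dist P Q \<le> c * (1 - ?A) + (1 + ?A) / c" if c: "c > 0" for c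
  proof -
    have "(LINT x|\<nu>. \<bar>p x - q x\<bar>) \<le>
       (LINT x|\<nu>. c / 2 * (p x + q x - 2 * sqrt (p x * q x)) + (p x + q x + 2 * sqrt (p x * q x)) / (2 * c))"
    proof (rule integral_mono)
      fix x assume x: "x \<in> space \<nu>"
      let ?a = "sqrt (p x)" and ?b = "sqrt (q x)"
      define d s where "d = \<bar>?a - ?b\<bar>" and "s = ?a + ?b"
      have "s \<ge> 0" using nn x by (auto simp: s_def)
      have eq: "p x + q x - 2 * sqrt (p x * q x) = d\<^sup>2" "p x + q x + 2 * sqrt (p x * q x) = s\<^sup>2"
        using nn x by (simp_all add: d_def s_def real_sqrt_mult power2_diff power2_sum)
      have "\<bar>p x - q x\<bar> = \<bar>(?a - ?b) * (?a + ?b)\<bar>"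
        using nn x by (simp add: algebra_simps flip: power2_eq_square)
      also have "\<dots> = d * s" using \<open>s \<ge> 0\<close> by (simp add: abs_mult d_def s_def)
      also have "\<dots> \<le> c / 2 * d\<^sup>2 + s\<^sup>2 / (2 * c)"
      proof -
        have "0 \<le> (c * d - s)\<^sup>2 / (2 * c)" using c by simp
        also have "\<dots> = c / 2 * d\<^sup>2 + s\<^sup>2 / (2 * c) - d * s"
          using c by (simp add: field_simps power2_eq_square)
        finally show ?thesis by simp
      qed
      finally show "\<bar>p x - q x\<bar> \<le> c / 2 * (p x + q x - 2 * sqrt (p x * q x)) + (p x + q x + 2 * sqrt (p x * q x)) / (2 * c)"
        unfolding eq .
    qed (use p q s in auto)
    also have "\<dots> = c * (1 - ?A) + (1 + ?A) / c"
      using p q s c unfolding A by (simp add: field_simps)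
    finally show ?thesis unfolding TV by simp
  qed
  have T0: "tv_dist P Q \<ge> 0" unfolding TV by simp
  let ?T = "tv_dist P Q"
  show "?T\<^sup>2 \<le> 1 - ?A\<^sup>2"
  \<comment> \<open>The optimal weight blows up as A tends to 1. At A = 1 the bound reads 2 T <= 2 /
    c, and c = 2 / T refutes T > 0.\<close>
  proof (cases "?A = 1")
    case True
    have "?T \<le> 0"
    proof (rule ccontr)
      assume n: "\<not> ?T \<le> 0"
      then have "2 * ?T \<le> 2 / (2 / ?T)" using key[of "2 / ?T"] True by simp
      then show False using n by simp
    qed
    then show ?thesis using T0 True by simp
  next
    case False
    then have A1: "?A < 1" using A1 by simp
    \<comment> \<open>This weight minimises the right side of \<open>key\<close> by making its two
      terms equal.\<close>
    define c where "c = sqrt ((1 + ?A) / (1 - ?A))"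
    have c: "c > 0" "c\<^sup>2 = (1 + ?A) / (1 - ?A)"
      unfolding c_def using A1 \<open>0 \<le> ?A\<close> by simp_all
    then have e: "c\<^sup>2 * (1 - ?A) = 1 + ?A" using A1 by simp
    then have "(1 + ?A) / c = c * (1 - ?A)" using c(1) by (simp add: power2_eq_square flip: e)
    then have "?T \<le> c * (1 - ?A)" using key[OF c(1)] by simp
    then have "?T\<^sup>2 \<le> (c * (1 - ?A))\<^sup>2" using T0 by (intro power_mono)
    also have "\<dots> = (c\<^sup>2 * (1 - ?A)) * (1 - ?A)" by (simp add: power2_eq_square)
    also have "\<dots> = 1 - ?A\<^sup>2" unfolding e by (simp add: algebra_simps power2_eq_square)
    finally show ?thesis .
  qed
qed

end

section \<open>Arbitrary pairs of laws, described by densities with respect to their sum\<close>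

text \<open>Both laws are absolutely continuous with respect to P + Q and their derivatives add up
  to 1 almost everywhere, so one function \<open>p\<close> describes the pair. Bounds that hold
  everywhere meet the pointwise assumptions of the density lemmas directly.\<close>

lemma common_density:
  assumes P: "prob_space P" and Q: "prob_space Q" and sets_eq: "sets Q = sets P"
  obtains p where "p \<in> borel_measurable P"
    "\<And>x. 0 \<le> p x" "\<And>x. p x \<le> (1::real)"
    "P = density (sum_measure P Q) p" "Q = density (sum_measure P Q) (\<lambda>x. 1 - p x)"
    "finite_measure (sum_measure P Q)" "measure (sum_measure P Q) (space P) = 2"
proof -
  let ?S = "sum_measure P Q"
  interpret P: prob_space P by fact
  interpret Q: prob_space Q by fact
  have spQ: "space Q = space P" using sets_eq by (rule sets_eq_imp_space_eq)
  have em: "emeasure ?S A = emeasure P A + emeasure Q A" if "A \<in> sets P" for A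
    using that sets_eq by (intro emeasure_sum_measure) auto
  have tot: "emeasure ?S (space P) = 2"
    using P.emeasure_space_1 Q.emeasure_space_1 spQ by (subst em) auto
  then interpret S: finite_measure ?S by (intro finite_measureI) auto
  have ac: "absolutely_continuous ?S P" "absolutely_continuous ?S Q"
    unfolding absolutely_continuous_def null_sets_def using em sets_eq by auto
  let ?p = "RN_deriv ?S P" and ?q = "RN_deriv ?S Q"
  have dP: "density ?S ?p = P" and dQ: "density ?S ?q = Q"
    using S.density_RN_deriv[OF ac(1)] S.density_RN_deriv[OF ac(2)] sets_eq by simp_all
  have "density ?S (\<lambda>x. ?p x + ?q x) = density ?S (\<lambda>_. 1)"
  proof (rule measure_eqI)
    fix A assume A: "A \<in> sets (density ?S (\<lambda>x. ?p x + ?q x))"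
    then have [measurable]: "A \<in> sets ?S" by simp
    have "emeasure (density ?S (\<lambda>x. ?p x + ?q x)) A
        = emeasure (density ?S ?p) A + emeasure (density ?S ?q) A"
      by (simp add: emeasure_density distrib_right nn_integral_add del: sets_sum_measure)
    also have "\<dots> = emeasure ?S A" unfolding dP dQ using em A by simp
    finally show "emeasure (density ?S (\<lambda>x. ?p x + ?q x)) A = emeasure (density ?S (\<lambda>_. 1)) A"
      by (simp add: density_1)
  qed simp
  then have pq: "AE x in ?S. ?p x + ?q x = 1"
    by (subst (asm) S.density_unique_iff) auto
  \<comment> \<open>Truncation turns almost sure bounds into bounds everywhere; by \<open>pq\<close>
    it changes the derivative only on a null set.\<close>
  define p where "p x = min 1 (enn2real (?p x))" for x
  have b: "0 \<le> p x" "p x \<le> 1" for x by (auto simp: p_def)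
  have "?p \<in> borel_measurable P" using borel_measurable_RN_deriv[of ?S P]
    by (simp cong: measurable_cong_sets)
  then have [measurable]: "p \<in> borel_measurable P" unfolding p_def by measurable
  have mS[measurable]: "p \<in> borel_measurable ?S"
    using \<open>p \<in> borel_measurable P\<close> by (simp cong: measurable_cong_sets)
  have AE: "AE x in ?S. ?p x = ennreal (p x) \<and> ?q x = ennreal (1 - p x)"
    using pq
  proof eventually_elim
    case (elim x)
    have "?p x \<le> 1" using elim by (metis le_iff_add)
    then have "?p x \<noteq> top" by (auto simp: top_unique)
    then have e: "?p x = ennreal (enn2real (?p x))" by (simp add: less_top)
    with \<open>?p x \<le> 1\<close> have "enn2real (?p x) \<le> 1" by (simp add: enn2real_leI)
    then have 1: "?p x = ennreal (p x)" using e by (simp add: p_def)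
    moreover have "?q x = ennreal (1 - p x)"
    proof -
      have "?q x = 1 - ?p x" using elim \<open>?p x \<noteq> top\<close> by (metis ennreal_add_diff_cancel_left)
      also have "\<dots> = ennreal (1 - p x)" unfolding 1 by (subst ennreal_minus[symmetric]) (auto simp: b)
      finally show ?thesis .
    qed
    ultimately show ?case by simp
  qed
  have "density ?S ?p = density ?S p" "density ?S ?q = density ?S (\<lambda>x. 1 - p x)"
    using AE by (auto intro!: density_cong)
  then show thesis
    using that[of p] b dP dQ \<open>p \<in> borel_measurable P\<close> S.finite_measure_axioms tot
    by (simp add: measure_def)
qed

lemma tv_dist_affinity:
  assumes P: "prob_space P" and Q: "prob_space Q" and sets_eq: "sets Q = sets P"
  shows "1 - affinity P Q \<le> tv_dist P Q" "(tv_dist P Q)\<^sup>2 \<le> 1 - (affinity P Q)\<^sup>2"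
    "0 \<le> affinity P Q" "affinity P Q \<le> 1"
proof -
  obtain p where p: "p \<in> borel_measurable P"
    "\<And>x. 0 \<le> p x" "\<And>x. p x \<le> (1::real)"
    "P = density (sum_measure P Q) p" "Q = density (sum_measure P Q) (\<lambda>x. 1 - p x)"
    using common_density[OF assms] by metis
  have [measurable]: "p \<in> borel_measurable (sum_measure P Q)"
    using p(1) by (simp cong: measurable_cong_sets)
  note * = tv_dist_affinity_density[of p "sum_measure P Q" "\<lambda>x. 1 - p x" P Q, OF _ _ _ _ p(4) P p(5) Q]
  show "1 - affinity P Q \<le> tv_dist P Q" "(tv_dist P Q)\<^sup>2 \<le> 1 - (affinity P Q)\<^sup>2"
    "0 \<le> affinity P Q" "affinity P Q \<le> 1"
    by (rule *; simp add: p(2,3))+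
qed

section \<open>Variational formula for the affinity\<close>

text \<open>Pointwise arithmetic-geometric mean inequality: sqrt (p q) = sqrt ((p u) (q / u)) <= (p
  u + q / u) / 2.\<close>

lemma affinity_le_variational:
  assumes P: "prob_space P" and Q: "prob_space Q" and sets_eq: "sets Q = sets P"
    and pos: "\<And>x. x \<in> space P \<Longrightarrow> 0 < u x"
    and iP: "integrable P u" and iQ: "integrable Q (\<lambda>x. 1 / u x)"
  shows "affinity P Q \<le> ((LINT x|P. u x) + (LINT x|Q. 1 / u x)) / 2"
proof -
  let ?S = "sum_measure P Q"
  obtain p where p: "p \<in> borel_measurable P"
    "\<And>x. 0 \<le> p x" "\<And>x. p x \<le> (1::real)"
    "P = density (sum_measure P Q) p" "Q = density (sum_measure P Q) (\<lambda>x. 1 - p x)"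
    using common_density[OF P Q sets_eq] by metis
  have [measurable]: "p \<in> borel_measurable ?S" "u \<in> borel_measurable ?S"
    using p(1) borel_measurable_integrable[OF iP] by (simp_all cong: measurable_cong_sets)
  have A: "affinity P Q = (LINT x|?S. sqrt (p x * (1 - p x)))"
    by (rule affinity_density[OF _ _ _ _ p(4) P p(5) Q]) (auto simp: p(2,3))
  have 1: "integrable ?S (\<lambda>x. p x * u x)"
    using iP by (subst (asm) p(4), subst (asm) integrable_real_density) (auto simp: p(2,3))
  have 2: "integrable ?S (\<lambda>x. (1 - p x) * (1 / u x))"
    using iQ by (subst (asm) p(5), subst (asm) integrable_real_density) (auto simp: p(2,3))
  have e1: "(LINT x|P. u x) = (LINT x|?S. p x * u x)"
    by (subst p(4), subst integral_real_density) (auto simp: p(2,3))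
  have e2: "(LINT x|Q. 1 / u x) = (LINT x|?S. (1 - p x) * (1 / u x))"
    by (subst p(5), subst integral_real_density) (auto simp: p(2,3))
  have "affinity P Q \<le> (LINT x|?S. (p x * u x + (1 - p x) * (1 / u x)) / 2)"
    unfolding A
  proof (rule integral_mono_AE')
    show "AE x in ?S. sqrt (p x * (1 - p x)) \<le> (p x * u x + (1 - p x) * (1 / u x)) / 2"
    proof (rule AE_I2)
      fix x assume "x \<in> space ?S"
      then have u: "u x > 0" using pos by simp
      have "sqrt (p x * (1 - p x)) = sqrt ((p x * u x) * ((1 - p x) * (1 / u x)))" using u by simp
      also have "\<dots> \<le> (p x * u x + (1 - p x) * (1 / u x)) / 2"
        using u p by (intro arith_geo_mean_sqrt) auto
      finally show "sqrt (p x * (1 - p x)) \<le> (p x * u x + (1 - p x) * (1 / u x)) / 2" .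
    qed
    show "AE x in ?S. 0 \<le> (p x * u x + (1 - p x) * (1 / u x)) / 2"
      using pos p(2,3) by (intro AE_I2) (auto intro!: add_nonneg_nonneg simp: less_imp_le)
  qed (use 1 2 in simp)
  then show ?thesis unfolding e1 e2 using 1 2 by simp
qed

text \<open>The optimiser sqrt (q / p) degenerates where one density vanishes. Adding a small
  constant to both densities bounds \<open>u\<close> and \<open>1 / u\<close> by the same
  \<open>c\<close> at a small cost. These bounds are used later to clamp an approximation of
  \<open>u\<close> and to control its reciprocal.\<close>

lemma affinity_variational_attained:
  assumes P: "prob_space P" and Q: "prob_space Q" and sets_eq: "sets Q = sets P"
    and "\<epsilon> > 0"
  obtains u c where "u \<in> borel_measurable P" "0 < c" "\<And>x. 1 / c \<le> u x" "\<And>x. u x \<le> (c::real)"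
    "((LINT x|P. u x) + (LINT x|Q. 1 / u x)) / 2 \<le> affinity P Q + \<epsilon>"
proof -
  let ?S = "sum_measure P Q"
  obtain p where p: "p \<in> borel_measurable P"
    "\<And>x. 0 \<le> p x" "\<And>x. p x \<le> (1::real)"
    "P = density (sum_measure P Q) p" "Q = density (sum_measure P Q) (\<lambda>x. 1 - p x)"
    and fin: "finite_measure (sum_measure P Q)" and m2: "measure (sum_measure P Q) (space P) = 2"
    using common_density[OF P Q sets_eq] by metis
  interpret S: finite_measure ?S by fact
  have [measurable]: "p \<in> borel_measurable ?S"
    using p(1) by (simp cong: measurable_cong_sets)
  have A: "affinity P Q = (LINT x|?S. sqrt (p x * (1 - p x)))"
    by (rule affinity_density[OF _ _ _ _ p(4) P p(5) Q]) (auto simp: p(2,3))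
  \<comment> \<open>Since \<delta> <= 1, this gives \<delta> + \<delta>^2 <= 2 \<delta> <=
    \<epsilon>^2 / 4, a pointwise error of at most \<epsilon> / 2; P + Q has mass 2, so the
    integrated error is at most \<epsilon>.\<close>
  define \<delta> where "\<delta> = min 1 (\<epsilon>\<^sup>2 / 8)"
  have d: "0 < \<delta>" "\<delta> \<le> 1" "\<delta> \<le> \<epsilon>\<^sup>2 / 8" using \<open>\<epsilon> > 0\<close> by (auto simp: \<delta>_def)
  have "\<delta> + \<delta>\<^sup>2 \<le> \<epsilon>\<^sup>2 / 4"
    using d mult_left_le[of \<delta> \<delta>] unfolding power2_eq_square[of \<delta>] by linarith
  then have sq: "sqrt (\<delta> + \<delta>\<^sup>2) \<le> \<epsilon> / 2"
    using \<open>\<epsilon> > 0\<close> by (intro real_le_lsqrt) (auto simp: power_divide)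
  define c where "c = sqrt ((1 + \<delta>) / \<delta>)"
  \<comment> \<open>a regularisation of the optimal \<open>\<surd>(q / p)\<close> that is bounded away from \<open>0\<close> and \<open>\<infinity>\<close>\<close>
  define u where "u x = sqrt ((1 - p x + \<delta>) / (p x + \<delta>))" for x
  have c: "c > 0" using d by (simp add: c_def)
  have pos: "p x + \<delta> > 0" "1 - p x + \<delta> > 0" for x using p(2,3)[of x] d by auto
  have u1: "1 / c \<le> u x" for x
  proof -
    have "\<delta> * (p x + \<delta>) \<le> (1 - p x + \<delta>) * (1 + \<delta>)"
      using p(2,3)[of x] d by (intro mult_mono) auto
    then have "\<delta> / (1 + \<delta>) \<le> (1 - p x + \<delta>) / (p x + \<delta>)"
      using pos[of x] d by (simp add: field_simps)
    then show ?thesis unfolding u_def c_def by (simp flip: real_sqrt_divide real_sqrt_inverse add: real_sqrt_divide[symmetric] inverse_eq_divide[symmetric] real_sqrt_inverse[symmetric])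
  qed
  have u2: "u x \<le> c" for x
  proof -
    have "(1 - p x + \<delta>) * \<delta> \<le> (1 + \<delta>) * (p x + \<delta>)"
      using p(2,3)[of x] d by (intro mult_mono) auto
    then have "(1 - p x + \<delta>) / (p x + \<delta>) \<le> (1 + \<delta>) / \<delta>"
      using pos[of x] d by (simp add: field_simps)
    then show ?thesis unfolding u_def c_def by simp
  qed
  have upos: "u x > 0" for x unfolding u_def using pos[of x] by simp
  have [measurable]: "u \<in> borel_measurable ?S" unfolding u_def by measurable
  have e1: "(LINT x|P. u x) = (LINT x|?S. p x * u x)"
    by (subst p(4), subst integral_real_density) (auto simp: p(2,3))
  have e2: "(LINT x|Q. 1 / u x) = (LINT x|?S. (1 - p x) * (1 / u x))"
    by (subst p(5), subst integral_real_density) (auto simp: p(2,3))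
  have uc: "1 / u x \<le> c" for x using u1[of x] c upos[of x] by (simp add: field_simps)
  have 1: "integrable ?S (\<lambda>x. p x * u x)"
    using p u2 upos by (intro S.integrable_const_bound[of _ c] AE_I2)
      (auto simp: abs_mult less_imp_le intro: order_trans[OF mult_left_le_one_le])
  have 2: "integrable ?S (\<lambda>x. (1 - p x) * (1 / u x))"
  proof (rule S.integrable_const_bound[of _ c], rule AE_I2)
    fix x
    have "(1 - p x) * (1 / u x) \<le> 1 / u x" using p(2,3)[of x] upos[of x]
      by (intro mult_left_le_one_le) auto
    then show "norm ((1 - p x) * (1 / u x)) \<le> c" using uc[of x] p(3)[of x] upos[of x]
      by (simp add: abs_mult)
  qed simp
  have 3: "integrable ?S (\<lambda>x. sqrt (p x * (1 - p x)))"
  proof (rule S.integrable_const_bound[of _ 1], rule AE_I2)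
    fix x
    show "norm (sqrt (p x * (1 - p x))) \<le> 1"
      using arith_geo_mean_sqrt[of "p x" "1 - p x"] p(2,3)[of x] by (simp del: real_sqrt_le_1_iff)
  qed simp
  have "(LINT x|?S. (p x * u x + (1 - p x) * (1 / u x)) / 2)
      \<le> (LINT x|?S. sqrt (p x * (1 - p x)) + \<epsilon> / 2)"
  proof (rule integral_mono)
    fix x
    let ?r = "sqrt ((p x + \<delta>) * (1 - p x + \<delta>))"
    have a: "(p x + \<delta>) * u x = ?r" "(1 - p x + \<delta>) * (1 / u x) = ?r"
      unfolding u_def using mult_sqrt_divide[OF pos] by auto
    have "p x * u x + (1 - p x) * (1 / u x) \<le> (p x + \<delta>) * u x + (1 - p x + \<delta>) * (1 / u x)"
      using d upos[of x] by (intro add_mono mult_right_mono) auto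
    also have "\<dots> = 2 * ?r" unfolding a by simp
    finally have "(p x * u x + (1 - p x) * (1 / u x)) / 2 \<le> ?r" by simp
    \<comment> \<open>The mixed terms add up to \<delta> (p + (1 - p)) = \<delta>.\<close>
    also have "?r = sqrt (p x * (1 - p x) + (\<delta> + \<delta>\<^sup>2))"
      by (simp add: algebra_simps power2_eq_square)
    also have "\<dots> \<le> sqrt (p x * (1 - p x)) + sqrt (\<delta> + \<delta>\<^sup>2)"
      using p(2,3)[of x] d by (intro sqrt_add_le_add_sqrt) auto
    finally show "(p x * u x + (1 - p x) * (1 / u x)) / 2 \<le> sqrt (p x * (1 - p x)) + \<epsilon> / 2"
      using sq by simp
  qed (use 1 2 3 in auto)
  also have "\<dots> = affinity P Q + \<epsilon>" using 3 m2 by (simp add: A)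
  finally have "((LINT x|P. u x) + (LINT x|Q. 1 / u x)) / 2 \<le> affinity P Q + \<epsilon>"
    unfolding e1 e2 using 1 2 by simp
  moreover have "u \<in> borel_measurable P" using p(1) unfolding u_def by measurable
  ultimately show thesis using that c u1 u2 by blast
qed

text \<open>The optimal \<open>u\<close> on the image space is \<open>\<surd>(q / p)\<close>.\<close>

lemma affinity_le_distr:
  fixes p q :: "'b \<Rightarrow> real"
  assumes P: "prob_space P" and Q: "prob_space Q" and sets_eq: "sets Q = sets P"
    and T[measurable]: "T \<in> measurable P L"
    and m[measurable]: "p \<in> borel_measurable L" "q \<in> borel_measurable L"
    and pos: "\<And>x. x \<in> space L \<Longrightarrow> 0 < p x" "\<And>x. x \<in> space L \<Longrightarrow> 0 < q x"
    and dP: "distr P L T = density L p" and dQ: "distr Q L T = density L q"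
  shows "affinity P Q \<le> (LINT x|L. sqrt (p x * q x))"
proof -
  have T'[measurable]: "T \<in> measurable Q L" using T sets_eq by (simp cong: measurable_cong_sets)
  have "prob_space (density L p)" "prob_space (density L q)"
    using prob_space.prob_space_distr[OF P T] prob_space.prob_space_distr[OF Q T'] dP dQ by auto
  then have i: "integrable L (\<lambda>x. sqrt (p x * q x))"
    using pos by (intro integrable_sqrt_mult prob_space_density_integral(1)) (auto intro: less_imp_le)
  define v where "v x = sqrt (q x / p x)" for x
  have [measurable]: "v \<in> borel_measurable L" unfolding v_def by measurable
  have a: "p x * v x = sqrt (p x * q x)" "q x * (1 / v x) = sqrt (p x * q x)" if "x \<in> space L" for x
    unfolding v_def using mult_sqrt_divide[OF pos[OF that]] by auto
  have vpos: "v x > 0" if "x \<in> space L" for x using pos[OF that] by (simp add: v_def)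
  have i1: "integrable (density L p) v"
    using i a pos by (subst integrable_real_density) (auto intro!: AE_I2 less_imp_le cong: Bochner_Integration.integrable_cong)
  have i2: "integrable (density L q) (\<lambda>x. 1 / v x)"
    using i a pos by (subst integrable_real_density) (auto intro!: AE_I2 less_imp_le cong: Bochner_Integration.integrable_cong)
  have e1: "(LINT x|density L p. v x) = (LINT x|L. sqrt (p x * q x))"
    using a pos by (subst integral_real_density) (auto intro!: AE_I2 less_imp_le cong: Bochner_Integration.integral_cong)
  have e2: "(LINT x|density L q. 1 / v x) = (LINT x|L. sqrt (p x * q x))"
    using a pos by (subst integral_real_density) (auto intro!: AE_I2 less_imp_le cong: Bochner_Integration.integral_cong)
  \<comment> \<open>Testing on the original space with the pullback of \<open>v\<close> along
    \<open>T\<close>: passing to an image can only increase the affinity.\<close>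
  have "affinity P Q \<le> ((LINT x|P. v (T x)) + (LINT x|Q. 1 / v (T x))) / 2"
  proof (rule affinity_le_variational[OF P Q sets_eq])
    show "integrable P (\<lambda>x. v (T x))" using i1 unfolding dP[symmetric] by (simp add: integrable_distr_eq)
    show "integrable Q (\<lambda>x. 1 / v (T x))" using i2 unfolding dQ[symmetric] by (simp add: integrable_distr_eq)
    show "0 < v (T x)" if "x \<in> space P" for x using measurable_space[OF T that] by (rule vpos)
  qed
  also have "(LINT x|P. v (T x)) = (LINT x|L. sqrt (p x * q x))"
    using e1 unfolding dP[symmetric] by (simp add: integral_distr)
  also have "(LINT x|Q. 1 / v (T x)) = (LINT x|L. sqrt (p x * q x))"
    using e2 unfolding dQ[symmetric] by (simp add: integral_distr)
  finally show ?thesis by simp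
qed

section \<open>Dense subspaces of integrable functions\<close>

text \<open>A Dynkin argument: the sets whose indicators lie in the L^1 closure of \<open>V\<close>
  form a lambda-system containing the pi-system \<open>E\<close>. Linearity and dominated
  convergence then extend the closure to all integrable functions. It is applied to step functions
  on [0,1] and to cylinder functions on path space.\<close>

lemma integrable_dense_subspace:
  fixes u :: "'a \<Rightarrow> real"
  assumes fin: "finite_measure \<nu>"
    and gen: "sets \<nu> = sigma_sets (space \<nu>) E" "Int_stable E" "E \<subseteq> Pow (space \<nu>)"
    and V: "\<And>v. v \<in> V \<Longrightarrow> integrable \<nu> v"
      "\<And>v w. v \<in> V \<Longrightarrow> w \<in> V \<Longrightarrow> (\<lambda>x. v x + w x) \<in> V"
      "\<And>v c. v \<in> V \<Longrightarrow> (\<lambda>x. c * v x) \<in> V"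
      "(\<lambda>_. 1) \<in> V"
      "\<And>A. A \<in> E \<Longrightarrow> indicator A \<in> V"
    and u: "integrable \<nu> u" and e: "\<epsilon> > 0"
  shows "\<exists>v\<in>V. (LINT x|\<nu>. \<bar>u x - v x\<bar>) < \<epsilon>"
proof -
  interpret finite_measure \<nu> by fact
  define D where "D u \<longleftrightarrow> (\<forall>\<epsilon>>0. \<exists>v\<in>V. (LINT x|\<nu>. \<bar>u x - v x\<bar>) < \<epsilon>)" for u :: "'a \<Rightarrow> real"
  have D_V: "D v" if "v \<in> V" for v
    unfolding D_def by (auto intro!: bexI[OF _ that])
  have D_add: "D (\<lambda>x. u x + w x)" if uw: "D u" "D w" and [simp]: "integrable \<nu> u" "integrable \<nu> w" for u w
    unfolding D_def
  proof safe
    fix \<epsilon> :: real assume "\<epsilon> > 0"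
    then have "\<epsilon> / 2 > 0" by simp
    then obtain v v' where v: "v \<in> V" "(LINT x|\<nu>. \<bar>u x - v x\<bar>) < \<epsilon> / 2"
        "v' \<in> V" "(LINT x|\<nu>. \<bar>w x - v' x\<bar>) < \<epsilon> / 2"
      using uw unfolding D_def by blast
    note [simp] = V(1)[OF v(1)] V(1)[OF v(3)]
    have "(LINT x|\<nu>. \<bar>(u x + w x) - (v x + v' x)\<bar>) \<le> (LINT x|\<nu>. \<bar>u x - v x\<bar> + \<bar>w x - v' x\<bar>)"
      by (intro integral_mono) auto
    also have "\<dots> < \<epsilon>" using v by simp
    finally show "\<exists>v\<in>V. (LINT x|\<nu>. \<bar>u x + w x - v x\<bar>) < \<epsilon>"
      using V(2)[OF v(1,3)] by (intro bexI[of _ "\<lambda>x. v x + v' x"])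
  qed
  have D_scale: "D (\<lambda>x. c * u x)" if Du: "D u" for c u
    unfolding D_def
  proof safe
    fix \<epsilon> :: real assume "\<epsilon> > 0"
    then have "\<epsilon> / (\<bar>c\<bar> + 1) > 0" by simp
    then obtain v where v: "v \<in> V" "(LINT x|\<nu>. \<bar>u x - v x\<bar>) < \<epsilon> / (\<bar>c\<bar> + 1)"
      using Du unfolding D_def by blast
    have "(LINT x|\<nu>. \<bar>c * u x - c * v x\<bar>) = (LINT x|\<nu>. \<bar>c\<bar> * \<bar>u x - v x\<bar>)"
      by (simp flip: abs_mult add: right_diff_distrib)
    also have "\<dots> = \<bar>c\<bar> * (LINT x|\<nu>. \<bar>u x - v x\<bar>)" by simp
    also have "\<dots> \<le> (\<bar>c\<bar> + 1) * (LINT x|\<nu>. \<bar>u x - v x\<bar>)"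
      by (intro mult_right_mono) auto
    also have "\<dots> < \<epsilon>" using v(2) by (simp add: field_simps)
    finally show "\<exists>v\<in>V. (LINT x|\<nu>. \<bar>c * u x - v x\<bar>) < \<epsilon>"
      using V(3)[OF v(1)] by (intro bexI[of _ "\<lambda>x. c * v x"])
  qed
  have D_closed: "D u" if [simp]: "integrable \<nu> u"
      and s: "\<And>\<epsilon>. \<epsilon> > 0 \<Longrightarrow> \<exists>w. integrable \<nu> w \<and> D w \<and> (LINT x|\<nu>. \<bar>u x - w x\<bar>) < \<epsilon>" for u
    unfolding D_def
  proof safe
    fix \<epsilon> :: real assume "\<epsilon> > 0"
    then have e: "\<epsilon> / 2 > 0" by simp
    then obtain w where w: "integrable \<nu> w" "D w" "(LINT x|\<nu>. \<bar>u x - w x\<bar>) < \<epsilon> / 2"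
      using s by blast
    then obtain v where v: "v \<in> V" "(LINT x|\<nu>. \<bar>w x - v x\<bar>) < \<epsilon> / 2"
      using e unfolding D_def by blast
    have "(LINT x|\<nu>. \<bar>u x - v x\<bar>) \<le> (LINT x|\<nu>. \<bar>u x - w x\<bar> + \<bar>w x - v x\<bar>)"
      using V(1)[OF v(1)] w(1) by (intro integral_mono) auto
    also have "\<dots> < \<epsilon>" using v w V(1)[OF v(1)] by simp
    finally show "\<exists>v\<in>V. (LINT x|\<nu>. \<bar>u x - v x\<bar>) < \<epsilon>" using v by blast
  qed
  \<comment> \<open>The factor 2 is the domination supplied by \<open>integrable_induct\<close>; it
    yields the integrable majorant 3 |u|.\<close>
  have D_lim: "D u" if u: "integrable \<nu> u" and s: "\<And>i. integrable \<nu> (s i)" "\<And>i. D (s i)"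
      and b: "\<And>i x. x \<in> space \<nu> \<Longrightarrow> \<bar>s i x\<bar> \<le> 2 * \<bar>u x\<bar>"
      and l: "\<And>x. x \<in> space \<nu> \<Longrightarrow> (\<lambda>i. s i x) \<longlonglongrightarrow> u x" for u s
  proof (rule D_closed[OF u])
    fix \<epsilon> :: real assume "\<epsilon> > 0"
    have "(\<lambda>i. LINT x|\<nu>. \<bar>u x - s i x\<bar>) \<longlonglongrightarrow> (LINT x|\<nu>. 0)"
    proof (rule integral_dominated_convergence)
      show "integrable \<nu> (\<lambda>x. 3 * \<bar>u x\<bar>)" using u by simp
      show "AE x in \<nu>. (\<lambda>i. \<bar>u x - s i x\<bar>) \<longlonglongrightarrow> 0"
        using l by (intro AE_I2 tendsto_rabs_zero) (auto intro!: tendsto_eq_intros)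
      show "AE x in \<nu>. norm \<bar>u x - s i x\<bar> \<le> 3 * \<bar>u x\<bar>" for i
      proof (rule AE_I2)
        fix x assume "x \<in> space \<nu>"
        then show "norm \<bar>u x - s i x\<bar> \<le> 3 * \<bar>u x\<bar>" using b[of x i] by simp
      qed
      show "(\<lambda>x. \<bar>u x - s i x\<bar>) \<in> borel_measurable \<nu>" for i
        using u s(1)[of i] by simp
    qed simp
    then have "(\<lambda>i. LINT x|\<nu>. \<bar>u x - s i x\<bar>) \<longlonglongrightarrow> 0" by simp
    from order_tendstoD(2)[OF this \<open>\<epsilon> > 0\<close>] obtain i where "(LINT x|\<nu>. \<bar>u x - s i x\<bar>) < \<epsilon>"
      by (auto dest: eventually_happens)
    then show "\<exists>w. integrable \<nu> w \<and> D w \<and> (LINT x|\<nu>. \<bar>u x - w x\<bar>) < \<epsilon>"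
      using s by blast
  qed
  have D_ind: "A \<in> sets \<nu> \<and> D (indicator A)" if "A \<in> sets \<nu>" for A
    using gen(2,3) that[unfolded gen(1)]
  proof (induction rule: sigma_sets_induct_disjoint)
    case (basic A)
    then show ?case using D_V V(5) gen(1) by auto
  next
    case empty
    then show ?case using D_scale[OF D_V[OF V(4)], of 0] by (simp add: indicator_def[abs_def])
  next
    case (compl A)
    then have A: "A \<in> sets \<nu>" "D (indicator A)" by auto
    have "D (\<lambda>x. 1 + (-1) * indicator A x)"
      by (rule D_add[OF D_V[OF V(4)] D_scale]) (use A in \<open>auto simp: less_top[symmetric]\<close>)
    then have "D (\<lambda>x. 1 - indicator A x)" by simp
    \<comment> \<open>\<open>1 - indicator A\<close> and the indicator of the complement agree only
      on \<open>space \<nu>\<close>, so the transfer goes through the integrals in \<open>D\<close>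
      and not through equality of functions.\<close>
    moreover have "D (indicator (space \<nu> - A))" if "D (\<lambda>x. 1 - indicator A x)"
    proof -
      have "(LINT x|\<nu>. \<bar>indicator (space \<nu> - A) x - v x\<bar>) = (LINT x|\<nu>. \<bar>1 - indicator A x - v x\<bar>)" for v :: "'a \<Rightarrow> real"
        by (intro Bochner_Integration.integral_cong) (auto simp: indicator_def)
      then show ?thesis using that unfolding D_def by simp
    qed
    ultimately show ?case using A by blast
  next
    case (union A)
    then have A: "\<And>i. A i \<in> sets \<nu>" "\<And>i. D (indicator (A i))" by auto
    let ?s = "\<lambda>n x. \<Sum>i<n. indicator (A i) x :: real"
    have s: "integrable \<nu> (?s n) \<and> D (?s n)" for n
    proof (induction n)
      case 0
      then show ?case using D_scale[OF D_V[OF V(4)], of 0] by simp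
    next
      case (Suc n)
      then show ?case using D_add[of "?s n" "indicator (A n)"] A by (auto simp: less_top[symmetric])
    qed
    have eq: "?s n x = indicator (\<Union>i<n. A i) x" for n x
      using union(1) by (subst indicator_UN_disjoint) (auto simp: disjoint_family_on_def)
    have "D (indicator (\<Union>i. A i) :: 'a \<Rightarrow> real)"
    proof (rule D_lim[where s = ?s])
      have "(\<Union>i. A i) \<in> sets \<nu>" using A by (intro sets.countable_UN) auto
      then show "integrable \<nu> (indicator (\<Union>i. A i) :: 'a \<Rightarrow> real)"
        by (intro integrable_real_indicator) (auto simp: less_top[symmetric])
      show "(\<lambda>n. ?s n x) \<longlonglongrightarrow> indicator (\<Union>i. A i) x" for x :: 'a
        unfolding eq using LIMSEQ_indicator_UN[of A x] .
      show "\<bar>?s n x\<bar> \<le> 2 * \<bar>indicator (\<Union>i. A i) x\<bar>" for n x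
        unfolding eq by (auto simp: indicator_def)
    qed (use s in auto)
    then show ?case using A by (intro conjI sets.countable_UN) auto
  qed
  have "D u"
    using u
  proof (induction rule: integrable_induct)
    case (base A c)
    then show ?case using D_scale[of "indicator A" c] D_ind by (auto simp: mult.commute)
  next
    case (add f g)
    then show ?case using D_add by blast
  next
    case (lim f s)
    show ?case by (rule D_lim[of f s]) (use lim in auto)
  qed
  then show ?thesis using e unfolding D_def by blast
qed

section \<open>Product experiments\<close>

text \<open>A product measure is determined by its values on boxes, and on a box the integral of a
  product of one-coordinate densities factorises.\<close>

lemma PiM_density:
  fixes p :: "'i \<Rightarrow> 'b \<Rightarrow> real"
  assumes I: "finite I" and N: "sigma_finite_measure N"
    and m[measurable]: "\<And>i. p i \<in> borel_measurable N"
    and nn: "\<And>i x. x \<in> space N \<Longrightarrow> 0 \<le> p i x"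
    and pr: "\<And>i. prob_space (density N (p i))"
  shows "(\<Pi>\<^sub>M i\<in>I. density N (p i)) = density (\<Pi>\<^sub>M i\<in>I. N) (\<lambda>x. ennreal (\<Prod>i\<in>I. p i (x i)))"
proof -
  interpret N: sigma_finite_measure N by fact
  interpret PN: product_sigma_finite "\<lambda>_::'i. N" by standard
  interpret D: product_prob_space "\<lambda>i. density N (p i)"
    using pr by (simp add: product_prob_space_def product_sigma_finite_def product_prob_space_axioms_def prob_space_imp_sigma_finite)
  have s: "sets (\<Pi>\<^sub>M i\<in>I. density N (p i)) = sets (\<Pi>\<^sub>M i\<in>I. N)"
    by (intro sets_PiM_cong) auto
  show ?thesis
  proof (rule D.PiM_eqI[symmetric, OF I])
    show "sets (density (\<Pi>\<^sub>M i\<in>I. N) (\<lambda>x. ennreal (\<Prod>i\<in>I. p i (x i)))) = sets (\<Pi>\<^sub>M i\<in>I. density N (p i))"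
      using s by simp
    fix A assume A: "\<And>i. i \<in> I \<Longrightarrow> A i \<in> sets (density N (p i))"
    then have A'[measurable]: "\<And>i. i \<in> I \<Longrightarrow> A i \<in> sets N" by simp
    have [measurable]: "Pi\<^sub>E I A \<in> sets (\<Pi>\<^sub>M i\<in>I. N)" using I A' by (intro sets_PiM_I_finite) auto
    have [measurable]: "(\<lambda>x. p i (x i)) \<in> borel_measurable (\<Pi>\<^sub>M i\<in>I. N)" if "i \<in> I" for i
      using that by measurable
    have "emeasure (density (\<Pi>\<^sub>M i\<in>I. N) (\<lambda>x. ennreal (\<Prod>i\<in>I. p i (x i)))) (Pi\<^sub>E I A)
       = (\<integral>\<^sup>+x. ennreal (\<Prod>i\<in>I. p i (x i)) * indicator (Pi\<^sub>E I A) x \<partial>(\<Pi>\<^sub>M i\<in>I. N))"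
      by (intro emeasure_density) measurable
    also have "\<dots> = (\<integral>\<^sup>+x. (\<Prod>i\<in>I. ennreal (p i (x i)) * indicator (A i) (x i)) \<partial>(\<Pi>\<^sub>M i\<in>I. N))"
    proof (rule nn_integral_cong)
      fix x assume x: "x \<in> space (\<Pi>\<^sub>M i\<in>I. N)"
      then have xi: "x i \<in> space N" if "i \<in> I" for i using that by (auto simp: space_PiM)
      have "(\<Prod>i\<in>I. indicator (A i) (x i)) = (indicator (Pi\<^sub>E I A) x :: ennreal)"
        using I x by (auto simp: indicator_def space_PiM PiE_iff prod_zero_iff)
      then show "ennreal (\<Prod>i\<in>I. p i (x i)) * indicator (Pi\<^sub>E I A) x = (\<Prod>i\<in>I. ennreal (p i (x i)) * indicator (A i) (x i))"
        using nn[OF xi] by (simp add: prod.distrib prod_ennreal)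
    qed
    also have "\<dots> = (\<Prod>i\<in>I. \<integral>\<^sup>+x. ennreal (p i x) * indicator (A i) x \<partial>N)"
      using I by (intro PN.product_nn_integral_prod) auto
    also have "\<dots> = (\<Prod>i\<in>I. emeasure (density N (p i)) (A i))"
      by (intro prod.cong refl) (simp add: emeasure_density)
    finally show "emeasure (density (\<Pi>\<^sub>M i\<in>I. N) (\<lambda>x. ennreal (\<Prod>i\<in>I. p i (x i)))) (Pi\<^sub>E I A) = (\<Prod>i\<in>I. emeasure (density N (p i)) (A i))" .
  qed
qed

text \<open>Tensorisation of the affinity. It reduces both experiments to one coordinate: a single
  observation in one case, a single Gaussian increment in the other.\<close>

lemma integral_sqrt_prod:
  fixes p q :: "'i \<Rightarrow> 'b \<Rightarrow> real"
  assumes I: "finite I" and N: "sigma_finite_measure N"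
    and m[measurable]: "\<And>i. p i \<in> borel_measurable N" "\<And>i. q i \<in> borel_measurable N"
    and nn: "\<And>i x. x \<in> space N \<Longrightarrow> 0 \<le> p i x" "\<And>i x. x \<in> space N \<Longrightarrow> 0 \<le> q i x"
    and pr: "\<And>i. prob_space (density N (p i))" "\<And>i. prob_space (density N (q i))"
  shows "(LINT x|(\<Pi>\<^sub>M i\<in>I. N). sqrt ((\<Prod>i\<in>I. p i (x i)) * (\<Prod>i\<in>I. q i (x i))))
    = (\<Prod>i\<in>I. LINT x|N. sqrt (p i x * q i x))"
proof -
  interpret N: sigma_finite_measure N by fact
  interpret PN: product_sigma_finite "\<lambda>_::'i. N" by standard
  have sq: "sqrt (\<Prod>i\<in>I. h i) = (\<Prod>i\<in>I. sqrt (h i))" for h :: "'i \<Rightarrow> real"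
    using I by (induction I) (auto simp: real_sqrt_mult)
  have "(LINT x|(\<Pi>\<^sub>M i\<in>I. N). sqrt ((\<Prod>i\<in>I. p i (x i)) * (\<Prod>i\<in>I. q i (x i))))
    = (LINT x|(\<Pi>\<^sub>M i\<in>I. N). (\<Prod>i\<in>I. sqrt (p i (x i) * q i (x i))))"
    by (simp add: sq flip: prod.distrib)
  also have "\<dots> = (\<Prod>i\<in>I. LINT x|N. sqrt (p i x * q i x))"
    using I prob_space_density_integral(1)[OF m(1) nn(1) pr(1)] prob_space_density_integral(1)[OF m(2) nn(2) pr(2)]
    by (intro PN.product_integral_prod integrable_sqrt_mult nn) auto
  finally show ?thesis .
qed

section \<open>The i.i.d. experiment\<close>

lemma prob_density_prob_space:
  assumes "prob_density f"
  shows "prob_space (density unit_lebesgue (\<lambda>x. ennreal (f x)))"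
proof
  have [measurable]: "f \<in> borel_measurable unit_lebesgue" using assms by (simp add: prob_density_def)
  have "emeasure (density unit_lebesgue (\<lambda>x. ennreal (f x))) (space unit_lebesgue) = (\<integral>\<^sup>+x. ennreal (f x) \<partial>unit_lebesgue)"
    by (subst emeasure_density[OF _ sets.top]) (auto intro!: nn_integral_cong)
  then show "emeasure (density unit_lebesgue (\<lambda>x. ennreal (f x))) (space (density unit_lebesgue (\<lambda>x. ennreal (f x)))) = 1"
    using assms by (simp add: prob_density_def)
qed

lemma finite_measure_unit_lebesgue: "finite_measure unit_lebesgue"
  by (rule finite_measureI) (simp add: space_restrict_space emeasure_restrict_space)

lemma set_integral_unit_lebesgue:
  fixes h :: "real \<Rightarrow> real"
  shows "(LBINT x:{0..1}. h x) = (LINT x|unit_lebesgue. h x)"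
  by (simp add: integral_restrict_space set_lebesgue_integral_def)

lemma prob_densityD:
  assumes "prob_density f"
  shows "f \<in> borel_measurable unit_lebesgue" "\<And>x. x \<in> space unit_lebesgue \<Longrightarrow> 0 \<le> f x"
    "integrable unit_lebesgue f" "(LINT x|unit_lebesgue. f x) = 1"
proof -
  show 1: "f \<in> borel_measurable unit_lebesgue" "\<And>x. x \<in> space unit_lebesgue \<Longrightarrow> 0 \<le> f x"
    using assms by (auto simp: prob_density_def space_restrict_space)
  show "integrable unit_lebesgue f" "(LINT x|unit_lebesgue. f x) = 1"
    using prob_space_density_integral[OF 1 prob_density_prob_space[OF assms]] by auto
qed

lemma iid_law_density:
  assumes "prob_density f"
  shows "iid_law n f = density (\<Pi>\<^sub>M i\<in>{..<n}. unit_lebesgue) (\<lambda>x. ennreal (\<Prod>i<n. f (x i)))" "prob_space (iid_law n f)"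
proof -
  interpret finite_measure unit_lebesgue by (rule finite_measure_unit_lebesgue)
  show "iid_law n f = density (\<Pi>\<^sub>M i\<in>{..<n}. unit_lebesgue) (\<lambda>x. ennreal (\<Prod>i<n. f (x i)))"
    unfolding iid_law_def
    by (rule PiM_density) (use prob_densityD[OF assms] prob_density_prob_space[OF assms] in \<open>auto intro: sigma_finite_measure_axioms\<close>)
  show "prob_space (iid_law n f)"
    unfolding iid_law_def by (intro prob_space_PiM prob_density_prob_space assms)
qed

lemma sets_iid_law: "sets (iid_law n g) = sets (iid_law n f)"
  by (auto simp: iid_law_def intro!: sets_PiM_cong)

lemma affinity_iid_law:
  assumes f: "prob_density f" and g: "prob_density g"
  shows "affinity (iid_law n f) (iid_law n g) = (1 - (LBINT x:{0..1}. (sqrt (f x) - sqrt (g x))\<^sup>2) / 2) ^ n"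
proof -
  interpret finite_measure unit_lebesgue by (rule finite_measure_unit_lebesgue)
  note F = prob_densityD[OF f] and G = prob_densityD[OF g]
  note [measurable] = F(1) G(1)
  have "affinity (iid_law n f) (iid_law n g)
    = (LINT x|(\<Pi>\<^sub>M i\<in>{..<n}. unit_lebesgue). sqrt ((\<Prod>i<n. f (x i)) * (\<Prod>i<n. g (x i))))"
    by (rule affinity_density[OF _ _ _ _ iid_law_density[OF f] iid_law_density[OF g]])
       (auto intro!: prod_nonneg F G simp: space_PiM PiE_iff)
  also have "\<dots> = (\<Prod>i<n. LINT x|unit_lebesgue. sqrt (f x * g x))"
    by (rule integral_sqrt_prod)
       (auto intro: sigma_finite_measure_axioms prob_density_prob_space f g F G)
  also have "\<dots> = (LINT x|unit_lebesgue. sqrt (f x * g x)) ^ n" by simp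
  \<comment> \<open>Reading the one-coordinate integral back as an affinity expresses it through the
    squared Hellinger distance of \<open>f\<close> and \<open>g\<close>.\<close>
  also have "(LINT x|unit_lebesgue. sqrt (f x * g x)) = affinity (density unit_lebesgue f) (density unit_lebesgue g)"
    by (rule affinity_density[symmetric]) (auto intro: prob_density_prob_space f g F G)
  also have "\<dots> = 1 - (LINT x|unit_lebesgue. (sqrt (f x) - sqrt (g x))\<^sup>2) / 2"
    unfolding affinity_def
    by (subst hellinger_sq_density[of f unit_lebesgue g]) (auto intro: prob_density_prob_space f g F G)
  finally show ?thesis by (simp add: set_integral_unit_lebesgue)
qed

text \<open>The upper bound is nonnegativity of the affinity at n = 1. Together the bounds put I / 2
  into [0,1], the range in which the comparison of powers and exponentials operates.\<close>

lemma unit_hellinger_bounds: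
  assumes f: "prob_density f" and g: "prob_density g"
  shows "0 \<le> (LBINT x:{0..1}. (sqrt (f x) - sqrt (g x))\<^sup>2)" "(LBINT x:{0..1}. (sqrt (f x) - sqrt (g x))\<^sup>2) \<le> 2"
proof -
  show "0 \<le> (LBINT x:{0..1}. (sqrt (f x) - sqrt (g x))\<^sup>2)"
    unfolding set_integral_unit_lebesgue by (rule integral_nonneg_AE) auto
  have "0 \<le> affinity (iid_law 1 f) (iid_law 1 g)"
    by (rule tv_dist_affinity(3)[OF iid_law_density(2)[OF f] iid_law_density(2)[OF g] sets_iid_law])
  then show "(LBINT x:{0..1}. (sqrt (f x) - sqrt (g x))\<^sup>2) \<le> 2"
    unfolding affinity_iid_law[OF f g] by simp
qed

section \<open>Dyadic step functions\<close>

text \<open>Half-open cells make the cell of a point computable as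
  \<open>\<lfloor>x * 2 ^ m\<rfloor>\<close>. The point 1 falls into the cell with index
  \<open>2 ^ m\<close>, outside the range \<open>i < 2 ^ m\<close>, and is discarded as a null
  set.\<close>

definition dyadic_cell :: "nat \<Rightarrow> nat \<Rightarrow> real set" where
  "dyadic_cell m i = {real i / 2 ^ m ..< real (Suc i) / 2 ^ m}"

text \<open>If d is the integral of \<delta> over a cell, the cell average is 2^m d, and its square
  times the cell length 2^(-m) is the summand 2^m d^2.\<close>

definition dyadic_energy :: "(real \<Rightarrow> real) \<Rightarrow> nat \<Rightarrow> real" where
  "dyadic_energy \<delta> m = (\<Sum>i<2 ^ m. 2 ^ m * (LINT x|unit_lebesgue. indicator (dyadic_cell m i) x * \<delta> x)\<^sup>2)"

lemma mem_dyadic_cell_iff: "x \<in> dyadic_cell m i \<longleftrightarrow> \<lfloor>x * 2 ^ m\<rfloor> = int i"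
  by (auto simp: dyadic_cell_def floor_eq_iff field_simps)

lemma dyadic_cell_measurable [measurable]: "dyadic_cell m i \<in> sets borel"
  by (simp add: dyadic_cell_def)

lemma unit_measurable [measurable (raw)]: "f \<in> borel_measurable borel \<Longrightarrow> f \<in> borel_measurable unit_lebesgue"
  by (rule measurable_restrict_space1) simp

lemma dyadic_cell_subset:
  assumes "i < 2 ^ m"
  shows "dyadic_cell m i \<subseteq> {0..1}"
proof
  fix x assume x: "x \<in> dyadic_cell m i"
  have "real (Suc i) \<le> 2 ^ m" using assms by (metis Suc_leI of_nat_le_iff of_nat_numeral of_nat_power)
  then have "real (Suc i) / 2 ^ m \<le> 1" by simp
  moreover have "0 \<le> real i / 2 ^ m" by simp
  ultimately show "x \<in> {0..1}"
    using x unfolding dyadic_cell_def atLeastLessThan_iff atLeastAtMost_iff by linarith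
qed

lemma measure_dyadic_cell:
  assumes "i < 2 ^ m"
  shows "measure unit_lebesgue (dyadic_cell m i \<inter> {0..1}) = 1 / 2 ^ m"
proof -
  have "measure unit_lebesgue (dyadic_cell m i \<inter> {0..1}) = measure lborel (dyadic_cell m i)"
    using dyadic_cell_subset[OF assms] by (simp add: Int_absorb2 measure_restrict_space)
  also have "\<dots> = 1 / 2 ^ m"
    by (simp add: dyadic_cell_def divide_right_mono diff_divide_distrib[symmetric])
  finally show ?thesis .
qed

lemma step_function_expand:
  assumes x: "0 \<le> x" "x < 1"
  shows "h \<lfloor>x * 2 ^ m\<rfloor> = (\<Sum>i<2 ^ m. h (int i) * indicator (dyadic_cell m i) x :: real)"
proof -
  define k where "k = nat \<lfloor>x * 2 ^ m\<rfloor>"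
  have k: "\<lfloor>x * 2 ^ m\<rfloor> = int k" using x by (simp add: k_def)
  have "x * 2 ^ m < 2 ^ m" using x by simp
  then have "\<lfloor>x * 2 ^ m\<rfloor> < 2 ^ m" by (simp add: floor_less_iff)
  then have k2: "k < 2 ^ m" unfolding k by (metis of_nat_less_iff of_nat_numeral of_nat_power)
  have "(\<Sum>i<2 ^ m. h (int i) * indicator (dyadic_cell m i) x) = (\<Sum>i<2 ^ m. if i = k then h (int k) else 0)"
    by (intro sum.cong refl) (auto simp: indicator_def mem_dyadic_cell_iff k)
  also have "\<dots> = h (int k)" using k2 by simp
  finally show ?thesis by (simp add: k)
qed

lemma AE_unit_less_1: "AE x in unit_lebesgue. 0 \<le> x \<and> x < 1"
proof -
  have "AE x in lborel. x \<noteq> (1::real)" by (rule AE_lborel_singleton)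
  then have "AE x in lborel. x \<in> {0..1::real} \<longrightarrow> 0 \<le> x \<and> x < 1" by eventually_elim auto
  then show ?thesis by (simp add: AE_restrict_space_iff)
qed

text \<open>The integrand is \<delta>^2 - (\<delta> - h)^2. Maximised over step functions h, its
  integral is the dyadic energy. The cell averages give the upper bound for the energy, any other h
  a lower bound.\<close>

lemma step_integral:
  fixes h :: "int \<Rightarrow> real"
  assumes \<delta>: "integrable unit_lebesgue \<delta>"
  shows "(LINT x|unit_lebesgue. 2 * \<delta> x * h \<lfloor>x * 2 ^ m\<rfloor> - (h \<lfloor>x * 2 ^ m\<rfloor>)\<^sup>2) =
    (\<Sum>i<2 ^ m. 2 * h (int i) * (LINT x|unit_lebesgue. indicator (dyadic_cell m i) x * \<delta> x) - (h (int i))\<^sup>2 / 2 ^ m)"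
proof -
  interpret finite_measure unit_lebesgue by (rule finite_measure_unit_lebesgue)
  note [measurable] = borel_measurable_integrable[OF \<delta>]
  have [measurable]: "(\<lambda>x::real. h \<lfloor>x * 2 ^ m\<rfloor> :: real) \<in> borel_measurable borel" by measurable
  have i1: "integrable unit_lebesgue (\<lambda>x. indicator (dyadic_cell m i) x * \<delta> x)" for i
    by (rule Bochner_Integration.integrable_bound[OF \<delta>]) (auto simp: indicator_def)
  have i2: "integrable unit_lebesgue (\<lambda>x. indicator (dyadic_cell m i) x :: real)" for i
    by (rule integrable_const_bound[of _ 1]) (auto simp: indicator_def)
  have "(LINT x|unit_lebesgue. 2 * \<delta> x * h \<lfloor>x * 2 ^ m\<rfloor> - (h \<lfloor>x * 2 ^ m\<rfloor>)\<^sup>2) =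
    (LINT x|unit_lebesgue. (\<Sum>i<2 ^ m. 2 * h (int i) * (indicator (dyadic_cell m i) x * \<delta> x) - (h (int i))\<^sup>2 * indicator (dyadic_cell m i) x))"
  proof (rule integral_cong_AE)
    show "AE x in unit_lebesgue. 2 * \<delta> x * h \<lfloor>x * 2 ^ m\<rfloor> - (h \<lfloor>x * 2 ^ m\<rfloor>)\<^sup>2 =
      (\<Sum>i<2 ^ m. 2 * h (int i) * (indicator (dyadic_cell m i) x * \<delta> x) - (h (int i))\<^sup>2 * indicator (dyadic_cell m i) x)"
      using AE_unit_less_1
    proof eventually_elim
      case (elim x)
      have "2 * \<delta> x * h \<lfloor>x * 2 ^ m\<rfloor> - (h \<lfloor>x * 2 ^ m\<rfloor>)\<^sup>2 = (\<Sum>i<2 ^ m. (2 * \<delta> x * h (int i) - (h (int i))\<^sup>2) * indicator (dyadic_cell m i) x)"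
        by (rule step_function_expand[of x "\<lambda>j. 2 * \<delta> x * h j - (h j)\<^sup>2"]) (use elim in auto)
      then show ?case by (simp add: algebra_simps)
    qed
  qed measurable
  also have "\<dots> = (\<Sum>i<2 ^ m. 2 * h (int i) * (LINT x|unit_lebesgue. indicator (dyadic_cell m i) x * \<delta> x) - (h (int i))\<^sup>2 * (LINT x|unit_lebesgue. indicator (dyadic_cell m i) x))"
    using i1 i2 by simp
  also have "\<dots> = (\<Sum>i<2 ^ m. 2 * h (int i) * (LINT x|unit_lebesgue. indicator (dyadic_cell m i) x * \<delta> x) - (h (int i))\<^sup>2 / 2 ^ m)"
    by (intro sum.cong refl) (simp add: measure_dyadic_cell space_restrict_space)
  finally show ?thesis .
qed

lemma step_integrable:
  "integrable unit_lebesgue (\<lambda>x. h \<lfloor>x * 2 ^ m\<rfloor> :: real)"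
proof -
  interpret finite_measure unit_lebesgue by (rule finite_measure_unit_lebesgue)
  \<comment> \<open>On [0,1] the floor takes only the values 0, ..., 2^m, the last one at x =
    1.\<close>
  have "finite ((\<lambda>j. \<bar>h j\<bar>) ` {0..2 ^ m})" by simp
  then obtain B where B: "\<And>j. 0 \<le> j \<Longrightarrow> j \<le> 2 ^ m \<Longrightarrow> \<bar>h j\<bar> \<le> B"
    by (metis (mono_tags, lifting) Max_ge atLeastAtMost_iff image_eqI)
  have [measurable]: "(\<lambda>x::real. h \<lfloor>x * 2 ^ m\<rfloor> :: real) \<in> borel_measurable borel" by measurable
  show ?thesis
  proof (rule integrable_const_bound[of _ B], rule AE_I2)
    fix x assume "x \<in> space unit_lebesgue"
    then have x: "0 \<le> x" "x \<le> 1" by (auto simp: space_restrict_space)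
    then have "x * 2 ^ m \<le> 2 ^ m" by simp
    then have "\<lfloor>x * 2 ^ m\<rfloor> \<le> 2 ^ m"
      unfolding floor_le_iff of_int_power of_int_numeral by linarith
    then show "norm (h \<lfloor>x * 2 ^ m\<rfloor>) \<le> B" using x B by simp
  qed measurable
qed

lemma sq_integrable_unit:
  fixes \<delta> :: "real \<Rightarrow> real"
  assumes [measurable]: "\<delta> \<in> borel_measurable unit_lebesgue" and sq: "integrable unit_lebesgue (\<lambda>x. (\<delta> x)\<^sup>2)"
  shows "integrable unit_lebesgue \<delta>"
proof -
  interpret finite_measure unit_lebesgue by (rule finite_measure_unit_lebesgue)
  have "integrable unit_lebesgue (\<lambda>x. 1 + (\<delta> x)\<^sup>2)" using sq by simp
  then show ?thesis
  proof (rule Bochner_Integration.integrable_bound)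
    have "\<bar>t\<bar> \<le> 1 + t\<^sup>2" for t :: real
      using zero_le_power2[of "\<bar>t\<bar> - 1"] zero_le_power2[of t] unfolding power2_diff by simp
    then show "AE x in unit_lebesgue. norm (\<delta> x) \<le> norm (1 + (\<delta> x)\<^sup>2)" by simp
  qed simp
qed

lemma sq_integrable_mult:
  fixes a b :: "'a \<Rightarrow> real"
  assumes [measurable]: "a \<in> borel_measurable M" "b \<in> borel_measurable M"
    and "integrable M (\<lambda>x. (a x)\<^sup>2)" "integrable M (\<lambda>x. (b x)\<^sup>2)"
  shows "integrable M (\<lambda>x. a x * b x)"
proof (rule Bochner_Integration.integrable_bound)
  show "integrable M (\<lambda>x. (a x)\<^sup>2 + (b x)\<^sup>2)" using assms by simp
  have "\<bar>s * t\<bar> \<le> s\<^sup>2 + t\<^sup>2" for s t :: real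
  proof -
    have "2 * \<bar>s * t\<bar> \<le> s\<^sup>2 + t\<^sup>2" using sum_squares_bound[of "\<bar>s\<bar>" "\<bar>t\<bar>"] by (simp add: abs_mult)
    then show ?thesis using abs_ge_zero[of "s * t"] by linarith
  qed
  then show "AE x in M. norm (a x * b x) \<le> norm ((a x)\<^sup>2 + (b x)\<^sup>2)" by simp
qed measurable

text \<open>Bessel's inequality, from 2 \<delta> h - h^2 <= \<delta>^2 with h the cell averages of
  \<delta>.\<close>

lemma dyadic_energy_le:
  assumes [measurable]: "\<delta> \<in> borel_measurable unit_lebesgue" and sq: "integrable unit_lebesgue (\<lambda>x. (\<delta> x)\<^sup>2)"
  shows "dyadic_energy \<delta> m \<le> (LINT x|unit_lebesgue. (\<delta> x)\<^sup>2)"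
proof -
  have \<delta>: "integrable unit_lebesgue \<delta>" by (rule sq_integrable_unit) fact+
  define h where "h j = 2 ^ m * (LINT x|unit_lebesgue. indicator (dyadic_cell m (nat j)) x * \<delta> x)" for j
  have [measurable]: "(\<lambda>x::real. h \<lfloor>x * 2 ^ m\<rfloor> :: real) \<in> borel_measurable borel" by measurable
  have "dyadic_energy \<delta> m = (\<Sum>i<2 ^ m. 2 * h (int i) * (LINT x|unit_lebesgue. indicator (dyadic_cell m i) x * \<delta> x) - (h (int i))\<^sup>2 / 2 ^ m)"
    unfolding dyadic_energy_def by (intro sum.cong refl) (simp add: h_def power2_eq_square)
  also have "\<dots> = (LINT x|unit_lebesgue. 2 * \<delta> x * h \<lfloor>x * 2 ^ m\<rfloor> - (h \<lfloor>x * 2 ^ m\<rfloor>)\<^sup>2)"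
    by (rule step_integral[OF \<delta>, symmetric])
  also have "\<dots> \<le> (LINT x|unit_lebesgue. (\<delta> x)\<^sup>2)"
  proof (rule integral_mono)
    have "integrable unit_lebesgue (\<lambda>x. \<delta> x * h \<lfloor>x * 2 ^ m\<rfloor>)"
      by (rule sq_integrable_mult[OF _ _ sq step_integrable[of "\<lambda>j. (h j)\<^sup>2"]]) measurable
    then show "integrable unit_lebesgue (\<lambda>x. 2 * \<delta> x * h \<lfloor>x * 2 ^ m\<rfloor> - (h \<lfloor>x * 2 ^ m\<rfloor>)\<^sup>2)"
      using step_integrable[of "\<lambda>j. (h j)\<^sup>2" m] by (simp add: mult.assoc)
    show "2 * \<delta> x * h \<lfloor>x * 2 ^ m\<rfloor> - (h \<lfloor>x * 2 ^ m\<rfloor>)\<^sup>2 \<le> (\<delta> x)\<^sup>2" for x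
      using zero_le_power2[of "\<delta> x - h \<lfloor>x * 2 ^ m\<rfloor>"] unfolding power2_diff by simp
  qed (rule sq)
  finally show ?thesis .
qed

lemma dyadic_below:
  assumes "x < (y::real)" "0 \<le> x"
  obtains i m :: nat where "x < real i / 2 ^ m" "real i / 2 ^ m < y"
proof -
  have "1 / (y - x) > 0" using assms by simp
  then obtain m where m: "1 / (y - x) < 2 ^ m" using real_arch_pow[of 2 "1 / (y - x)"] by auto
  then have m1: "1 < 2 ^ m * (y - x)" using assms by (simp add: field_simps)
  define i where "i = nat (\<lfloor>x * 2 ^ m\<rfloor> + 1)"
  have "0 \<le> \<lfloor>x * 2 ^ m\<rfloor>" using assms by simp
  then have i: "real i = \<lfloor>x * 2 ^ m\<rfloor> + 1" unfolding i_def by linarith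
  have "x * 2 ^ m < real i" "real i \<le> x * 2 ^ m + 1" unfolding i by linarith+
  then have "x < real i / 2 ^ m" "real i / 2 ^ m < y" using m1 by (auto simp: field_simps)
  then show thesis by (rule that)
qed

section \<open>Density of dyadic step functions\<close>

text \<open>These generators form a chain under inclusion, hence are closed under intersection, and
  the indicator of each is a step function of one dyadic level on [0,1].\<close>

lemma sets_unit_lebesgue_dyadic:
  "sets unit_lebesgue = sigma_sets {0..1} (range (\<lambda>(i::nat, m::nat). {x \<in> {0..1::real}. x < real i / 2 ^ m}))"
  (is "_ = sigma_sets ?\<Omega> ?E")
proof
  let ?N = "sigma ?\<Omega> ?E"
  have E: "?E \<subseteq> Pow ?\<Omega>" by auto
  have sN: "sets ?N = sigma_sets ?\<Omega> ?E" "space ?N = ?\<Omega>" using E by auto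
  have id: "(\<lambda>x. x) \<in> borel_measurable ?N"
  proof (rule borel_measurableI_less)
    fix y :: real
    have "{x \<in> space ?N. x < y} = (\<Union>im\<in>{im::nat\<times>nat. real (fst im) / 2 ^ snd im \<le> y}. {x \<in> ?\<Omega>. x < real (fst im) / 2 ^ snd im})"
      unfolding sN(2)
    proof safe
      fix x assume x: "x < y" "x \<in> ?\<Omega>"
      then obtain i m where "x < real i / 2 ^ m" "real i / 2 ^ m < y" using dyadic_below[of x y] by auto
      then show "x \<in> (\<Union>im\<in>{im::nat\<times>nat. real (fst im) / 2 ^ snd im \<le> y}. {x \<in> ?\<Omega>. x < real (fst im) / 2 ^ snd im})"
        using x by (intro UN_I[of "(i, m)"]) auto
    qed auto
    also have "\<dots> \<in> sets ?N"
      unfolding sN(1) by (intro sigma_sets_UNION) (auto intro!: sigma_sets.Basic)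
    finally show "{x \<in> space ?N. x < y} \<in> sets ?N" .
  qed
  show "sets unit_lebesgue \<subseteq> sigma_sets ?\<Omega> ?E"
  proof
    fix A assume "A \<in> sets unit_lebesgue"
    then obtain B where B: "B \<in> sets borel" "A = ?\<Omega> \<inter> B" by (auto simp: sets_restrict_space)
    have "(\<lambda>x. x) -` B \<inter> space ?N \<in> sets ?N" using id B(1) by (rule measurable_sets)
    then show "A \<in> sigma_sets ?\<Omega> ?E" unfolding sN B(2) by (simp add: Int_commute)
  qed
  have "?E \<subseteq> sets unit_lebesgue"
  proof safe
    fix i m :: nat
    have "{x \<in> ?\<Omega>. x < real i / 2 ^ m} = ?\<Omega> \<inter> {..<real i / 2 ^ m}" by auto
    then show "{x \<in> ?\<Omega>. x < real i / 2 ^ m} \<in> sets unit_lebesgue" by (simp add: sets_restrict_space)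
  qed
  then show "sigma_sets ?\<Omega> ?E \<subseteq> sets unit_lebesgue"
    using sets.sigma_sets_subset[of ?E unit_lebesgue] by (simp add: space_restrict_space)
qed

text \<open>Nestedness of the levels: it brings step functions of levels m and k to the common level
  m + k.\<close>

lemma floor_dyadic_refine:
  fixes x :: real
  shows "\<lfloor>x * 2 ^ m\<rfloor> = \<lfloor>x * 2 ^ (m + k)\<rfloor> div (2 ^ k)"
proof -
  have "\<lfloor>(x * 2 ^ (m + k)) / real_of_int (2 ^ k)\<rfloor> = \<lfloor>x * 2 ^ (m + k)\<rfloor> div (2 ^ k)"
    by (rule floor_divide_real_eq_div) simp
  then show ?thesis by (simp add: power_add)
qed

lemma step_functions_dense:
  assumes u: "integrable unit_lebesgue u" and e: "\<epsilon> > 0"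
  shows "\<exists>m (h :: int \<Rightarrow> real). (LINT x|unit_lebesgue. \<bar>u x - h \<lfloor>x * 2 ^ m\<rfloor>\<bar>) < \<epsilon>"
proof -
  let ?E = "range (\<lambda>(i::nat, m::nat). {x \<in> {0..1::real}. x < real i / 2 ^ m})"
  \<comment> \<open>Agreement is required on [0,1] only: the indicators of the generators vanish
    outside and are not functions of the floor on the whole line.\<close>
  define V :: "(real \<Rightarrow> real) set" where "V = {v. \<exists>m h. \<forall>x\<in>{0..1}. v x = h \<lfloor>x * 2 ^ m\<rfloor>}"
  have V_I: "v \<in> V" if "\<And>x. x \<in> {0..1} \<Longrightarrow> v x = h \<lfloor>x * 2 ^ m\<rfloor>" for v m h
    unfolding V_def using that by blast
  have "\<exists>v\<in>V. (LINT x|unit_lebesgue. \<bar>u x - v x\<bar>) < \<epsilon>"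
  proof (rule integrable_dense_subspace[OF finite_measure_unit_lebesgue, of ?E])
    show "sets unit_lebesgue = sigma_sets (space unit_lebesgue) ?E"
      unfolding sets_unit_lebesgue_dyadic by (simp add: space_restrict_space)
    show "Int_stable ?E"
    proof (rule Int_stableI)
      fix a b assume "a \<in> ?E" "b \<in> ?E"
      then obtain i m j k where ab: "a = {x \<in> {0..1::real}. x < real i / 2 ^ m}" "b = {x \<in> {0..1::real}. x < real j / 2 ^ k}"
        by auto
      have "a \<inter> b = a \<or> a \<inter> b = b" unfolding ab by (cases "real i / 2 ^ m \<le> real j / 2 ^ k") auto
      then show "a \<inter> b \<in> ?E" by (rule disjE) (simp_all only: \<open>a \<in> ?E\<close> \<open>b \<in> ?E\<close>)
    qed
    show "?E \<subseteq> Pow (space unit_lebesgue)" by (auto simp: space_restrict_space)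
    show "integrable unit_lebesgue v" if v: "v \<in> V" for v
    proof -
      obtain m h where v: "\<And>x. x \<in> {0..1} \<Longrightarrow> v x = h \<lfloor>x * 2 ^ m\<rfloor>" using v unfolding V_def by blast
      have "integrable unit_lebesgue v = integrable unit_lebesgue (\<lambda>x. h \<lfloor>x * 2 ^ m\<rfloor>)"
        using v by (intro Bochner_Integration.integrable_cong) (auto simp: space_restrict_space)
      then show ?thesis using step_integrable by simp
    qed
    show "(\<lambda>x. v x + w x) \<in> V" if vw: "v \<in> V" "w \<in> V" for v w
    proof -
      obtain m h where v: "\<And>x. x \<in> {0..1} \<Longrightarrow> v x = h \<lfloor>x * 2 ^ m\<rfloor>" using vw unfolding V_def by blast
      obtain k g where w: "\<And>x. x \<in> {0..1} \<Longrightarrow> w x = g \<lfloor>x * 2 ^ k\<rfloor>" using vw unfolding V_def by blast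
      show ?thesis
      proof (rule V_I[where m = "m + k" and h = "\<lambda>j. h (j div 2 ^ k) + g (j div 2 ^ m)"])
        fix x :: real assume "x \<in> {0..1}"
        then show "v x + w x = h (\<lfloor>x * 2 ^ (m + k)\<rfloor> div 2 ^ k) + g (\<lfloor>x * 2 ^ (m + k)\<rfloor> div 2 ^ m)"
          using v w floor_dyadic_refine[of x m k] floor_dyadic_refine[of x k m] by (simp add: add.commute)
      qed
    qed
    show "(\<lambda>x. c * v x) \<in> V" if v: "v \<in> V" for v c
    proof -
      obtain m h where v: "\<And>x. x \<in> {0..1} \<Longrightarrow> v x = h \<lfloor>x * 2 ^ m\<rfloor>" using v unfolding V_def by blast
      then show ?thesis by (intro V_I[where m = m and h = "\<lambda>j. c * h j"]) simp
    qed
    show "(\<lambda>_. 1) \<in> V" by (rule V_I[where h = "\<lambda>_. 1"]) simp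
    show "indicator A \<in> V" if A: "A \<in> ?E" for A
    proof -
      obtain i m where A: "A = {x \<in> {0..1::real}. x < real i / 2 ^ m}" using A by auto
      show ?thesis
        by (rule V_I[where m = m and h = "\<lambda>j. if j < int i then 1 else 0"])
           (auto simp: A indicator_def field_simps floor_less_iff)
    qed
  qed (use u e in auto)
  then obtain v m h where v: "(LINT x|unit_lebesgue. \<bar>u x - v x\<bar>) < \<epsilon>" "\<And>x. x \<in> {0..1} \<Longrightarrow> v x = h \<lfloor>x * 2 ^ m\<rfloor>"
    unfolding V_def by blast
  have "(LINT x|unit_lebesgue. \<bar>u x - v x\<bar>) = (LINT x|unit_lebesgue. \<bar>u x - h \<lfloor>x * 2 ^ m\<rfloor>\<bar>)"
    using v by (intro Bochner_Integration.integral_cong) (auto simp: space_restrict_space)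
  then show ?thesis using v by metis
qed

text \<open>Density is available in L^1 but needed in L^2. Truncating \<delta> at a high level K
  costs little in L^2, and between functions bounded by K the squared L^2 distance is at most 2 K
  times the L^1 distance.\<close>

lemma dyadic_energy_approx:
  assumes m[measurable]: "\<delta> \<in> borel_measurable unit_lebesgue" and sq: "integrable unit_lebesgue (\<lambda>x. (\<delta> x)\<^sup>2)"
    and e: "\<epsilon> > 0"
  shows "\<exists>m. (LINT x|unit_lebesgue. (\<delta> x)\<^sup>2) - \<epsilon> < dyadic_energy \<delta> m"
proof -
  interpret finite_measure unit_lebesgue by (rule finite_measure_unit_lebesgue)
  have \<delta>: "integrable unit_lebesgue \<delta>" by (rule sq_integrable_unit) fact+
  define clip where "clip K t = max (- K) (min K t)" for K t :: real
  have clip_meas[measurable]: "clip K \<in> borel_measurable borel" for K unfolding clip_def by measurable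
  have "(\<lambda>K. LINT x|unit_lebesgue. (\<delta> x - clip (real K) (\<delta> x))\<^sup>2) \<longlonglongrightarrow> (LINT x|unit_lebesgue. 0)"
  proof (rule integral_dominated_convergence)
    show "AE x in unit_lebesgue. (\<lambda>K. (\<delta> x - clip (real K) (\<delta> x))\<^sup>2) \<longlonglongrightarrow> 0"
    proof (rule AE_I2)
      fix x
      have "eventually (\<lambda>K. (\<delta> x - clip (real K) (\<delta> x))\<^sup>2 = 0) sequentially"
        using eventually_ge_at_top[of "nat \<lceil>\<bar>\<delta> x\<bar>\<rceil>"] by eventually_elim (auto simp: clip_def)
      then show "(\<lambda>K. (\<delta> x - clip (real K) (\<delta> x))\<^sup>2) \<longlonglongrightarrow> 0" by (rule tendsto_eventually)
    qed
    show "AE x in unit_lebesgue. norm ((\<delta> x - clip (real K) (\<delta> x))\<^sup>2) \<le> (\<delta> x)\<^sup>2" for K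
    proof (rule AE_I2)
      fix x
      have "\<bar>\<delta> x - clip (real K) (\<delta> x)\<bar> \<le> \<bar>\<delta> x\<bar>" by (auto simp: clip_def)
      then show "norm ((\<delta> x - clip (real K) (\<delta> x))\<^sup>2) \<le> (\<delta> x)\<^sup>2" by (simp add: abs_le_square_iff)
    qed
  qed (use sq in measurable)
  then have "(\<lambda>K. LINT x|unit_lebesgue. (\<delta> x - clip (real K) (\<delta> x))\<^sup>2) \<longlonglongrightarrow> 0" by simp
  from order_tendstoD(2)[OF this, of "\<epsilon> / 4"] e obtain K :: nat
    where K: "(LINT x|unit_lebesgue. (\<delta> x - clip (real K) (\<delta> x))\<^sup>2) < \<epsilon> / 4"
    by (auto dest: eventually_happens)
  let ?c = "\<lambda>x. clip (real K) (\<delta> x)"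
  have cb: "\<bar>clip (real K) t\<bar> \<le> real K" for t by (auto simp: clip_def)
  have clip_contract: "\<bar>s - clip (real K) t\<bar> \<le> \<bar>s - t\<bar>" if "\<bar>s\<bar> \<le> real K" for s t
    using that unfolding clip_def by linarith
  have ic: "integrable unit_lebesgue ?c"
    by (rule integrable_const_bound[of _ "real K"]) (use cb in auto)
  \<comment> \<open>The L^1 accuracy is multiplied by 2 K, which leaves at most \<epsilon> / 4; K +
    1 keeps the denominator positive for K = 0.\<close>
  have "\<epsilon> / (8 * (real K + 1)) > 0" using e by simp
  from step_functions_dense[OF ic this] obtain m h0
    where h0: "(LINT x|unit_lebesgue. \<bar>?c x - h0 \<lfloor>x * 2 ^ m\<rfloor>\<bar>) < \<epsilon> / (8 * (real K + 1))" by auto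
  \<comment> \<open>Clipping the step function too gives it the bound K. Clipping is a contraction
    that fixes values in [-K, K], so the distance to the clipped \<delta> does not grow.\<close>
  define h where "h j = clip (real K) (h0 j)" for j
  let ?h = "\<lambda>x. h \<lfloor>x * 2 ^ m\<rfloor>"
  have [measurable]: "(\<lambda>x::real. ?h x) \<in> borel_measurable borel" "(\<lambda>x::real. h0 \<lfloor>x * 2 ^ m\<rfloor>) \<in> borel_measurable borel" by measurable
  have hb: "\<bar>?h x\<bar> \<le> real K" for x :: real unfolding h_def by (rule cb)
  have i1: "integrable unit_lebesgue (\<lambda>x. \<bar>?c x - h0 \<lfloor>x * 2 ^ m\<rfloor>\<bar>)"
    using ic step_integrable[of h0 m] by simp
  have i2: "integrable unit_lebesgue (\<lambda>x. (?c x - ?h x)\<^sup>2)"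
  proof (rule integrable_const_bound[of _ "(2 * real K)\<^sup>2"], rule AE_I2)
    fix x
    have "\<bar>?c x - ?h x\<bar> \<le> \<bar>2 * real K\<bar>" using cb[of "\<delta> x"] hb[of x] by linarith
    then show "norm ((?c x - ?h x)\<^sup>2) \<le> (2 * real K)\<^sup>2" by (simp only: abs_le_square_iff real_norm_def abs_power2)
  qed measurable
  have i3: "integrable unit_lebesgue (\<lambda>x. (\<delta> x - ?c x)\<^sup>2)"
  proof (rule Bochner_Integration.integrable_bound[OF sq])
    show "AE x in unit_lebesgue. norm ((\<delta> x - ?c x)\<^sup>2) \<le> norm ((\<delta> x)\<^sup>2)"
    proof (rule AE_I2)
      fix x
      have "\<bar>\<delta> x - ?c x\<bar> \<le> \<bar>\<delta> x\<bar>" by (auto simp: clip_def)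
      then show "norm ((\<delta> x - ?c x)\<^sup>2) \<le> norm ((\<delta> x)\<^sup>2)" by (simp add: abs_le_square_iff)
    qed
  qed measurable
  have c2: "(LINT x|unit_lebesgue. (?c x - ?h x)\<^sup>2) \<le> \<epsilon> / 4"
  proof -
    have "(LINT x|unit_lebesgue. (?c x - ?h x)\<^sup>2) \<le> (LINT x|unit_lebesgue. 2 * real K * \<bar>?c x - h0 \<lfloor>x * 2 ^ m\<rfloor>\<bar>)"
    proof (rule integral_mono[OF i2])
      fix x
      have 1: "\<bar>?c x - ?h x\<bar> \<le> 2 * real K" using cb[of "\<delta> x"] hb[of x] by linarith
      have 2: "\<bar>?c x - ?h x\<bar> \<le> \<bar>?c x - h0 \<lfloor>x * 2 ^ m\<rfloor>\<bar>" unfolding h_def by (rule clip_contract[OF cb])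
      have "(?c x - ?h x)\<^sup>2 = \<bar>?c x - ?h x\<bar> * \<bar>?c x - ?h x\<bar>" by (simp add: power2_eq_square)
      also have "\<dots> \<le> 2 * real K * \<bar>?c x - h0 \<lfloor>x * 2 ^ m\<rfloor>\<bar>" using 1 2 by (intro mult_mono) auto
      finally show "(?c x - ?h x)\<^sup>2 \<le> 2 * real K * \<bar>?c x - h0 \<lfloor>x * 2 ^ m\<rfloor>\<bar>" .
    qed (use i1 in simp)
    also have "\<dots> = 2 * real K * (LINT x|unit_lebesgue. \<bar>?c x - h0 \<lfloor>x * 2 ^ m\<rfloor>\<bar>)" by simp
    also have "\<dots> \<le> 2 * (real K + 1) * (\<epsilon> / (8 * (real K + 1)))"
      using h0 by (intro mult_mono) (auto intro!: integral_nonneg_AE)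
    also have "\<dots> = \<epsilon> / 4" by (simp add: field_simps)
    finally show ?thesis .
  qed
  have i4: "integrable unit_lebesgue (\<lambda>x. 2 * \<delta> x * ?h x - (?h x)\<^sup>2)"
  proof -
    have "integrable unit_lebesgue (\<lambda>x. \<delta> x * ?h x)"
      by (rule sq_integrable_mult[OF _ _ sq step_integrable[of "\<lambda>j. (h j)\<^sup>2"]]) measurable
    then show ?thesis using step_integrable[of "\<lambda>j. (h j)\<^sup>2" m] by (simp add: mult.assoc)
  qed
  have "(LINT x|unit_lebesgue. (\<delta> x)\<^sup>2 - (2 * (\<delta> x - ?c x)\<^sup>2 + 2 * (?c x - ?h x)\<^sup>2)) \<le> (LINT x|unit_lebesgue. 2 * \<delta> x * ?h x - (?h x)\<^sup>2)"
  proof (rule integral_mono[OF _ i4])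
    fix x
    \<comment> \<open>The parallelogram identity gives (\<delta> - h)^2 <= 2 (\<delta> - c)^2 + 2 (c
      - h)^2, where c is the clipped \<delta>, and \<delta>^2 - (\<delta> - h)^2 = 2 \<delta> h -
      h^2.\<close>
    have "0 \<le> ((\<delta> x - ?c x) - (?c x - ?h x))\<^sup>2" by simp
    then show "(\<delta> x)\<^sup>2 - (2 * (\<delta> x - ?c x)\<^sup>2 + 2 * (?c x - ?h x)\<^sup>2) \<le> 2 * \<delta> x * ?h x - (?h x)\<^sup>2"
      by (simp add: power2_eq_square algebra_simps)
  qed (use sq i2 i3 in simp)
  also have "\<dots> = (\<Sum>i<2 ^ m. 2 * h (int i) * (LINT x|unit_lebesgue. indicator (dyadic_cell m i) x * \<delta> x) - (h (int i))\<^sup>2 / 2 ^ m)"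
    by (rule step_integral[OF \<delta>])
  also have "\<dots> \<le> dyadic_energy \<delta> m"
    unfolding dyadic_energy_def
  proof (rule sum_mono)
    fix i
    let ?d = "LINT x|unit_lebesgue. indicator (dyadic_cell m i) x * \<delta> x"
    \<comment> \<open>Completing the square in each cell: the cell average is the best
      constant.\<close>
    have "0 \<le> (2 ^ m * ?d - h (int i))\<^sup>2 / 2 ^ m" by simp
    also have "\<dots> = 2 ^ m * ?d\<^sup>2 - (2 * h (int i) * ?d - (h (int i))\<^sup>2 / 2 ^ m)"
      by (simp add: power2_eq_square field_simps)
    finally show "2 * h (int i) * ?d - (h (int i))\<^sup>2 / 2 ^ m \<le> 2 ^ m * ?d\<^sup>2" by simp
  qed
  finally have "(LINT x|unit_lebesgue. (\<delta> x)\<^sup>2) - (2 * (LINT x|unit_lebesgue. (\<delta> x - ?c x)\<^sup>2) + 2 * (LINT x|unit_lebesgue. (?c x - ?h x)\<^sup>2)) \<le> dyadic_energy \<delta> m"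
    using sq i2 i3 by simp
  then show ?thesis using K c2 by (intro exI[of _ m]) linarith
qed

section \<open>The space of continuous paths\<close>

text \<open>Compactness of [0,1] makes every continuous path bounded, so the boundedness built into
  \<open>cfunspace\<close> disappears from the description.\<close>

lemma mem_path_space:
  "y \<in> mspace path_space \<longleftrightarrow> y \<in> extensional {0..1} \<and> continuous_on {0..1} y"
proof -
  have "compactin (top_of_set {0..1::real}) (topspace (top_of_set {0..1}))"
    by (simp add: compactin_subtopology)
  then show ?thesis
    unfolding path_space_def by (subst compactin_mspace_cfunspace) auto
qed

lemma mdist_path_space_le:
  assumes "y \<in> mspace path_space" "z \<in> mspace path_space"
  shows "mdist path_space y z \<le> a \<longleftrightarrow> (\<forall>t\<in>{0..1}. \<bar>y t - z t\<bar> \<le> a)"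
  using cfunspace_mdist_le[of y "top_of_set {0..1}" euclidean_metric z a] assms
  unfolding path_space_def by (auto simp: dist_real_def)

lemma openin_path_space:
  "openin (mtopology_of path_space) U \<longleftrightarrow>
    U \<subseteq> mspace path_space \<and> (\<forall>y\<in>U. \<exists>r>0. \<forall>z\<in>mspace path_space. mdist path_space y z < r \<longrightarrow> z \<in> U)"
proof -
  interpret Metric_space "mspace path_space" "mdist path_space" by simp
  show ?thesis
    unfolding mtopology_of_def openin_mtopology subset_iff in_mball by blast
qed

lemma space_path_borel: "space path_borel = mspace path_space"
  and sets_path_borel: "sets path_borel = sigma_sets (mspace path_space) {U. openin (mtopology_of path_space) U}"
proof -
  have "{U. openin (mtopology_of path_space) U} \<subseteq> Pow (mspace path_space)"
    by (auto simp: openin_path_space)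
  then show "space path_borel = mspace path_space"
    "sets path_borel = sigma_sets (mspace path_space) {U. openin (mtopology_of path_space) U}"
    by (auto simp: path_borel_def)
qed

text \<open>Evaluation is 1-Lipschitz for the supremum distance, so its strict sublevel sets are
  open.\<close>

lemma eval_measurable_path_borel:
  assumes t: "t \<in> {0..1}"
  shows "(\<lambda>y. y t) \<in> borel_measurable path_borel"
proof (rule borel_measurableI_less)
  fix a :: real
  have "openin (mtopology_of path_space) {y \<in> mspace path_space. y t < a}"
    unfolding openin_path_space
  proof safe
    fix y assume y: "y \<in> mspace path_space" "y t < a"
    show "\<exists>r>0. \<forall>z\<in>mspace path_space. mdist path_space y z < r \<longrightarrow> z \<in> {y \<in> mspace path_space. y t < a}"
    proof (intro exI[of _ "a - y t"] conjI ballI impI)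
      fix z assume z: "z \<in> mspace path_space" and d: "mdist path_space y z < a - y t"
      have "\<bar>y t - z t\<bar> \<le> mdist path_space y z"
        using mdist_path_space_le[OF y(1) z, of "mdist path_space y z"] t by auto
      then have "z t < a" using d by linarith
      then show "z \<in> {y \<in> mspace path_space. y t < a}" using z by simp
    qed (use y in simp)
  qed
  then show "{y \<in> space path_borel. y t < a} \<in> sets path_borel"
    unfolding space_path_borel sets_path_borel by (intro sigma_sets.Basic) simp
qed

section \<open>Dyadic evaluations generate the Borel sets of path space\<close>

definition dyadic_eval :: "nat \<Rightarrow> (real \<Rightarrow> real) \<Rightarrow> (nat \<Rightarrow> real)" where
  "dyadic_eval m y = (\<lambda>i\<in>{..2 ^ m}. y (real i / 2 ^ m))"

text \<open>Each cylinder looks at one level only. As the levels are nested, this is already closed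
  under intersection.\<close>

definition dyadic_cylinders :: "(real \<Rightarrow> real) set set" where
  "dyadic_cylinders = {dyadic_eval m -` B \<inter> mspace path_space | m B. B \<in> sets (\<Pi>\<^sub>M i\<in>{..2 ^ m}. borel)}"

lemma dyadic_eval_measurable:
  assumes "\<And>m i. i \<le> 2 ^ m \<Longrightarrow> (\<lambda>y. y (real i / 2 ^ m)) \<in> borel_measurable N"
  shows "dyadic_eval m \<in> measurable N (\<Pi>\<^sub>M i\<in>{..2 ^ m}. borel)"
  unfolding dyadic_eval_def by (rule measurable_restrict) (use assms in auto)

lemma dyadic_unit: "i \<le> 2 ^ m \<Longrightarrow> real i / 2 ^ m \<in> {0..1}"
proof -
  assume "i \<le> 2 ^ m"
  then have "real i \<le> 2 ^ m" by (metis of_nat_le_iff of_nat_numeral of_nat_power)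
  then show ?thesis by simp
qed

lemma dyadic_eval_measurable_path_borel:
  "dyadic_eval m \<in> measurable path_borel (\<Pi>\<^sub>M i\<in>{..2 ^ m}. borel)"
  by (rule dyadic_eval_measurable[OF eval_measurable_path_borel[OF dyadic_unit]])

lemma dyadic_dense_le:
  assumes c: "continuous_on {0..1} (h :: real \<Rightarrow> real)" and le: "\<And>m i. i \<le> 2 ^ m \<Longrightarrow> h (real i / 2 ^ m) \<le> a"
    and x: "x \<in> {0..1}"
  shows "h x \<le> a"
proof -
  define k where "k m = nat \<lfloor>x * 2 ^ m\<rfloor>" for m :: nat
  have rk: "real (k m) = of_int \<lfloor>x * 2 ^ m\<rfloor>" for m using x by (simp add: k_def)
  have kle: "k m \<le> 2 ^ m" for m
  proof -
    have "x * 2 ^ m \<le> 2 ^ m" using x by simp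
    then have "real (k m) \<le> 2 ^ m" unfolding rk by linarith
    then show ?thesis by (metis of_nat_le_iff of_nat_numeral of_nat_power)
  qed
  have "(\<lambda>m. real (k m) / 2 ^ m) \<longlonglongrightarrow> x"
  proof (rule real_tendsto_sandwich)
    show "eventually (\<lambda>m. x - (1 / 2) ^ m \<le> real (k m) / 2 ^ m) sequentially"
    proof (rule always_eventually, rule allI)
      fix m
      have "x * 2 ^ m - 1 \<le> real (k m)" unfolding rk by linarith
      then have "x \<le> (real (k m) + 1) / 2 ^ m" by (simp add: field_simps)
      then show "x - (1 / 2) ^ m \<le> real (k m) / 2 ^ m" by (simp add: add_divide_distrib power_one_over)
    qed
    show "eventually (\<lambda>m. real (k m) / 2 ^ m \<le> x) sequentially"
    proof (rule always_eventually, rule allI)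
      fix m
      have "real (k m) \<le> x * 2 ^ m" unfolding rk by linarith
      then show "real (k m) / 2 ^ m \<le> x" by (simp add: field_simps)
    qed
    show "(\<lambda>m. x - (1 / 2) ^ m) \<longlonglongrightarrow> x"
      by (rule tendsto_eq_intros LIMSEQ_power_zero refl | simp)+
  qed simp
  then have "(\<lambda>m. h (real (k m) / 2 ^ m)) \<longlonglongrightarrow> h x"
    by (rule continuous_on_tendsto_compose[OF c]) (use x dyadic_unit[OF kle] in auto)
  then show ?thesis by (rule LIMSEQ_le_const2) (use le[OF kle] in auto)
qed

text \<open>A dense subset of path space indexed by a countable type, which lets unions over it stay
  inside a sigma-algebra.\<close>

definition rational_bernstein :: "nat \<times> rat list \<Rightarrow> real \<Rightarrow> real" where
  "rational_bernstein = (\<lambda>(n, qs). \<lambda>t\<in>{0..1}. \<Sum>k\<le>n. real_of_rat (qs ! k) * Bernstein n k t)"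

lemma rational_bernstein_mem: "rational_bernstein p \<in> mspace path_space"
proof -
  have "continuous_on {0..1} (rational_bernstein p) = continuous_on {0..1} (\<lambda>t. \<Sum>k\<le>fst p. real_of_rat (snd p ! k) * Bernstein (fst p) k t)"
    by (rule continuous_on_cong) (auto simp: rational_bernstein_def split_def)
  also have "\<dots>" unfolding Bernstein_def by (intro continuous_intros)
  finally show ?thesis by (auto simp: mem_path_space rational_bernstein_def split_def)
qed

text \<open>Bernstein approximation spends half of \<epsilon>, rounding the coefficients to
  rationals the other half. The basis polynomials are nonnegative with sum 1, so rounding errors are
  not amplified.\<close>

lemma rational_bernstein_dense:
  assumes y: "y \<in> mspace path_space" and e: "\<epsilon> > 0"
  shows "\<exists>p. mdist path_space y (rational_bernstein p) \<le> \<epsilon>"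
proof -
  have "continuous_on {0..1} y" using y by (simp add: mem_path_space)
  from Bernstein_Weierstrass[OF this, of "\<epsilon> / 2"] e obtain n
    where n: "\<And>x. x \<in> {0..1} \<Longrightarrow> \<bar>y x - (\<Sum>k\<le>n. y (real k / real n) * Bernstein n k x)\<bar> < \<epsilon> / 2" by auto
  have "\<exists>q. y (real k / real n) < real_of_rat q \<and> real_of_rat q < y (real k / real n) + \<epsilon> / 2" for k
    using of_rat_dense[of "y (real k / real n)" "y (real k / real n) + \<epsilon> / 2"] e by auto
  then obtain q where q0: "\<And>k. y (real k / real n) < real_of_rat (q k) \<and> real_of_rat (q k) < y (real k / real n) + \<epsilon> / 2"
    by metis
  have q: "\<bar>y (real k / real n) - real_of_rat (q k)\<bar> \<le> \<epsilon> / 2" for k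
    using q0[of k] by linarith
  define p where "p = (n, map q [0..<Suc n])"
  have "\<bar>y x - rational_bernstein p x\<bar> \<le> \<epsilon>" if x: "x \<in> {0..1}" for x
  proof -
    have "rational_bernstein p x = (\<Sum>k\<le>n. real_of_rat (q k) * Bernstein n k x)"
      using x unfolding rational_bernstein_def p_def by (auto intro!: sum.cong simp del: upt_Suc)
    moreover have "\<bar>(\<Sum>k\<le>n. y (real k / real n) * Bernstein n k x) - (\<Sum>k\<le>n. real_of_rat (q k) * Bernstein n k x)\<bar> \<le> \<epsilon> / 2"
    proof -
      have "\<bar>(\<Sum>k\<le>n. y (real k / real n) * Bernstein n k x) - (\<Sum>k\<le>n. real_of_rat (q k) * Bernstein n k x)\<bar>
         = \<bar>\<Sum>k\<le>n. (y (real k / real n) - real_of_rat (q k)) * Bernstein n k x\<bar>"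
        by (simp add: sum_subtractf left_diff_distrib)
      also have "\<dots> \<le> (\<Sum>k\<le>n. \<bar>(y (real k / real n) - real_of_rat (q k)) * Bernstein n k x\<bar>)" by (rule sum_abs)
      also have "\<dots> \<le> (\<Sum>k\<le>n. \<epsilon> / 2 * Bernstein n k x)"
      proof (rule sum_mono)
        fix k
        have B: "0 \<le> Bernstein n k x" using x by (simp add: Bernstein_nonneg)
        have "\<bar>(y (real k / real n) - real_of_rat (q k)) * Bernstein n k x\<bar> = \<bar>y (real k / real n) - real_of_rat (q k)\<bar> * Bernstein n k x"
          using B by (simp add: abs_mult)
        also have "\<dots> \<le> \<epsilon> / 2 * Bernstein n k x" using q B by (rule mult_right_mono)
        finally show "\<bar>(y (real k / real n) - real_of_rat (q k)) * Bernstein n k x\<bar> \<le> \<epsilon> / 2 * Bernstein n k x" .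
      qed
      also have "\<dots> = \<epsilon> / 2" by (simp only: sum_distrib_left[symmetric] sum_Bernstein mult_1_right)
      finally show ?thesis .
    qed
    ultimately show ?thesis using n[OF x] by linarith
  qed
  then show ?thesis
    using mdist_path_space_le[OF y rational_bernstein_mem] by blast
qed

text \<open>Separability writes an open set as a countable union of closed balls. By continuity a
  closed ball is a countable intersection of conditions at dyadic points; balls are closed because
  weak inequalities survive the passage from dyadic points to all points.\<close>

lemma sets_path_borel_dyadic: "sets path_borel = sigma_sets (mspace path_space) dyadic_cylinders"
proof
  let ?\<Omega> = "mspace path_space"
  define N where "N = sigma ?\<Omega> dyadic_cylinders"
  have sub: "dyadic_cylinders \<subseteq> Pow ?\<Omega>" by (auto simp: dyadic_cylinders_def)
  have N: "sets N = sigma_sets ?\<Omega> dyadic_cylinders" "space N = ?\<Omega>" using sub by (auto simp: N_def)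
  have "dyadic_cylinders \<subseteq> sets path_borel"
    using measurable_sets[OF dyadic_eval_measurable_path_borel] by (auto simp: dyadic_cylinders_def space_path_borel)
  then show "sigma_sets ?\<Omega> dyadic_cylinders \<subseteq> sets path_borel"
    using sets.sigma_sets_subset[of dyadic_cylinders path_borel] by (simp add: space_path_borel)
  have T: "dyadic_eval m \<in> measurable N (\<Pi>\<^sub>M i\<in>{..2 ^ m}. borel)" for m
  proof (rule measurableI)
    show "dyadic_eval m y \<in> space (\<Pi>\<^sub>M i\<in>{..2 ^ m}. borel)" for y
      by (simp add: dyadic_eval_def space_PiM)
    show "dyadic_eval m -` B \<inter> space N \<in> sets N" if "B \<in> sets (\<Pi>\<^sub>M i\<in>{..2 ^ m}. borel)" for B
      unfolding N using that by (intro sigma_sets.Basic) (auto simp: dyadic_cylinders_def)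
  qed
  have ev[measurable]: "(\<lambda>y. y (real i / 2 ^ m)) \<in> borel_measurable N" if "i \<le> 2 ^ m" for i m
  proof -
    have "(\<lambda>y. dyadic_eval m y i) \<in> borel_measurable N"
      using measurable_compose[OF T measurable_component_singleton[of i "{..2 ^ m}" "\<lambda>_. borel"]] that by simp
    then show ?thesis using that by (simp add: dyadic_eval_def)
  qed
  have cball: "{y \<in> ?\<Omega>. mdist path_space z y \<le> r} \<in> sets N" if z: "z \<in> ?\<Omega>" for z r
  proof -
    have "{y \<in> ?\<Omega>. mdist path_space z y \<le> r} = {y \<in> space N. \<forall>m. \<forall>i\<in>{..2 ^ m}. \<bar>z (real i / 2 ^ m) - y (real i / 2 ^ m)\<bar> \<le> r}"
    proof -
      have "mdist path_space z y \<le> r \<longleftrightarrow> (\<forall>m. \<forall>i\<in>{..2 ^ m}. \<bar>z (real i / 2 ^ m) - y (real i / 2 ^ m)\<bar> \<le> r)" if y: "y \<in> ?\<Omega>" for y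
        unfolding mdist_path_space_le[OF z y]
      proof safe
        fix t :: real assume t: "t \<in> {0..1}" and *: "\<forall>m. \<forall>i\<in>{..2 ^ m}. \<bar>z (real i / 2 ^ m) - y (real i / 2 ^ m)\<bar> \<le> r"
        have "continuous_on {0..1} (\<lambda>t. \<bar>z t - y t\<bar>)"
          using y z by (intro continuous_intros) (auto simp: mem_path_space)
        then show "\<bar>z t - y t\<bar> \<le> r" by (rule dyadic_dense_le) (use * t in auto)
      qed (use dyadic_unit in auto)
      then show ?thesis unfolding N by blast
    qed
    also have "\<dots> \<in> sets N"
    proof -
      have [measurable]: "{y \<in> space N. \<bar>z (real i / 2 ^ m) - y (real i / 2 ^ m)\<bar> \<le> r} \<in> sets N" if "i \<le> 2 ^ m" for i m
        using ev[OF that] by measurable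
      show ?thesis by (intro sets.sets_Collect_countable_All sets.sets_Collect_finite_All') auto
    qed
    finally show ?thesis .
  qed
  have "U \<in> sets N" if U: "openin (mtopology_of path_space) U" for U
  proof -
    define C where "C = {(p, r) | p r :: rat. {y \<in> ?\<Omega>. mdist path_space (rational_bernstein p) y \<le> real_of_rat r} \<subseteq> U}"
    interpret Metric_space ?\<Omega> "mdist path_space" by simp
    have "U = (\<Union>(p, r)\<in>C. {y \<in> ?\<Omega>. mdist path_space (rational_bernstein p) y \<le> real_of_rat r})"
    proof
      show "U \<subseteq> (\<Union>(p, r)\<in>C. {y \<in> ?\<Omega>. mdist path_space (rational_bernstein p) y \<le> real_of_rat r})"
      proof
        fix y assume y: "y \<in> U"
        then obtain e where e: "e > 0" "\<And>z. z \<in> ?\<Omega> \<Longrightarrow> mdist path_space y z < e \<Longrightarrow> z \<in> U"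
          using U unfolding openin_path_space by blast
        have y': "y \<in> ?\<Omega>" using y U openin_path_space by blast
        \<comment> \<open>A centre within e / 4 of y and a rational radius between e / 4 and e / 2:
          the ball contains y, and all its points are within 3 e / 4 of y.\<close>
        obtain p where p: "mdist path_space y (rational_bernstein p) \<le> e / 4"
          using rational_bernstein_dense[OF y', of "e / 4"] e by auto
        obtain r where r: "e / 4 < real_of_rat r" "real_of_rat r < e / 2"
          using of_rat_dense[of "e / 4" "e / 2"] e by auto
        let ?z = "rational_bernstein p"
        have zm: "?z \<in> ?\<Omega>" by (rule rational_bernstein_mem)
        have "{w \<in> ?\<Omega>. mdist path_space ?z w \<le> real_of_rat r} \<subseteq> U"
        proof safe
          fix w assume w: "w \<in> ?\<Omega>" "mdist path_space ?z w \<le> real_of_rat r"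
          have "mdist path_space y w \<le> mdist path_space y ?z + mdist path_space ?z w"
            by (rule triangle) (use y' w zm in auto)
          also have "\<dots> < e" using p w r e by linarith
          finally show "w \<in> U" using e w by blast
        qed
        moreover have "mdist path_space ?z y \<le> real_of_rat r" using p r commute by (metis order.trans less_imp_le)
        ultimately show "y \<in> (\<Union>(p, r)\<in>C. {y \<in> ?\<Omega>. mdist path_space (rational_bernstein p) y \<le> real_of_rat r})"
          using y' by (intro UN_I[of "(p, r)"]) (cases p, auto simp: C_def)
      qed
      show "(\<Union>(p, r)\<in>C. {y \<in> ?\<Omega>. mdist path_space (rational_bernstein p) y \<le> real_of_rat r}) \<subseteq> U"
        by (auto simp: C_def)
    qed
    also have "\<dots> \<in> sets N"
      by (intro sets.countable_UN') (auto simp: cball rational_bernstein_mem)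
    finally show ?thesis .
  qed
  then have "sigma_sets ?\<Omega> {U. openin (mtopology_of path_space) U} \<subseteq> sets N"
    using sets.sigma_sets_subset[of "{U. openin (mtopology_of path_space) U}" N] by (auto simp: N(2))
  then show "sets path_borel \<subseteq> sigma_sets ?\<Omega> dyadic_cylinders"
    unfolding sets_path_borel N(1) .
qed

section \<open>Gaussian white noise\<close>

text \<open>Completing the square around the midpoint: (x - a)^2 + (x - b)^2 = 2 (x - (a + b) / 2)^2
  + (a - b)^2 / 2. The geometric mean of the densities is thus a multiple of the normal density
  centred there.\<close>

lemma normal_density_affinity:
  assumes s: "\<sigma> > 0"
  shows "(LINT x|lborel. sqrt (normal_density a \<sigma> x * normal_density b \<sigma> x)) = exp (- (a - b)\<^sup>2 / (8 * \<sigma>\<^sup>2))"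
proof -
  have "sqrt (normal_density a \<sigma> x * normal_density b \<sigma> x) = exp (- (a - b)\<^sup>2 / (8 * \<sigma>\<^sup>2)) * normal_density ((a + b) / 2) \<sigma> x" for x
  proof (rule real_sqrt_unique)
    have e: "- (x - a)\<^sup>2 / (2 * \<sigma>\<^sup>2) + - (x - b)\<^sup>2 / (2 * \<sigma>\<^sup>2) = 2 * (- (a - b)\<^sup>2 / (8 * \<sigma>\<^sup>2) + - (x - (a + b) / 2)\<^sup>2 / (2 * \<sigma>\<^sup>2))"
      using s by (simp add: field_simps power2_eq_square)
    have "(exp (- (a - b)\<^sup>2 / (8 * \<sigma>\<^sup>2)) * normal_density ((a + b) / 2) \<sigma> x)\<^sup>2
      = (1 / sqrt (2 * pi * \<sigma>\<^sup>2))\<^sup>2 * exp (2 * (- (a - b)\<^sup>2 / (8 * \<sigma>\<^sup>2) + - (x - (a + b) / 2)\<^sup>2 / (2 * \<sigma>\<^sup>2)))"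
      unfolding normal_density_def exp_double exp_add by (simp only: power_mult_distrib ac_simps)
    also have "\<dots> = normal_density a \<sigma> x * normal_density b \<sigma> x"
      unfolding e[symmetric] exp_add normal_density_def power2_eq_square[of "1 / sqrt (2 * pi * \<sigma>\<^sup>2)"] by (simp only: ac_simps)
    finally show "(exp (- (a - b)\<^sup>2 / (8 * \<sigma>\<^sup>2)) * normal_density ((a + b) / 2) \<sigma> x)\<^sup>2 = normal_density a \<sigma> x * normal_density b \<sigma> x" .
  qed (simp add: normal_density_nonneg)
  then show ?thesis using s by simp
qed

lemma set_integrable_sqrt_prob_density:
  assumes f: "prob_density f"
  shows "integrable unit_lebesgue (\<lambda>x. sqrt (f x))" "set_integrable lborel {0..1} (\<lambda>x. sqrt (f x))"
proof -
  note F = prob_densityD[OF f]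
  note [measurable] = F(1)
  show "integrable unit_lebesgue (\<lambda>x. sqrt (f x))"
  proof (rule sq_integrable_unit)
    have "integrable unit_lebesgue (\<lambda>x. (sqrt (f x))\<^sup>2) = integrable unit_lebesgue f"
      using F(2) by (intro Bochner_Integration.integrable_cong) auto
    then show "integrable unit_lebesgue (\<lambda>x. (sqrt (f x))\<^sup>2)" using F(3) by simp
  qed measurable
  then show "set_integrable lborel {0..1} (\<lambda>x. sqrt (f x))"
    unfolding set_integrable_def by (subst (asm) integrable_restrict_space) auto
qed

lemma continuous_on_primitive:
  assumes "set_integrable lborel {0..1} (h :: real \<Rightarrow> real)"
  shows "continuous_on {0..1} (\<lambda>t. LBINT s:{0..t}. h s)"
proof -
  have "h integrable_on {0..1}" using set_borel_integral_eq_integral[OF assms] by simp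
  then have "continuous_on {0..1} (\<lambda>t. integral {0..t} h)" by (rule indefinite_integral_continuous_1)
  moreover have "(LBINT s:{0..t}. h s) = integral {0..t} h" if "t \<in> {0..1}" for t
  proof -
    have "set_integrable lborel {0..t} h" by (rule set_integrable_subset[OF assms]) (use that in auto)
    then show ?thesis by (rule set_borel_integral_eq_integral)
  qed
  ultimately show ?thesis
    by (subst continuous_on_cong[OF refl, where g = "\<lambda>t. integral {0..t} h"]) auto
qed

text \<open>The half-open interval is chosen to match \<open>dyadic_cell\<close>; the endpoints are
  null.\<close>

lemma primitive_diff:
  assumes h: "integrable unit_lebesgue (h :: real \<Rightarrow> real)" and st: "0 \<le> s" "s \<le> t" "t \<le> 1"
  shows "(LBINT x:{0..t}. h x) - (LBINT x:{0..s}. h x) = (LINT x|unit_lebesgue. indicator {s..<t} x * h x)"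
proof -
  note [measurable] = borel_measurable_integrable[OF h]
  have e: "(LBINT x:{0..r}. h x) = (LINT x|unit_lebesgue. indicator {0..r} x * h x)" if "r \<le> 1" for r
    unfolding set_lebesgue_integral_def using that
    by (subst integral_restrict_space) (auto intro!: Bochner_Integration.integral_cong simp: indicator_def)
  have i: "integrable unit_lebesgue (\<lambda>x. indicator {0..r} x * h x)" for r
    by (rule Bochner_Integration.integrable_bound[OF h]) (auto simp: indicator_def)
  have "(LBINT x:{0..t}. h x) - (LBINT x:{0..s}. h x) = (LINT x|unit_lebesgue. indicator {0..t} x * h x - indicator {0..s} x * h x)"
    using st i by (simp add: e)
  also have "\<dots> = (LINT x|unit_lebesgue. indicator {s..<t} x * h x)"
  proof (rule integral_cong_AE)
    have "AE x in lborel. x \<noteq> s \<and> x \<noteq> t" by (intro AE_conjI AE_lborel_singleton)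
    then have "AE x in lborel. x \<in> {0..1} \<longrightarrow> x \<noteq> s \<and> x \<noteq> t" by eventually_elim auto
    then have "AE x in unit_lebesgue. x \<noteq> s \<and> x \<noteq> t"
      by (rule AE_restrict_space_iff[THEN iffD2, rotated]) simp
    then show "AE x in unit_lebesgue. indicator {0..t} x * h x - indicator {0..s} x * h x = indicator {s..<t} x * h x"
      by eventually_elim (use st in \<open>auto simp: indicator_def\<close>)
  qed measurable
  finally show ?thesis .
qed

section \<open>The white noise path and its dyadic increments\<close>

definition white_noise_path :: "(real \<Rightarrow> 'w \<Rightarrow> real) \<Rightarrow> nat \<Rightarrow> (real \<Rightarrow> real) \<Rightarrow> 'w \<Rightarrow> real \<Rightarrow> real" where
  "white_noise_path W n f \<omega> = (\<lambda>t\<in>{0..1}. 2 * (LBINT s:{0..t}. sqrt (f s)) + W t \<omega> / sqrt (real n))"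

text \<open>Written as affine images of the increments of \<open>W\<close>, so that normality and
  independence carry over at once; \<open>white_noise_increments_path\<close> identifies them with
  increments of the path.\<close>

definition white_noise_increments :: "(real \<Rightarrow> 'w \<Rightarrow> real) \<Rightarrow> nat \<Rightarrow> (real \<Rightarrow> real) \<Rightarrow> nat \<Rightarrow> 'w \<Rightarrow> nat \<Rightarrow> real" where
  "white_noise_increments W n f m \<omega> = (\<lambda>i\<in>{..<2 ^ m}.
     2 * (LINT x|unit_lebesgue. indicator (dyadic_cell m i) x * sqrt (f x))
       + 1 / sqrt (real n) * (W (real (Suc i) / 2 ^ m) \<omega> - W (real i / 2 ^ m) \<omega>))"

context
  fixes M :: "'w measure" and W :: "real \<Rightarrow> 'w \<Rightarrow> real"
  assumes W: "brownian_motion01 M W"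
begin

interpretation prob_space M using W by (simp add: brownian_motion01_def)

text \<open>As dyadic cylinders generate the Borel sets, measurability into path space reduces to
  continuity of the paths and measurability of finitely many coordinates.\<close>

lemma white_noise_path_measurable:
  assumes f: "prob_density f"
  shows "white_noise_path W n f \<in> measurable M path_borel"
proof (rule measurable_sigma_sets[OF sets_path_borel_dyadic])
  have Wm: "\<And>t. t \<in> {0..1} \<Longrightarrow> W t \<in> borel_measurable M"
    and Wc: "\<And>\<omega>. \<omega> \<in> space M \<Longrightarrow> continuous_on {0..1} (\<lambda>t. W t \<omega>)"
    using W by (auto simp: brownian_motion01_def)
  show sub: "dyadic_cylinders \<subseteq> Pow (mspace path_space)" by (auto simp: dyadic_cylinders_def)
  have mem: "white_noise_path W n f \<omega> \<in> mspace path_space" if "\<omega> \<in> space M" for \<omega>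
  proof -
    \<comment> \<open>With \<open>inverse\<close> the noise term is a product with a constant, whose
      continuity also covers n = 0.\<close>
    have "continuous_on {0..1} (\<lambda>t. 2 * (LBINT s:{0..t}. sqrt (f s)) + W t \<omega> * inverse (sqrt (real n)))"
      by (intro continuous_intros continuous_on_primitive set_integrable_sqrt_prob_density f Wc that)
    then have "continuous_on {0..1} (white_noise_path W n f \<omega>)"
      by (rule continuous_on_eq) (simp add: white_noise_path_def divide_inverse)
    then show ?thesis
      unfolding mem_path_space white_noise_path_def by simp
  qed
  then show "white_noise_path W n f \<in> space M \<rightarrow> mspace path_space" by auto
  fix A assume "A \<in> dyadic_cylinders"
  then obtain m B where A: "A = dyadic_eval m -` B \<inter> mspace path_space" "B \<in> sets (\<Pi>\<^sub>M i\<in>{..2 ^ m}. borel)"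
    by (auto simp: dyadic_cylinders_def)
  have "(\<lambda>\<omega>. dyadic_eval m (white_noise_path W n f \<omega>)) \<in> measurable M (\<Pi>\<^sub>M i\<in>{..2 ^ m}. borel)"
    unfolding dyadic_eval_def
  proof (rule measurable_restrict)
    fix i :: nat assume "i \<in> {..2 ^ m}"
    then have u: "real i / 2 ^ m \<in> {0..1}" using dyadic_unit by auto
    note [measurable] = Wm[OF u]
    show "(\<lambda>\<omega>. white_noise_path W n f \<omega> (real i / 2 ^ m)) \<in> borel_measurable M"
      unfolding white_noise_path_def using u by simp
  qed
  then have "(\<lambda>\<omega>. dyadic_eval m (white_noise_path W n f \<omega>)) -` B \<inter> space M \<in> sets M"
    using A(2) by (rule measurable_sets)
  also have "(\<lambda>\<omega>. dyadic_eval m (white_noise_path W n f \<omega>)) -` B \<inter> space M = white_noise_path W n f -` A \<inter> space M"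
    using mem by (auto simp: A(1))
  finally show "white_noise_path W n f -` A \<inter> space M \<in> sets M" .
qed

lemma white_noise_law_distr: "white_noise_law M W n f = distr M path_borel (white_noise_path W n f)"
  unfolding white_noise_law_def white_noise_path_def ..

lemma prob_space_white_noise_law:
  assumes "prob_density f"
  shows "prob_space (white_noise_law M W n f)"
  unfolding white_noise_law_distr by (rule prob_space_distr[OF white_noise_path_measurable[OF assms]])

lemma white_noise_increments_path:
  assumes f: "prob_density f"
  shows "white_noise_increments W n f m \<omega> = (\<lambda>i\<in>{..<2 ^ m}. white_noise_path W n f \<omega> (real (Suc i) / 2 ^ m) - white_noise_path W n f \<omega> (real i / 2 ^ m))"
proof (unfold white_noise_increments_def, rule restrict_ext)
  fix i :: nat assume "i \<in> {..<2 ^ m}"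
  then have i: "Suc i \<le> 2 ^ m" "i \<le> 2 ^ m" by auto
  note u = dyadic_unit[OF i(1)] dyadic_unit[OF i(2)]
  have le: "real i / 2 ^ m \<le> real (Suc i) / 2 ^ m" by (intro divide_right_mono) auto
  have "(LBINT s:{0..real (Suc i) / 2 ^ m}. sqrt (f s)) - (LBINT s:{0..real i / 2 ^ m}. sqrt (f s))
    = (LINT x|unit_lebesgue. indicator (dyadic_cell m i) x * sqrt (f x))"
    unfolding dyadic_cell_def
    by (rule primitive_diff[OF set_integrable_sqrt_prob_density(1)[OF f] _ le]) (use u in \<open>simp_all only: atLeastAtMost_iff\<close>)
  then show "2 * (LINT x|unit_lebesgue. indicator (dyadic_cell m i) x * sqrt (f x)) + 1 / sqrt (real n) * (W (real (Suc i) / 2 ^ m) \<omega> - W (real i / 2 ^ m) \<omega>)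
    = white_noise_path W n f \<omega> (real (Suc i) / 2 ^ m) - white_noise_path W n f \<omega> (real i / 2 ^ m)"
    unfolding white_noise_path_def restrict_apply'[OF u(1)] restrict_apply'[OF u(2)]
    by (simp add: diff_divide_distrib del: of_nat_Suc flip: right_diff_distrib)
qed

lemma white_noise_increments_distr:
  assumes n: "n \<ge> 1"
  shows "white_noise_increments W n f m \<in> measurable M (\<Pi>\<^sub>M i\<in>{..<2 ^ m}. lborel)"
    "distr M (\<Pi>\<^sub>M i\<in>{..<2 ^ m}. lborel) (white_noise_increments W n f m) = (\<Pi>\<^sub>M i\<in>{..<2 ^ m}.
      density lborel (normal_density (2 * (LINT x|unit_lebesgue. indicator (dyadic_cell m i) x * sqrt (f x))) (sqrt (1 / (real n * 2 ^ m)))))"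
proof -
  let ?a = "\<lambda>i. 2 * (LINT x|unit_lebesgue. indicator (dyadic_cell m i) x * sqrt (f x))"
  let ?D = "\<lambda>i \<omega>. W (real (Suc i) / 2 ^ m) \<omega> - W (real i / 2 ^ m) \<omega>"
  let ?X = "\<lambda>i \<omega>. ?a i + 1 / sqrt (real n) * ?D i \<omega>"
  let ?\<sigma> = "sqrt (1 / (real n * 2 ^ m))"
  have step: "real (Suc i) / 2 ^ m - real i / 2 ^ m = 1 / 2 ^ m" for i
    by (simp add: diff_divide_distrib[symmetric])
  have X: "distributed M lborel (?X i) (normal_density (?a i) ?\<sigma>)" if i: "i \<in> {..<2 ^ m}" for i
  proof -
    have u: "real (Suc i) / 2 ^ m \<in> {0..1}" "real i / 2 ^ m \<in> {0..1}" using i by (auto intro!: dyadic_unit simp del: of_nat_Suc)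
    have "0 \<le> real i / 2 ^ m \<and> real i / 2 ^ m < real (Suc i) / 2 ^ m \<and> real (Suc i) / 2 ^ m \<le> 1"
      using u by (auto simp del: of_nat_Suc intro: divide_strict_right_mono)
    then have "distributed M lborel (?D i) (normal_density 0 (sqrt (real (Suc i) / 2 ^ m - real i / 2 ^ m)))"
      using W unfolding brownian_motion01_def by blast
    then have "distributed M lborel (?D i) (normal_density 0 (sqrt (1 / 2 ^ m)))" unfolding step .
    then have "distributed M lborel (?X i) (normal_density (?a i + 1 / sqrt (real n) * 0) (\<bar>1 / sqrt (real n)\<bar> * sqrt (1 / 2 ^ m)))"
      by (rule normal_density_affine) (use n in auto)
    moreover have "\<bar>1 / sqrt (real n)\<bar> * sqrt (1 / 2 ^ m) = ?\<sigma>"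
      by (simp add: real_sqrt_divide real_sqrt_mult)
    ultimately show ?thesis by simp
  qed
  have Xm: "?X i \<in> borel_measurable M" if "i \<in> {..<2 ^ m}" for i
    using distributed_measurable[OF X[OF that]] by simp
  then show m: "white_noise_increments W n f m \<in> measurable M (\<Pi>\<^sub>M i\<in>{..<2 ^ m}. lborel)"
    unfolding white_noise_increments_def by (intro measurable_restrict) simp
  have "mono_on {..2 ^ m} (\<lambda>i. real i / 2 ^ m) \<and> (\<lambda>i. real i / 2 ^ m) ` {..2 ^ m} \<subseteq> {0..1}"
    using dyadic_unit by (auto intro!: mono_onI divide_right_mono)
  then have "indep_vars (\<lambda>_. borel) (\<lambda>i \<omega>. ?D i \<omega>) {..<2 ^ m}"
    using W unfolding brownian_motion01_def by blast
  then have ind: "indep_vars (\<lambda>_. borel) (\<lambda>i \<omega>. (\<lambda>x. ?a i + 1 / sqrt (real n) * x) (?D i \<omega>)) {..<2 ^ m}"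
    by (rule indep_vars_compose2) simp
  \<comment> \<open>Independence is phrased over \<open>borel\<close>, densities over
    \<open>lborel\<close>; both carry the same sigma-algebra, which is all that \<open>distr\<close>
    sees.\<close>
  have "distr M (\<Pi>\<^sub>M i\<in>{..<2 ^ m}. lborel) (white_noise_increments W n f m) = distr M (\<Pi>\<^sub>M i\<in>{..<2 ^ m}. borel) (\<lambda>\<omega>. \<lambda>i\<in>{..<2 ^ m}. ?X i \<omega>)"
    unfolding white_noise_increments_def by (intro distr_cong sets_PiM_cong) auto
  also have "\<dots> = (\<Pi>\<^sub>M i\<in>{..<2 ^ m}. distr M borel (?X i))"
    using ind by (subst (asm) indep_vars_iff_distr_eq_PiM') (use Xm in \<open>auto simp: lessThan_empty_iff\<close>)
  also have "\<dots> = (\<Pi>\<^sub>M i\<in>{..<2 ^ m}. density lborel (normal_density (?a i) ?\<sigma>))"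
  proof (rule PiM_cong)
    fix i :: nat assume i: "i \<in> {..<2 ^ m}"
    have "distr M borel (?X i) = distr M lborel (?X i)" by (rule distr_cong) auto
    also have "\<dots> = density lborel (normal_density (?a i) ?\<sigma>)" by (rule distributed_distr_eq_density[OF X[OF i]])
    finally show "distr M borel (?X i) = density lborel (normal_density (?a i) ?\<sigma>)" .
  qed simp
  finally show "distr M (\<Pi>\<^sub>M i\<in>{..<2 ^ m}. lborel) (white_noise_increments W n f m) = (\<Pi>\<^sub>M i\<in>{..<2 ^ m}. density lborel (normal_density (?a i) ?\<sigma>))" .
qed

end

section \<open>Approximation by functions of finitely many dyadic evaluations\<close>

lemma dyadic_eval_refine:
  "dyadic_eval m y = (\<lambda>i\<in>{..2 ^ m}. dyadic_eval (m + k) y (i * 2 ^ k))"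
proof (unfold dyadic_eval_def, rule restrict_ext)
  fix i :: nat assume "i \<in> {..2 ^ m}"
  then have i: "i * 2 ^ k \<in> {..2 ^ (m + k)}" by (simp add: power_add)
  have "real (i * 2 ^ k) / 2 ^ (m + k) = real i / 2 ^ m" by (simp add: power_add)
  then show "y (real i / 2 ^ m) = (\<lambda>i\<in>{..2 ^ (m + k)}. y (real i / 2 ^ (m + k))) (i * 2 ^ k)"
    using i by simp
qed

lemma dyadic_refine_measurable:
  "(\<lambda>x. \<lambda>i\<in>{..2 ^ m}. x (i * 2 ^ k)) \<in> measurable (\<Pi>\<^sub>M i\<in>{..2 ^ (m + k) :: nat}. borel) (\<Pi>\<^sub>M i\<in>{..2 ^ m :: nat}. (borel :: real measure))"
proof (rule measurable_restrict)
  fix i :: nat assume "i \<in> {..2 ^ m}"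
  then have "i * 2 ^ k \<in> {..2 ^ (m + k)}" by (simp add: power_add)
  then show "(\<lambda>x. x (i * 2 ^ k)) \<in> borel_measurable (\<Pi>\<^sub>M i\<in>{..2 ^ (m + k)}. borel)"
    by (rule measurable_component_singleton)
qed

text \<open>The general density lemma with the bounded cylinder functions as subspace: boundedness
  gives integrability under every finite measure, nestedness of the levels gives closure under
  addition.\<close>

lemma cylinder_functions_dense:
  assumes fin: "finite_measure \<nu>" and sets: "sets \<nu> = sets path_borel"
    and u: "integrable \<nu> u" and e: "\<epsilon> > (0::real)"
  shows "\<exists>m w. w \<in> borel_measurable (\<Pi>\<^sub>M i\<in>{..2 ^ m}. borel) \<and>
    integrable \<nu> (\<lambda>y. w (dyadic_eval m y)) \<and> (LINT y|\<nu>. \<bar>u y - w (dyadic_eval m y)\<bar>) < \<epsilon>"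
proof -
  interpret finite_measure \<nu> by fact
  let ?\<Omega> = "mspace path_space"
  have sp: "space \<nu> = ?\<Omega>" using sets_eq_imp_space_eq[OF sets] by (simp add: space_path_borel)
  have T: "dyadic_eval m \<in> measurable \<nu> (\<Pi>\<^sub>M i\<in>{..2 ^ m}. borel)" for m
    using dyadic_eval_measurable_path_borel sets by (simp cong: measurable_cong_sets)
  define V :: "((real \<Rightarrow> real) \<Rightarrow> real) set" where
    "V = {v. \<exists>m w B. w \<in> borel_measurable (\<Pi>\<^sub>M i\<in>{..2 ^ m}. borel) \<and> (\<forall>x. \<bar>w x\<bar> \<le> B) \<and> (\<forall>y\<in>?\<Omega>. v y = w (dyadic_eval m y))}"
  have V_I: "v \<in> V" if "w \<in> borel_measurable (\<Pi>\<^sub>M i\<in>{..2 ^ m}. borel)" "\<And>x. \<bar>w x\<bar> \<le> B" "\<And>y. y \<in> ?\<Omega> \<Longrightarrow> v y = w (dyadic_eval m y)" for v m w B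
    unfolding V_def using that by blast
  have int: "integrable \<nu> (\<lambda>y. w (dyadic_eval m y))"
    if w: "w \<in> borel_measurable (\<Pi>\<^sub>M i\<in>{..2 ^ m}. borel)" "\<And>x. \<bar>w x\<bar> \<le> B" for w m and B :: real
    by (rule integrable_const_bound[of _ B]) (use w measurable_compose[OF T w(1)] in auto)
  have cong: "integrable \<nu> v \<longleftrightarrow> integrable \<nu> (\<lambda>y. w (dyadic_eval m y))"
    if "\<And>y. y \<in> ?\<Omega> \<Longrightarrow> v y = w (dyadic_eval m y)" for v m and w :: "(nat \<Rightarrow> real) \<Rightarrow> real"
    using that by (intro Bochner_Integration.integrable_cong) (auto simp: sp)
  have "\<exists>v\<in>V. (LINT x|\<nu>. \<bar>u x - v x\<bar>) < \<epsilon>"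
  proof (rule integrable_dense_subspace[OF fin, of dyadic_cylinders])
    show "sets \<nu> = sigma_sets (space \<nu>) dyadic_cylinders"
      unfolding sets sp sets_path_borel_dyadic ..
    show "dyadic_cylinders \<subseteq> Pow (space \<nu>)" by (auto simp: dyadic_cylinders_def sp)
    show "Int_stable dyadic_cylinders"
    proof (rule Int_stableI)
      fix a b assume "a \<in> dyadic_cylinders" "b \<in> dyadic_cylinders"
      then obtain m k A B where ab: "a = dyadic_eval m -` A \<inter> ?\<Omega>" "A \<in> sets (\<Pi>\<^sub>M i\<in>{..2 ^ m}. borel)"
          "b = dyadic_eval k -` B \<inter> ?\<Omega>" "B \<in> sets (\<Pi>\<^sub>M i\<in>{..2 ^ k}. borel)"
        unfolding dyadic_cylinders_def by auto
      let ?L = "\<Pi>\<^sub>M i\<in>{..2 ^ (m + k)}. (borel :: real measure)"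
      let ?A = "(\<lambda>x. \<lambda>i\<in>{..2 ^ m}. x (i * 2 ^ k)) -` A \<inter> space ?L"
      let ?B = "(\<lambda>x. \<lambda>i\<in>{..2 ^ k}. x (i * 2 ^ m)) -` B \<inter> space ?L"
      have "?A \<in> sets ?L" by (rule measurable_sets[OF dyadic_refine_measurable ab(2)])
      moreover have "?B \<in> sets ?L"
        using measurable_sets[OF dyadic_refine_measurable[where m = k and k = m] ab(4)] by (simp add: add.commute)
      moreover have "dyadic_eval (m + k) y \<in> space ?L" for y by (simp add: dyadic_eval_def space_PiM)
      then have "a \<inter> b = dyadic_eval (m + k) -` (?A \<inter> ?B) \<inter> ?\<Omega>"
        unfolding ab using dyadic_eval_refine[of m _ k] dyadic_eval_refine[of k _ m] by (auto simp: add.commute)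
      ultimately show "a \<inter> b \<in> dyadic_cylinders" unfolding dyadic_cylinders_def by blast
    qed
    show "integrable \<nu> v" if v: "v \<in> V" for v
    proof -
      obtain m w B where w: "w \<in> borel_measurable (\<Pi>\<^sub>M i\<in>{..2 ^ m}. borel)" "\<And>x. \<bar>w x\<bar> \<le> B"
          "\<And>y. y \<in> ?\<Omega> \<Longrightarrow> v y = w (dyadic_eval m y)" using v unfolding V_def by blast
      show ?thesis using cong[of v w m, OF w(3)] int[OF w(1,2)] by blast
    qed
    show "(\<lambda>x. v x + v' x) \<in> V" if vv: "v \<in> V" "v' \<in> V" for v v'
    proof -
      obtain m w B where w: "w \<in> borel_measurable (\<Pi>\<^sub>M i\<in>{..2 ^ m}. borel)" "\<And>x. \<bar>w x\<bar> \<le> B"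
          "\<And>y. y \<in> ?\<Omega> \<Longrightarrow> v y = w (dyadic_eval m y)" using vv unfolding V_def by blast
      obtain k w' B' where w': "w' \<in> borel_measurable (\<Pi>\<^sub>M i\<in>{..2 ^ k}. borel)" "\<And>x. \<bar>w' x\<bar> \<le> B'"
          "\<And>y. y \<in> ?\<Omega> \<Longrightarrow> v' y = w' (dyadic_eval k y)" using vv unfolding V_def by blast
      show ?thesis
      proof (rule V_I[where m = "m + k" and B = "B + B'" and
            w = "\<lambda>x. w (\<lambda>i\<in>{..2 ^ m}. x (i * 2 ^ k)) + w' (\<lambda>i\<in>{..2 ^ k}. x (i * 2 ^ m))"])
        show "(\<lambda>x. w (\<lambda>i\<in>{..2 ^ m}. x (i * 2 ^ k)) + w' (\<lambda>i\<in>{..2 ^ k}. x (i * 2 ^ m))) \<in> borel_measurable (\<Pi>\<^sub>M i\<in>{..2 ^ (m + k)}. borel)"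
          using measurable_compose[OF dyadic_refine_measurable[where m = m and k = k] w(1)]
            measurable_compose[OF dyadic_refine_measurable[where m = k and k = m] w'(1)]
          by (intro borel_measurable_add) (auto simp: add.commute)
        show "\<bar>w (\<lambda>i\<in>{..2 ^ m}. x (i * 2 ^ k)) + w' (\<lambda>i\<in>{..2 ^ k}. x (i * 2 ^ m))\<bar> \<le> B + B'" for x
          by (rule order_trans[OF abs_triangle_ineq add_mono[OF w(2) w'(2)]])
        show "v y + v' y = w (\<lambda>i\<in>{..2 ^ m}. dyadic_eval (m + k) y (i * 2 ^ k)) + w' (\<lambda>i\<in>{..2 ^ k}. dyadic_eval (m + k) y (i * 2 ^ m))"
          if "y \<in> ?\<Omega>" for y
          using w(3)[OF that] w'(3)[OF that] dyadic_eval_refine[of m y k] dyadic_eval_refine[of k y m] by (simp add: add.commute)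
      qed
    qed
    show "(\<lambda>x. c * v x) \<in> V" if v: "v \<in> V" for v c
    proof -
      obtain m w B where w: "w \<in> borel_measurable (\<Pi>\<^sub>M i\<in>{..2 ^ m}. borel)" "\<And>x. \<bar>w x\<bar> \<le> B"
          "\<And>y. y \<in> ?\<Omega> \<Longrightarrow> v y = w (dyadic_eval m y)" using v unfolding V_def by blast
      then show ?thesis
        by (intro V_I[where m = m and w = "\<lambda>x. c * w x" and B = "\<bar>c\<bar> * B"]) (auto simp: abs_mult intro: mult_left_mono)
    qed
    show "(\<lambda>_. 1) \<in> V" by (rule V_I[where w = "\<lambda>_. 1" and B = 1]) auto
    show "indicator A \<in> V" if A: "A \<in> dyadic_cylinders" for A
    proof -
      obtain m B where B: "A = dyadic_eval m -` B \<inter> ?\<Omega>" "B \<in> sets (\<Pi>\<^sub>M i\<in>{..2 ^ m}. borel)"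
        using A by (auto simp: dyadic_cylinders_def)
      show ?thesis
        by (rule V_I[where m = m and w = "indicator B" and B = 1]) (use B in \<open>auto simp: indicator_def\<close>)
    qed
  qed (use u e in auto)
  then obtain v where v: "v \<in> V" "(LINT x|\<nu>. \<bar>u x - v x\<bar>) < \<epsilon>" by blast
  then obtain m w B where w: "w \<in> borel_measurable (\<Pi>\<^sub>M i\<in>{..2 ^ m}. borel)" "\<And>x. \<bar>w x\<bar> \<le> B"
      "\<And>y. y \<in> ?\<Omega> \<Longrightarrow> v y = w (dyadic_eval m y)" unfolding V_def by blast
  have "(LINT x|\<nu>. \<bar>u x - v x\<bar>) = (LINT y|\<nu>. \<bar>u y - w (dyadic_eval m y)\<bar>)"
    using w(3) by (intro Bochner_Integration.integral_cong) (auto simp: sp)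
  then show ?thesis using w(1) int[OF w(1,2)] v(2) by (intro exI[of _ m] exI[of _ w]) simp
qed

text \<open>Both densities with respect to P + Q are at most 1. A single L^1 approximation under P +
  Q therefore controls the error under P and under Q at once.\<close>

lemma integral_le_sum_measure:
  fixes h :: "'a \<Rightarrow> real"
  assumes P: "prob_space P" and Q: "prob_space Q" and sets_eq: "sets Q = sets P"
    and h: "integrable (sum_measure P Q) h" and nn: "\<And>x. x \<in> space P \<Longrightarrow> 0 \<le> h x"
  shows "(LINT x|P. h x) \<le> (LINT x|sum_measure P Q. h x)" "(LINT x|Q. h x) \<le> (LINT x|sum_measure P Q. h x)"
proof -
  obtain p where p: "p \<in> borel_measurable P"
    "\<And>x. 0 \<le> p x" "\<And>x. p x \<le> (1::real)"
    "P = density (sum_measure P Q) p" "Q = density (sum_measure P Q) (\<lambda>x. 1 - p x)"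
    using common_density[OF P Q sets_eq] by metis
  have [measurable]: "p \<in> borel_measurable (sum_measure P Q)"
    using p(1) by (simp cong: measurable_cong_sets)
  note [measurable] = borel_measurable_integrable[OF h]
  have "(LINT x|density (sum_measure P Q) r. h x) \<le> (LINT x|sum_measure P Q. h x)"
    if [measurable]: "r \<in> borel_measurable (sum_measure P Q)" and r: "\<And>x. 0 \<le> r x" "\<And>x. r x \<le> (1::real)" for r
  proof -
    have "(LINT x|density (sum_measure P Q) r. h x) = (LINT x|sum_measure P Q. r x * h x)"
      by (subst integral_real_density) (auto simp: r)
    also have "\<dots> \<le> (LINT x|sum_measure P Q. h x)"
    proof (rule integral_mono_AE'[OF h])
      show "AE x in sum_measure P Q. r x * h x \<le> h x"
        using nn r by (intro AE_I2) (simp add: mult_left_le_one_le)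
    qed (use nn in auto)
    finally show ?thesis .
  qed
  from this[of p] this[of "\<lambda>x. 1 - p x"]
  show "(LINT x|P. h x) \<le> (LINT x|sum_measure P Q. h x)" "(LINT x|Q. h x) \<le> (LINT x|sum_measure P Q. h x)"
    using p by auto
qed

section \<open>Affinity of the white noise laws\<close>

context
  fixes M :: "'w measure" and W :: "real \<Rightarrow> 'w \<Rightarrow> real" and n :: nat and f g :: "real \<Rightarrow> real"
  assumes W: "brownian_motion01 M W" and n: "n \<ge> 1" and f: "prob_density f" and g: "prob_density g"
begin

interpretation prob_space M using W by (simp add: brownian_motion01_def)

abbreviation (input) "incr_law h m \<equiv> distr M (\<Pi>\<^sub>M i\<in>{..<2 ^ m}. lborel) (white_noise_increments W n h m)"

text \<open>The equality is tensorisation of the Gaussian affinity. The inequality holds because the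
  increments are a measurable image of the path.\<close>

lemma affinity_white_noise_increments:
  shows "affinity (incr_law f m) (incr_law g m) = exp (- (real n / 2) * dyadic_energy (\<lambda>x. sqrt (f x) - sqrt (g x)) m)" (is ?eq)
    and "affinity (white_noise_law M W n f) (white_noise_law M W n g) \<le> exp (- (real n / 2) * dyadic_energy (\<lambda>x. sqrt (f x) - sqrt (g x)) m)" (is ?le)
proof -
  let ?L = "\<Pi>\<^sub>M i\<in>{..<2 ^ m}. (lborel :: real measure)"
  define a where "a h i = 2 * (LINT x|unit_lebesgue. indicator (dyadic_cell m i) x * sqrt (h x))" for h :: "real \<Rightarrow> real" and i
  define \<sigma> where "\<sigma> = sqrt (1 / (real n * 2 ^ m))"
  define p where "p h x = (\<Prod>i<2 ^ m. normal_density (a h i) \<sigma> (x i))" for h and x :: "nat \<Rightarrow> real"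
  have \<sigma>: "\<sigma> > 0" "\<sigma>\<^sup>2 = 1 / (real n * 2 ^ m)" using n by (auto simp: \<sigma>_def)
  have norm: "prob_space (density lborel (normal_density b \<sigma>))" for b using \<sigma>(1) by (rule prob_space_normal_density)
  have D: "incr_law h m = density ?L (p h)" for h
    unfolding white_noise_increments_distr(2)[OF W n] p_def a_def[symmetric] \<sigma>_def[symmetric]
    by (rule PiM_density) (auto intro: norm lborel.sigma_finite_measure_axioms normal_density_nonneg)
  have [measurable]: "p h \<in> borel_measurable ?L" for h unfolding p_def by measurable
  have pos: "p h x > 0" for h x unfolding p_def by (intro prod_pos) (simp add: normal_density_pos \<sigma>)
  have P: "prob_space (incr_law h m)" for h by (rule prob_space_distr[OF white_noise_increments_distr(1)[OF W n]])
  have d: "a f i - a g i = 2 * (LINT x|unit_lebesgue. indicator (dyadic_cell m i) x * (sqrt (f x) - sqrt (g x)))" for i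
  proof -
    have "integrable unit_lebesgue (\<lambda>x. indicator (dyadic_cell m i) x * sqrt (h x))" if "prob_density h" for h
      using set_integrable_sqrt_prob_density(1)[OF that]
      by (rule Bochner_Integration.integrable_bound) (use borel_measurable_integrable[OF set_integrable_sqrt_prob_density(1)[OF that]] in \<open>auto simp: indicator_def\<close>)
    then show ?thesis using f g by (simp add: a_def right_diff_distrib)
  qed
  have "(LINT x|?L. sqrt (p f x * p g x)) = (\<Prod>i<2 ^ m. LINT x|lborel. sqrt (normal_density (a f i) \<sigma> x * normal_density (a g i) \<sigma> x))"
    unfolding p_def by (rule integral_sqrt_prod) (auto intro: norm lborel.sigma_finite_measure_axioms normal_density_nonneg)
  also have "\<dots> = (\<Prod>i<2 ^ m. exp (- (a f i - a g i)\<^sup>2 / (8 * \<sigma>\<^sup>2)))"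
    by (intro prod.cong refl normal_density_affinity \<sigma>)
  also have "\<dots> = exp (\<Sum>i<2 ^ m. - (a f i - a g i)\<^sup>2 / (8 * \<sigma>\<^sup>2))" by (simp add: exp_sum)
  \<comment> \<open>With mean difference 2 d and variance 1 / (n 2^m), a cell contributes (2 d)^2 n
    2^m / 8 = (n / 2) 2^m d^2.\<close>
  also have "(\<Sum>i<2 ^ m. - (a f i - a g i)\<^sup>2 / (8 * \<sigma>\<^sup>2)) = - (real n / 2) * dyadic_energy (\<lambda>x. sqrt (f x) - sqrt (g x)) m"
    unfolding d dyadic_energy_def sum_distrib_left \<sigma>(2) by (intro sum.cong refl) (simp add: power_mult_distrib)
  finally have E: "(LINT x|?L. sqrt (p f x * p g x)) = exp (- (real n / 2) * dyadic_energy (\<lambda>x. sqrt (f x) - sqrt (g x)) m)" .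
  show ?eq
    unfolding E[symmetric] by (rule affinity_density[OF _ _ _ _ D P D P]) (auto intro: less_imp_le pos)
  define T where "T y = (\<lambda>i\<in>{..<2 ^ m}. y (real (Suc i) / 2 ^ m) - y (real i / 2 ^ m))" for y :: "real \<Rightarrow> real"
  have T: "T \<in> measurable path_borel ?L"
    unfolding T_def
  proof (rule measurable_restrict)
    fix i :: nat assume "i \<in> {..<2 ^ m}"
    then have u: "real (Suc i) / 2 ^ m \<in> {0..1}" "real i / 2 ^ m \<in> {0..1}" by (auto intro!: dyadic_unit simp del: of_nat_Suc)
    show "(\<lambda>y. y (real (Suc i) / 2 ^ m) - y (real i / 2 ^ m)) \<in> measurable path_borel lborel"
      using eval_measurable_path_borel[OF u(1)] eval_measurable_path_borel[OF u(2)] by simp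
  qed
  have T': "distr (white_noise_law M W n h) ?L T = density ?L (p h)" if h: "prob_density h" for h
  proof -
    have "distr (white_noise_law M W n h) ?L T = distr M ?L (T \<circ> white_noise_path W n h)"
      unfolding white_noise_law_distr[OF W] by (rule distr_distr[OF T white_noise_path_measurable[OF W h]])
    also have "T \<circ> white_noise_path W n h = white_noise_increments W n h m"
      by (rule ext) (simp add: T_def white_noise_increments_path[OF W h] del: of_nat_Suc)
    finally show ?thesis unfolding D .
  qed
  have T2: "T \<in> measurable (white_noise_law M W n f) ?L"
    using T by (simp add: white_noise_law_distr[OF W])
  show ?le
    unfolding E[symmetric]
    by (rule affinity_le_distr[OF prob_space_white_noise_law[OF W f] prob_space_white_noise_law[OF W g] _ T2 _ _ pos pos T'[OF f] T'[OF g]])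
      (simp_all add: white_noise_law_distr[OF W])
qed

text \<open>A test function of the dyadic evaluations is almost surely one of the increments, so its
  functional on path space equals a functional of the finite-dimensional Gaussian laws and is
  bounded below by their affinity.\<close>

lemma cylinder_variational_bound:
  assumes w: "w \<in> borel_measurable (\<Pi>\<^sub>M i\<in>{..2 ^ m}. borel)"
    and wb: "\<And>x. 1 / c \<le> w x" "\<And>x. w x \<le> c" "0 < (c::real)"
  shows "exp (- (real n / 2) * dyadic_energy (\<lambda>x. sqrt (f x) - sqrt (g x)) m) \<le>
    ((LINT y|white_noise_law M W n f. w (dyadic_eval m y)) + (LINT y|white_noise_law M W n g. 1 / w (dyadic_eval m y))) / 2"
proof -
  let ?L = "\<Pi>\<^sub>M i\<in>{..<2 ^ m}. (lborel :: real measure)"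
  \<comment> \<open>partial sums recover the path from its increments, almost surely because \<open>W 0 = 0\<close> only a.s.\<close>
  define C where "C x = (\<lambda>j\<in>{..2 ^ m}. \<Sum>i<j. x i)" for x :: "nat \<Rightarrow> real"
  have C: "C \<in> measurable ?L (\<Pi>\<^sub>M i\<in>{..2 ^ m}. borel)"
    unfolding C_def
  proof (rule measurable_restrict)
    fix j :: nat assume "j \<in> {..2 ^ m}"
    then have "(\<lambda>x. x i) \<in> measurable ?L lborel" if "i \<in> {..<j}" for i
      using that by (intro measurable_component_singleton) auto
    then show "(\<lambda>x. \<Sum>i<j. x i) \<in> borel_measurable ?L"
      by (intro borel_measurable_sum) simp
  qed
  have DC: "AE \<omega> in M. dyadic_eval m (white_noise_path W n h \<omega>) = C (white_noise_increments W n h m \<omega>)"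
    if h: "prob_density h" for h
  proof -
    have "AE \<omega> in M. W 0 \<omega> = 0" using W by (simp add: brownian_motion01_def)
    then show ?thesis
    proof eventually_elim
      case (elim \<omega>)
      let ?y = "white_noise_path W n h \<omega>"
      have "AE x in lborel. x \<noteq> (0::real)" by (rule AE_lborel_singleton)
      then have "AE x in lborel. indicator {0..0} x *\<^sub>R sqrt (h x) = 0"
        by eventually_elim (simp add: indicator_def)
      then have "(LBINT s:{0..0}. sqrt (h s)) = 0"
        unfolding set_lebesgue_integral_def by (rule integral_eq_zero_AE)
      then have y0: "?y 0 = 0" using elim by (simp add: white_noise_path_def)
      have "(\<Sum>i<j. white_noise_increments W n h m \<omega> i) = ?y (real j / 2 ^ m)" if "j \<le> 2 ^ m" for j
      proof -
        have "(\<Sum>i<j. white_noise_increments W n h m \<omega> i) = (\<Sum>i<j. ?y (real (Suc i) / 2 ^ m) - ?y (real i / 2 ^ m))"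
          using that by (intro sum.cong refl) (auto simp: white_noise_increments_path[OF W h] simp del: of_nat_Suc)
        also have "\<dots> = ?y (real j / 2 ^ m) - ?y (real 0 / 2 ^ m)" by (rule sum_lessThan_telescope)
        finally show ?thesis using y0 by simp
      qed
      then show ?case unfolding dyadic_eval_def C_def by (intro restrict_ext) simp
    qed
  qed
  have I: "(LINT y|white_noise_law M W n h. v (dyadic_eval m y)) = (LINT x|incr_law h m. v (C x))"
    if h: "prob_density h" and v: "v \<in> borel_measurable (\<Pi>\<^sub>M i\<in>{..2 ^ m}. borel)" for h and v :: "(nat \<Rightarrow> real) \<Rightarrow> real"
  proof -
    have "(LINT y|white_noise_law M W n h. v (dyadic_eval m y)) = (LINT \<omega>|M. v (dyadic_eval m (white_noise_path W n h \<omega>)))"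
      unfolding white_noise_law_distr[OF W]
      by (rule integral_distr[OF white_noise_path_measurable[OF W h] measurable_compose[OF dyadic_eval_measurable_path_borel v]])
    also have "\<dots> = (LINT \<omega>|M. v (C (white_noise_increments W n h m \<omega>)))"
    proof (rule integral_cong_AE)
      show "(\<lambda>\<omega>. v (dyadic_eval m (white_noise_path W n h \<omega>))) \<in> borel_measurable M"
        by (rule measurable_compose[OF white_noise_path_measurable[OF W h] measurable_compose[OF dyadic_eval_measurable_path_borel v]])
      show "(\<lambda>\<omega>. v (C (white_noise_increments W n h m \<omega>))) \<in> borel_measurable M"
        by (rule measurable_compose[OF white_noise_increments_distr(1)[OF W n] measurable_compose[OF C v]])
      show "AE \<omega> in M. v (dyadic_eval m (white_noise_path W n h \<omega>)) = v (C (white_noise_increments W n h m \<omega>))"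
        using DC[OF h] by eventually_elim simp
    qed
    also have "\<dots> = (LINT x|incr_law h m. v (C x))"
      by (rule integral_distr[OF white_noise_increments_distr(1)[OF W n] measurable_compose[OF C v], symmetric])
    finally show ?thesis .
  qed
  have P: "prob_space (incr_law h m)" for h by (rule prob_space_distr[OF white_noise_increments_distr(1)[OF W n]])
  have wpos: "w x > 0" for x using wb(1)[of x] wb(3) by (meson divide_pos_pos less_le_trans zero_less_one)
  have w2: "1 / w x \<le> c" for x using wb(1)[of x] wb(3) wpos[of x] by (simp add: field_simps)
  have wC: "(\<lambda>x. w (C x)) \<in> borel_measurable (incr_law h m)" for h
    using measurable_compose[OF C w] by simp
  have "exp (- (real n / 2) * dyadic_energy (\<lambda>x. sqrt (f x) - sqrt (g x)) m) = affinity (incr_law f m) (incr_law g m)"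
    by (rule affinity_white_noise_increments(1)[symmetric])
  also have "\<dots> \<le> ((LINT x|incr_law f m. w (C x)) + (LINT x|incr_law g m. 1 / w (C x))) / 2"
  proof (rule affinity_le_variational[OF P P])
    show "integrable (incr_law f m) (\<lambda>x. w (C x))"
      by (rule finite_measure.integrable_const_bound[OF prob_space.finite_measure[OF P], of _ c])
         (use wC wb wpos in \<open>auto simp: less_imp_le\<close>)
    show "integrable (incr_law g m) (\<lambda>x. 1 / w (C x))"
      by (rule finite_measure.integrable_const_bound[OF prob_space.finite_measure[OF P], of _ c])
         (use wC w2 wpos in \<open>auto simp: less_imp_le abs_of_pos\<close>)
  qed (use wpos in auto)
  also have "(LINT x|incr_law f m. w (C x)) = (LINT y|white_noise_law M W n f. w (dyadic_eval m y))"
    by (rule I[OF f w, symmetric])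
  also have "(LINT x|incr_law g m. 1 / w (C x)) = (LINT y|white_noise_law M W n g. 1 / w (dyadic_eval m y))"
    by (rule I[OF g, symmetric]) (use w in simp)
  finally show ?thesis .
qed

lemma affinity_white_noise_law:
  "affinity (white_noise_law M W n f) (white_noise_law M W n g) = exp (- (real n / 2) * (LBINT x:{0..1}. (sqrt (f x) - sqrt (g x))\<^sup>2))"
    (is "affinity ?P ?Q = exp (- (real n / 2) * ?I)")
proof (rule antisym)
  let ?\<delta> = "\<lambda>x. sqrt (f x) - sqrt (g x)"
  have fm[measurable]: "f \<in> borel_measurable unit_lebesgue" "g \<in> borel_measurable unit_lebesgue"
    using prob_densityD f g by auto
  have dm: "?\<delta> \<in> borel_measurable unit_lebesgue" by measurable
  have dsq: "integrable unit_lebesgue (\<lambda>x. (?\<delta> x)\<^sup>2)"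
  proof (rule Bochner_Integration.integrable_bound)
    show "integrable unit_lebesgue (\<lambda>x. f x + g x)" using prob_densityD(3) f g by auto
    show "AE x in unit_lebesgue. norm ((?\<delta> x)\<^sup>2) \<le> norm (f x + g x)"
    proof (rule AE_I2)
      fix x assume "x \<in> space unit_lebesgue"
      then have nn: "0 \<le> f x" "0 \<le> g x" using prob_densityD(2) f g by auto
      then have "(?\<delta> x)\<^sup>2 = f x + g x - 2 * (sqrt (f x) * sqrt (g x))" by (simp add: power2_diff)
      moreover have "0 \<le> sqrt (f x) * sqrt (g x)" using nn by simp
      ultimately have "(?\<delta> x)\<^sup>2 \<le> f x + g x" by linarith
      then show "norm ((?\<delta> x)\<^sup>2) \<le> norm (f x + g x)" using nn by simp
    qed
  qed measurable
  have I: "?I = (LINT x|unit_lebesgue. (?\<delta> x)\<^sup>2)" by (rule set_integral_unit_lebesgue)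
  show "affinity ?P ?Q \<le> exp (- (real n / 2) * ?I)"
  proof (rule ccontr)
    assume "\<not> ?thesis"
    then have lt: "exp (- (real n / 2) * ?I) < affinity ?P ?Q" by simp
    then have pos: "0 < affinity ?P ?Q" using exp_gt_zero less_trans by blast
    \<comment> \<open>The value of the integral that would match the affinity exactly. If it were
      smaller than I, some level would have energy above J and its bound would be violated.\<close>
    define J where "J = - (2 / real n) * ln (affinity ?P ?Q)"
    have "- (real n / 2) * ?I < ln (affinity ?P ?Q)" using lt pos by (metis exp_less_cancel_iff exp_ln)
    then have "?I - J > 0" using n by (simp add: J_def field_simps)
    from dyadic_energy_approx[OF dm dsq this] obtain m where m: "J < dyadic_energy ?\<delta> m" unfolding I by auto
    have "ln (affinity ?P ?Q) \<le> - (real n / 2) * dyadic_energy ?\<delta> m"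
      using affinity_white_noise_increments(2)[of m] pos by (metis exp_le_cancel_iff exp_ln)
    then have "dyadic_energy ?\<delta> m \<le> J" using n by (simp add: J_def field_simps)
    with m show False by simp
  qed
  let ?S = "sum_measure ?P ?Q"
  note pP = prob_space_white_noise_law[OF W f] and pQ = prob_space_white_noise_law[OF W g]
  have sP: "sets ?P = sets path_borel" and sQ: "sets ?Q = sets path_borel" and s: "sets ?Q = sets ?P"
    by (simp_all add: white_noise_law_distr[OF W])
  have fin: "finite_measure ?S" using common_density[OF pP pQ s] by metis
  show "exp (- (real n / 2) * ?I) \<le> affinity ?P ?Q"
  proof (rule field_le_epsilon)
    fix e :: real assume e: "e > 0"
    then have "e / 2 > 0" by simp
    from affinity_variational_attained[OF pP pQ s this] obtain u c where u: "u \<in> borel_measurable ?P" "0 < c"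
      "\<And>x. 1 / c \<le> u x" "\<And>x. u x \<le> c" "((LINT x|?P. u x) + (LINT x|?Q. 1 / u x)) / 2 \<le> affinity ?P ?Q + e / 2" by metis
    have uP: "u \<in> borel_measurable path_borel" using u(1) sP by (simp cong: measurable_cong_sets)
    have upos: "u x > 0" for x using u(2) u(3)[of x] by (meson divide_pos_pos less_le_trans zero_less_one)
    have c1: "1 / c \<le> c" using u(3,4) order_trans by blast
    have bi: "integrable N h" if "finite_measure N" "sets N = sets path_borel" "h \<in> borel_measurable path_borel" "\<And>y. 0 \<le> h y" "\<And>y. h y \<le> c"
      for N and h :: "(real \<Rightarrow> real) \<Rightarrow> real"
      by (rule finite_measure.integrable_const_bound[OF that(1), of _ c]) (use that in \<open>auto cong: measurable_cong_sets\<close>)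
    have sS: "sets ?S = sets path_borel" using sP by simp
    have iu: "integrable ?S u" using bi[OF fin sS uP] u(4) upos by (simp add: less_imp_le)
    \<comment> \<open>The exchange of \<open>u\<close> for \<open>w\<close> costs \<eta> under P and
      c^2 \<eta> under Q, together e; halving leaves e / 2 beside the e / 2 already spent on
      \<open>u\<close>.\<close>
    define \<eta> where "\<eta> = e / (1 + c\<^sup>2)"
    have c2: "1 + c\<^sup>2 > 0" by (simp add: add_pos_nonneg)
    have "\<eta> > 0" using e c2 by (simp add: \<eta>_def)
    from cylinder_functions_dense[OF fin sS iu this] obtain m w0 where w0: "w0 \<in> borel_measurable (\<Pi>\<^sub>M i\<in>{..2 ^ m}. borel)"
      "integrable ?S (\<lambda>y. w0 (dyadic_eval m y))" "(LINT y|?S. \<bar>u y - w0 (dyadic_eval m y)\<bar>) < \<eta>" by blast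
    \<comment> \<open>Clamping to the interval that contains the values of \<open>u\<close> brings
      \<open>w\<close> no further from \<open>u\<close> and keeps \<open>1 / w\<close> bounded by
      \<open>c\<close>.\<close>
    define w where "w x = max (1 / c) (min c (w0 x))" for x
    have w: "w \<in> borel_measurable (\<Pi>\<^sub>M i\<in>{..2 ^ m}. borel)" unfolding w_def using w0(1) by measurable
    have wb: "1 / c \<le> w x" "w x \<le> c" for x using c1 by (auto simp: w_def)
    have wpos: "w x > 0" for x using u(2) wb(1)[of x] by (meson divide_pos_pos less_le_trans zero_less_one)
    let ?w = "\<lambda>y. w (dyadic_eval m y)"
    have wP: "?w \<in> borel_measurable path_borel" by (rule measurable_compose[OF dyadic_eval_measurable_path_borel w])
    have iw: "integrable ?S ?w" using bi[OF fin sS wP] wb wpos by (simp add: less_imp_le)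
    have dist: "\<bar>u y - ?w y\<bar> \<le> \<bar>u y - w0 (dyadic_eval m y)\<bar>" for y
      using u(3)[of y] u(4)[of y] unfolding w_def by linarith
    have inv: "1 / x \<le> c" if "1 / c \<le> x" "x > 0" for x :: real using that u(2) by (simp add: field_simps)
    have fP: "finite_measure ?P" and fQ: "finite_measure ?Q" using pP pQ by (auto intro: prob_space.finite_measure)
    have iD: "integrable ?S (\<lambda>y. \<bar>u y - ?w y\<bar>)" using iu iw by simp
    have D: "(LINT y|?S. \<bar>u y - ?w y\<bar>) \<le> \<eta>"
    proof -
      have "(LINT y|?S. \<bar>u y - ?w y\<bar>) \<le> (LINT y|?S. \<bar>u y - w0 (dyadic_eval m y)\<bar>)"
        by (rule integral_mono[OF iD _ dist]) (use iu w0(2) in simp)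
      then show ?thesis using w0(3) by simp
    qed
    note le = integral_le_sum_measure[OF pP pQ s iD]
    have u1: "(\<lambda>y. 1 / u y) \<in> borel_measurable path_borel" and w1: "(\<lambda>y. 1 / ?w y) \<in> borel_measurable path_borel"
      using uP wP by measurable
    note iPu = bi[OF fP sP uP, OF less_imp_le[OF upos] u(4)]
    note iPw = bi[OF fP sP wP, OF less_imp_le[OF wpos] wb(2)]
    have iQu: "integrable ?Q (\<lambda>y. 1 / u y)" by (rule bi[OF fQ sQ u1]) (auto intro: inv u(3) upos less_imp_le)
    have iQw: "integrable ?Q (\<lambda>y. 1 / ?w y)" by (rule bi[OF fQ sQ w1]) (auto intro: inv wb(1) wpos less_imp_le)
    note iQu' = bi[OF fQ sQ uP, OF less_imp_le[OF upos] u(4)]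
    note iQw' = bi[OF fQ sQ wP, OF less_imp_le[OF wpos] wb(2)]
    have "(LINT y|?P. ?w y) \<le> (LINT y|?P. u y + \<bar>u y - ?w y\<bar>)"
      using iPu iPw by (intro integral_mono) auto
    also have "\<dots> \<le> (LINT y|?P. u y) + \<eta>" using iPu iPw le(1) D by simp
    finally have 1: "(LINT y|?P. ?w y) \<le> (LINT y|?P. u y) + \<eta>" .
    have "(LINT y|?Q. 1 / ?w y) \<le> (LINT y|?Q. 1 / u y + c\<^sup>2 * \<bar>u y - ?w y\<bar>)"
    proof (rule integral_mono[OF iQw])
      fix y
      \<comment> \<open>On [1 / c, c] the reciprocal is Lipschitz with constant c^2.\<close>
      have "1 / ?w y - 1 / u y = (u y - ?w y) * (1 / ?w y * (1 / u y))"
        using upos[of y] wpos[of "dyadic_eval m y"] by (simp add: field_simps)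
      also have "\<dots> \<le> \<bar>u y - ?w y\<bar> * (1 / ?w y * (1 / u y))"
        using upos[of y] wpos[of "dyadic_eval m y"] by (intro mult_right_mono) auto
      also have "\<dots> \<le> \<bar>u y - ?w y\<bar> * (c * c)"
        using upos[of y] wpos[of "dyadic_eval m y"] u(2,3) wb(1) by (intro mult_left_mono mult_mono inv) auto
      finally show "1 / ?w y \<le> 1 / u y + c\<^sup>2 * \<bar>u y - ?w y\<bar>" by (simp add: power2_eq_square mult.commute)
    qed (use iQu iQu' iQw' in simp)
    also have "\<dots> = (LINT y|?Q. 1 / u y) + c\<^sup>2 * (LINT y|?Q. \<bar>u y - ?w y\<bar>)" using iQu iQu' iQw' by simp
    also have "\<dots> \<le> (LINT y|?Q. 1 / u y) + c\<^sup>2 * \<eta>" using le(2) D by (intro add_left_mono mult_left_mono) auto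
    finally have 2: "(LINT y|?Q. 1 / ?w y) \<le> (LINT y|?Q. 1 / u y) + c\<^sup>2 * \<eta>" .
    have "\<eta> * (1 + c\<^sup>2) = e" using c2 by (simp add: \<eta>_def)
    then have "\<eta> + c\<^sup>2 * \<eta> = e" by (simp add: algebra_simps)
    then have "((LINT y|?P. ?w y) + (LINT y|?Q. 1 / ?w y)) / 2 \<le> affinity ?P ?Q + e"
      using 1 2 u(5) by (simp add: field_simps)
    moreover have "exp (- (real n / 2) * ?I) \<le> exp (- (real n / 2) * dyadic_energy ?\<delta> m)"
      using dyadic_energy_le[OF dm dsq, of m] n unfolding I by simp
    moreover have "exp (- (real n / 2) * dyadic_energy ?\<delta> m) \<le> ((LINT y|?P. ?w y) + (LINT y|?Q. 1 / ?w y)) / 2"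
      by (rule cylinder_variational_bound[OF w wb u(2)])
    ultimately show "exp (- (real n / 2) * ?I) \<le> affinity ?P ?Q + e" by linarith
  qed
qed

end

section \<open>Comparison of the two experiments\<close>

text \<open>For the lower bound on (1 - x)^n: multiplying exp (- x) (1 + x) <= 1 by 1 - x gives exp
  (- x) (1 - x^2) <= 1 - x, and Bernoulli's inequality bounds (1 - x^2)^n below by 1 - n x^2. With y
  = n x the gap is at most y^2 exp (- y) / n.\<close>

lemma exp_minus_power_le:
  fixes x :: real
  assumes n: "n > 1" and x: "0 \<le> x" "x \<le> 1"
  shows "(1 - x) ^ n \<le> exp (- (real n * x))" "exp (- (real n * x)) - (1 - x) ^ n \<le> ln (real n) / real n"
proof -
  have e: "exp (- (real n * x)) = exp (- x) ^ n" by (simp flip: exp_of_nat_mult)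
  have "1 - x \<le> exp (- x)" using exp_ge_add_one_self[of "-x"] by simp
  then show "(1 - x) ^ n \<le> exp (- (real n * x))" unfolding e using x by (intro power_mono) auto
  define y where "y = real n * x"
  have y: "y \<ge> 0" using x by (simp add: y_def)
  have x2: "x\<^sup>2 \<le> 1" using x by (simp add: power_le_one)
  have "exp (- x) * (1 - x\<^sup>2) \<le> 1 - x"
  proof -
    have "exp (- x) * (1 + x) \<le> exp (- x) * exp x" by (intro mult_left_mono exp_ge_add_one_self) auto
    then have "exp (- x) * (1 + x) \<le> 1" by (simp flip: exp_add)
    then have "(1 - x) * (exp (- x) * (1 + x)) \<le> (1 - x) * 1" using x by (intro mult_left_mono) auto
    then show ?thesis by (simp add: power2_eq_square algebra_simps)
  qed
  then have "(exp (- x) * (1 - x\<^sup>2)) ^ n \<le> (1 - x) ^ n" using x2 by (intro power_mono) auto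
  moreover have "exp (- x) ^ n * (1 - real n * x\<^sup>2) \<le> (exp (- x) * (1 - x\<^sup>2)) ^ n"
    unfolding power_mult_distrib using Bernoulli_inequality[of "- x\<^sup>2" n] x2
    by (intro mult_left_mono) auto
  ultimately have "exp (- x) ^ n - (1 - x) ^ n \<le> exp (- x) ^ n * (real n * x\<^sup>2)" by (simp add: algebra_simps)
  also have "\<dots> = y\<^sup>2 * exp (- y) / real n" using n unfolding e[symmetric] y_def by (simp add: power2_eq_square)
  also have "\<dots> \<le> ln (real n) / real n"
  proof (rule divide_right_mono)
    have "y\<^sup>2 * exp (- y) \<le> 2 / 3"
    proof -
      \<comment> \<open>The maximum of y^2 exp (- y) is 4 / e^2, attained at y = 2. The tangent of
        exp at 0, used at y / 2 - 1, gives exactly this value; it lies below ln 2, and n > 1 turns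
        ln 2 into ln n.\<close>
      have "y / 2 \<le> exp (y / 2 - 1)" using exp_ge_add_one_self[of "y / 2 - 1"] by simp
      then have "(y / 2)\<^sup>2 \<le> (exp (y / 2 - 1))\<^sup>2" using y by (intro power_mono) auto
      also have "(exp (y / 2 - 1))\<^sup>2 = exp y / exp 2" by (simp add: power2_eq_square flip: exp_add exp_diff)
      finally have "y\<^sup>2 \<le> 4 / exp 2 * exp y" by (simp add: power_divide field_simps)
      then have "y\<^sup>2 * exp (- y) \<le> 4 / exp 2" by (simp add: exp_minus field_simps)
      also have "exp (2::real) \<ge> 6"
      proof -
        \<comment> \<open>Here e >= 1 + 1 + 1 / 2, and (5 / 2)^2 = 6.25 exceeds 6.\<close>
        have "5 / 2 \<le> exp (1::real)" using exp_lower_Taylor_quadratic[of 1] by simp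
        then have "5 / 2 * (5 / 2) \<le> exp (1::real) * exp 1" by (intro mult_mono) auto
        then show ?thesis by (simp flip: exp_add)
      qed
      then have "4 / exp (2::real) \<le> 2 / 3" by (simp add: field_simps)
      finally show ?thesis .
    qed
    also have "2 / 3 \<le> ln (2::real)" by (rule ln2_ge_two_thirds)
    also have "ln 2 \<le> ln (real n)" using n by simp
    finally show "y\<^sup>2 * exp (- y) \<le> ln (real n)" .
  qed simp
  finally show "exp (- (real n * x)) - (1 - x) ^ n \<le> ln (real n) / real n" unfolding e .
qed

section \<open>From affinities to the limit statements\<close>

text \<open>The two bounds say T + A >= 1 and T^2 + A^2 <= 1, which is symmetric in T and A; each
  implication is a sandwich between these.\<close>

lemma tv_dist_affinity_limits:
  assumes "eventually (\<lambda>n. 1 - A n \<le> T n \<and> (T n)\<^sup>2 \<le> 1 - (A n)\<^sup>2 \<and> 0 \<le> A n \<and> A n \<le> (1::real)) sequentially"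
  shows "T \<longlonglongrightarrow> 0 \<longleftrightarrow> A \<longlonglongrightarrow> 1" "T \<longlonglongrightarrow> 1 \<longleftrightarrow> A \<longlonglongrightarrow> 0"
proof -
  have T0: "eventually (\<lambda>n. 0 \<le> T n) sequentially"
    using assms by eventually_elim linarith
  have T2: "eventually (\<lambda>n. T n \<le> sqrt (1 - (A n)\<^sup>2)) sequentially"
    using assms by eventually_elim (auto intro: real_le_rsqrt)
  have A2: "eventually (\<lambda>n. A n \<le> sqrt (1 - (T n)\<^sup>2)) sequentially"
    using assms by eventually_elim (auto intro: real_le_rsqrt)
  have T1: "eventually (\<lambda>n. 1 - A n \<le> T n) sequentially"
    using assms by eventually_elim simp
  have A0: "eventually (\<lambda>n. 0 \<le> A n) sequentially" 
    using assms by eventually_elim simp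
  have A1: "eventually (\<lambda>n. A n \<le> 1) sequentially"
    using assms by eventually_elim simp
  have TT: "eventually (\<lambda>n. T n \<le> 1) sequentially"
    using T2 by eventually_elim (smt (verit, best) real_sqrt_le_1_iff zero_le_power2)
  show "T \<longlonglongrightarrow> 0 \<longleftrightarrow> A \<longlonglongrightarrow> 1"
  proof
    assume T: "T \<longlonglongrightarrow> 0"
    then have l: "(\<lambda>n. 1 - T n) \<longlonglongrightarrow> 1" by (auto intro!: tendsto_eq_intros)
    have "eventually (\<lambda>n. 1 - T n \<le> A n) sequentially" using T1 by eventually_elim simp
    then show "A \<longlonglongrightarrow> 1" by (rule real_tendsto_sandwich[OF _ A1 l tendsto_const])
  next
    assume "A \<longlonglongrightarrow> 1"
    then have l: "(\<lambda>n. sqrt (1 - (A n)\<^sup>2)) \<longlonglongrightarrow> 0" by (auto intro!: tendsto_eq_intros)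
    show "T \<longlonglongrightarrow> 0" by (rule real_tendsto_sandwich[OF T0 T2 tendsto_const l])
  qed
  show "T \<longlonglongrightarrow> 1 \<longleftrightarrow> A \<longlonglongrightarrow> 0"
  proof
    assume "T \<longlonglongrightarrow> 1"
    then have l: "(\<lambda>n. sqrt (1 - (T n)\<^sup>2)) \<longlonglongrightarrow> 0" by (auto intro!: tendsto_eq_intros)
    show "A \<longlonglongrightarrow> 0" by (rule real_tendsto_sandwich[OF A0 A2 tendsto_const l])
  next
    assume "A \<longlonglongrightarrow> 0"
    then have l: "(\<lambda>n. 1 - A n) \<longlonglongrightarrow> 1" by (auto intro!: tendsto_eq_intros)
    show "T \<longlonglongrightarrow> 1" by (rule real_tendsto_sandwich[OF T1 TT l tendsto_const])
  qed
qed

lemma exp_neg_half_limits: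
  fixes x :: "nat \<Rightarrow> real"
  shows "(\<lambda>n. exp (- x n / 2)) \<longlonglongrightarrow> 1 \<longleftrightarrow> x \<longlonglongrightarrow> 0"
    "(\<lambda>n. exp (- x n / 2)) \<longlonglongrightarrow> 0 \<longleftrightarrow> filterlim x at_top sequentially"
proof -
  have e: "x n = - 2 * ln (exp (- x n / 2))" for n by simp
  show "(\<lambda>n. exp (- x n / 2)) \<longlonglongrightarrow> 1 \<longleftrightarrow> x \<longlonglongrightarrow> 0"
  proof
    assume "(\<lambda>n. exp (- x n / 2)) \<longlonglongrightarrow> 1"
    then have "(\<lambda>n. - 2 * ln (exp (- x n / 2))) \<longlonglongrightarrow> - 2 * ln 1" by (intro tendsto_intros) auto
    then show "x \<longlonglongrightarrow> 0" unfolding e[symmetric] by simp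
  qed (auto intro!: tendsto_eq_intros)
  show "(\<lambda>n. exp (- x n / 2)) \<longlonglongrightarrow> 0 \<longleftrightarrow> filterlim x at_top sequentially"
  proof
    assume "(\<lambda>n. exp (- x n / 2)) \<longlonglongrightarrow> 0"
    then have l: "filterlim (\<lambda>n. exp (- x n / 2)) (at_right 0) sequentially"
      by (intro tendsto_imp_filterlim_at_right) auto
    have "filterlim (\<lambda>n. 2 * - ln (exp (- x n / 2))) at_top sequentially"
      by (intro filterlim_tendsto_pos_mult_at_top[OF tendsto_const] filterlim_compose[OF filterlim_uminus_at_top_at_bot]
          filterlim_compose[OF ln_at_0 l]) simp
    then show "filterlim x at_top sequentially" by simp
  next
    assume x: "filterlim x at_top sequentially"
    have "filterlim (\<lambda>n. 1 / 2 * x n) at_top sequentially"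
      by (rule filterlim_tendsto_pos_mult_at_top[OF tendsto_const _ x]) simp
    then have "filterlim (\<lambda>n. - (1 / 2 * x n)) at_bot sequentially" by (rule filterlim_compose[OF filterlim_uminus_at_bot_at_top])
    then have "(\<lambda>n. exp (- (1 / 2 * x n))) \<longlonglongrightarrow> 0" by (rule filterlim_compose[OF exp_at_bot])
    then show "(\<lambda>n. exp (- x n / 2)) \<longlonglongrightarrow> 0" by simp
  qed
qed

theorem lemma2:
  fixes f g :: "nat \<Rightarrow> real \<Rightarrow> real"
    and M :: "'w measure" and W :: "real \<Rightarrow> 'w \<Rightarrow> real"
  assumes W: "brownian_motion01 M W"
    and f: "\<And>n. n \<ge> 1 \<Longrightarrow> prob_density (f n)"
    and g: "\<And>n. n \<ge> 1 \<Longrightarrow> prob_density (g n)"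
  defines "P \<equiv> iid_law"
    and "Q \<equiv> white_noise_law M W"
    and "I \<equiv> \<lambda>n. LBINT x:{0..1}. (sqrt (f n x) - sqrt (g n x))\<^sup>2"
  shows
    "(((\<lambda>n. tv_dist (P n (f n)) (P n (g n))) \<longlonglongrightarrow> 0) \<longleftrightarrow>
        ((\<lambda>n. tv_dist (Q n (f n)) (Q n (g n))) \<longlonglongrightarrow> 0)) \<and>
     (((\<lambda>n. tv_dist (Q n (f n)) (Q n (g n))) \<longlonglongrightarrow> 0) \<longleftrightarrow>
        ((\<lambda>n. real n * I n) \<longlonglongrightarrow> 0)) \<and>
     (((\<lambda>n. tv_dist (P n (f n)) (P n (g n))) \<longlonglongrightarrow> 1) \<longleftrightarrow>
        ((\<lambda>n. tv_dist (Q n (f n)) (Q n (g n))) \<longlonglongrightarrow> 1)) \<and>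
     (((\<lambda>n. tv_dist (Q n (f n)) (Q n (g n))) \<longlonglongrightarrow> 1) \<longleftrightarrow>
        filterlim (\<lambda>n. real n * I n) at_top sequentially) \<and>
     (\<forall>n>1. hellinger_sq (Q n (f n)) (Q n (g n)) \<le> hellinger_sq (P n (f n)) (P n (g n)) \<and>
        hellinger_sq (P n (f n)) (P n (g n))
          \<le> hellinger_sq (Q n (f n)) (Q n (g n)) + 2 * ln (real n) / real n)"
proof -
  define A where "A n = affinity (P n (f n)) (P n (g n))" for n
  define B where "B n = affinity (Q n (f n)) (Q n (g n))" for n
  have hA: "hellinger_sq (P n (f n)) (P n (g n)) = 2 - 2 * A n" for n by (simp add: A_def affinity_def)
  have hB: "hellinger_sq (Q n (f n)) (Q n (g n)) = 2 - 2 * B n" for n by (simp add: B_def affinity_def)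
  have A: "A n = (1 - I n / 2) ^ n" if "n \<ge> 1" for n
    unfolding A_def P_def I_def by (rule affinity_iid_law[OF f[OF that] g[OF that]])
  have B: "B n = exp (- (real n * I n) / 2)" if "n \<ge> 1" for n
    unfolding B_def Q_def I_def affinity_white_noise_law[OF W that f[OF that] g[OF that]] by simp
  have I: "0 \<le> I n / 2" "I n / 2 \<le> 1" if "n \<ge> 1" for n
    using unit_hellinger_bounds[OF f[OF that] g[OF that]] by (auto simp: I_def)
  have AB: "A n \<le> B n" "B n - A n \<le> ln (real n) / real n" if n: "n > 1" for n
  proof -
    have "n \<ge> 1" using n by simp
    note * = exp_minus_power_le[OF n I[OF this]] A[OF this] B[OF this]
    show "A n \<le> B n" "B n - A n \<le> ln (real n) / real n" using * by simp_all
  qed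
  \<comment> \<open>The logarithmic comparison \<open>AB\<close> starts at n = 2, so the limits are
    taken over eventual statements.\<close>
  have n1: "eventually (\<lambda>n. (1::nat) < n) sequentially" by (rule eventually_gt_at_top)
  have eB: "eventually (\<lambda>n. exp (- (real n * I n) / 2) = B n) sequentially"
    using n1 by eventually_elim (simp add: B)
  have TA: "eventually (\<lambda>n. 1 - A n \<le> tv_dist (P n (f n)) (P n (g n)) \<and> (tv_dist (P n (f n)) (P n (g n)))\<^sup>2 \<le> 1 - (A n)\<^sup>2 \<and> 0 \<le> A n \<and> A n \<le> 1) sequentially"
    using n1
  proof eventually_elim
    case (elim n)
    then have "prob_density (f n)" "prob_density (g n)" using f g by auto
    then show ?case unfolding A_def P_def
      using tv_dist_affinity[OF iid_law_density(2) iid_law_density(2) sets_iid_law] by blast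
  qed
  have TB: "eventually (\<lambda>n. 1 - B n \<le> tv_dist (Q n (f n)) (Q n (g n)) \<and> (tv_dist (Q n (f n)) (Q n (g n)))\<^sup>2 \<le> 1 - (B n)\<^sup>2 \<and> 0 \<le> B n \<and> B n \<le> 1) sequentially"
    using n1
  proof eventually_elim
    case (elim n)
    then have fg: "prob_density (f n)" "prob_density (g n)" using f g by auto
    have "sets (white_noise_law M W n (g n)) = sets (white_noise_law M W n (f n))"
      by (simp add: white_noise_law_distr[OF W])
    then show ?case unfolding B_def Q_def
      using tv_dist_affinity[OF prob_space_white_noise_law[OF W fg(1)] prob_space_white_noise_law[OF W fg(2)]] by blast
  qed
  have "(\<lambda>n. B n - A n) \<longlonglongrightarrow> 0"
  proof (rule real_tendsto_sandwich)
    show "eventually (\<lambda>n. 0 \<le> B n - A n) sequentially" using n1 by eventually_elim (simp add: AB)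
    show "eventually (\<lambda>n. B n - A n \<le> ln (real n) / real n) sequentially" using n1 by eventually_elim (simp add: AB)
    show "(\<lambda>n. ln (real n) / real n) \<longlonglongrightarrow> 0" by (rule lim_ln_over_n)
  qed simp
  \<comment> \<open>Equal limits of the affinities transfer both equivalences between the
    experiments, so only the explicit \<open>B\<close> has to be related to n I.\<close>
  then have AB_lim: "A \<longlonglongrightarrow> l \<longleftrightarrow> B \<longlonglongrightarrow> l" for l
    using tendsto_add[of A l sequentially "\<lambda>n. B n - A n" 0] tendsto_diff[of B l sequentially "\<lambda>n. B n - A n" 0] by auto
  have B_lim: "B \<longlonglongrightarrow> 1 \<longleftrightarrow> (\<lambda>n. real n * I n) \<longlonglongrightarrow> 0"
    "B \<longlonglongrightarrow> 0 \<longleftrightarrow> filterlim (\<lambda>n. real n * I n) at_top sequentially"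
    unfolding exp_neg_half_limits[symmetric] tendsto_cong[OF eB] by auto
  \<comment> \<open>H^2 = 2 - 2 A reverses the order of the affinities and doubles their
    gap.\<close>
  have "hellinger_sq (Q n (f n)) (Q n (g n)) \<le> hellinger_sq (P n (f n)) (P n (g n)) \<and>
        hellinger_sq (P n (f n)) (P n (g n)) \<le> hellinger_sq (Q n (f n)) (Q n (g n)) + 2 * ln (real n) / real n"
    if "n > 1" for n
    unfolding hA hB using AB[OF that] by simp
  then show ?thesis
    unfolding tv_dist_affinity_limits[OF TA] tv_dist_affinity_limits[OF TB] AB_lim B_lim by simp
qed

end
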